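(* Let $\mathcal{P}$ be an $h$-happy portalgon with $n$ vertices and $m$ portal edges, and let $s$ and $t$ be two points in $\mathcal{P}$ (i.e. on its surface). Then a (minimum complexity) shortest path $\pi(s,t)$ between $s$ and $t$ has complexity $O(n+hm)$. This bound is tight in the worst case: there are $h$-happy portalgons, with $n$ vertices and $m$ portal edges, containing points $s,t$ for which the shortest path has complexity $\Omega(n+hm)$.
   Context: A portalgon is a pair $\mathcal{P}=(\mathcal{F},P)$ where $\mathcal{F}$ is a finite collection of simple polygons (fragments) and $P$ is a collection of portals. A portal is an unordered pair $e=(e^-,e^+)$ of distinct, directed, equally long edges (portal edges) of fragments of $\mathcal{F}$; each portal edge appears in exactly one portal. $n$ is the total number of vertices of the fragments and $m\le n$ the number of portal edges. The surface $\Sigma=\Sigma(\mathcal{P})$ is the quotient of $\bigcup_{F\in\mathcal{F}}F$ identifying corresponding points $p^-\in e^-$ and $p^+\in e^+$ of each portal $e$ (respecting directions). The length of a path in $\Sigma$ is the sum of the Euclidean lengths of its maximal subpaths inside fragments, and $d(s,t)$ is the infimum of lengths of paths between $s$ and $t$; $(\Sigma,d)$ is a geodesic metric space. A shortest path is polygonal and is described by an alternating sequence $s=v_1,E_1,v_2,\dots,E_k,v_{k+1}=t$ of vertices ($s$, $t$, or portalgon vertices) and sequences $E_i$ of portal edges crossed by the path; the total length of these sequences is the complexity of the path. $\pi(s,t)$ denotes an arbitrary minimum complexity shortest path between $s$ and $t$. Let $\Pi(p,q)$ be the set of all shortest paths between $p,q\in\Sigma$ and let $c(X)$ be the number of connected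 components of $X$. The happiness of a fragment $F$ is $\mathcal{H}(F)=\max_{p,q\in\Sigma}\max_{\pi\in\Pi(p,q)}c(F\cap\pi)$ (the maximum number of times a shortest path goes through $F$), the happiness of $\mathcal{P}$ is $\mathcal{H}(\mathcal{P})=\max_{F\in\mathcal{F}}\mathcal{H}(F)$, and $\mathcal{P}$ is $h$-happy if $\mathcal{H}(\mathcal{P})\le h$. *)

theory Defs
  imports "HOL-Analysis.Analysis"
begin

text \<open>The Euclidean plane is represented by the type \<^typ>\<open>complex\<close>.\<close>

section \<open>Simple polygons\<close>

text \<open>A polygon is given by the cyclic list of its vertices; side \<open>j\<close> joins vertex \<open>j\<close> to
  vertex \<open>j + 1\<close> (modulo the number of vertices).  Straight angles are allowed.\<close>

definition poly_vertex :: "complex list \<Rightarrow> nat \<Rightarrow> complex" where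
  "poly_vertex vs j = vs ! (j mod length vs)"

definition poly_side :: "complex list \<Rightarrow> nat \<Rightarrow> complex set" where
  "poly_side vs j = closed_segment (poly_vertex vs j) (poly_vertex vs (Suc j))"

definition poly_boundary :: "complex list \<Rightarrow> complex set" where
  "poly_boundary vs = (\<Union>j<length vs. poly_side vs j)"

definition poly_region :: "complex list \<Rightarrow> complex set" where
  "poly_region vs = poly_boundary vs \<union> inside (poly_boundary vs)"

text \<open>Two different sides meet in their common endpoints only.\<close>

definition simple_polygon :: "complex list \<Rightarrow> bool" where
  "simple_polygon vs \<longleftrightarrow> 3 \<le> length vs \<and> distinct vs \<and>
     (\<forall>j<length vs. \<forall>k<length vs. j \<noteq> k \<longrightarrow>
        poly_side vs j \<inter> poly_side vs k =
          {poly_vertex vs j, poly_vertex vs (Suc j)} \<inter> {poly_vertex vs k, poly_vertex vs (Suc k)})"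


section \<open>Portalgons\<close>

text \<open>A directed edge is side \<open>side_of e\<close> of fragment \<open>frag_of e\<close>, traversed from vertex \<open>side_of e\<close>
  to its successor if \<open>forward e\<close> holds, and the other way round otherwise.\<close>

datatype directed_edge = DEdge (frag_of: nat) (side_of: nat) (forward: bool)

text \<open>A portal is an unordered pair of directed edges, i.e. a set with two elements.\<close>

record portalgon =
  fragments :: "complex list list"
  portals :: "directed_edge set set"

abbreviation num_fragments :: "portalgon \<Rightarrow> nat" where
  "num_fragments P \<equiv> length (fragments P)"

definition fragment :: "portalgon \<Rightarrow> nat \<Rightarrow> complex set" where
  "fragment P i = poly_region (fragments P ! i)"

definition is_edge :: "portalgon \<Rightarrow> directed_edge \<Rightarrow> bool" where
  "is_edge P e \<longleftrightarrow> frag_of e < num_fragments P \<and> side_of e < length (fragments P ! frag_of e)"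

definition edge_start :: "portalgon \<Rightarrow> directed_edge \<Rightarrow> complex" where
  "edge_start P e = poly_vertex (fragments P ! frag_of e)
     (if forward e then side_of e else Suc (side_of e))"

definition edge_end :: "portalgon \<Rightarrow> directed_edge \<Rightarrow> complex" where
  "edge_end P e = poly_vertex (fragments P ! frag_of e)
     (if forward e then Suc (side_of e) else side_of e)"

definition edge_point :: "portalgon \<Rightarrow> directed_edge \<Rightarrow> real \<Rightarrow> complex" where
  "edge_point P e = linepath (edge_start P e) (edge_end P e)"

definition same_side :: "directed_edge \<Rightarrow> directed_edge \<Rightarrow> bool" where
  "same_side e e' \<longleftrightarrow> frag_of e = frag_of e' \<and> side_of e = side_of e'"

text \<open>The last condition says that every portal edge, regardless of the direction given to it,
  belongs to exactly one portal.\<close>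

definition is_portalgon :: "portalgon \<Rightarrow> bool" where
  "is_portalgon P \<longleftrightarrow>
     (\<forall>vs\<in>set (fragments P). simple_polygon vs) \<and>
     (\<forall>p\<in>portals P. \<exists>e e'. p = {e, e'} \<and> is_edge P e \<and> is_edge P e' \<and> \<not> same_side e e' \<and>
        dist (edge_start P e) (edge_end P e) = dist (edge_start P e') (edge_end P e')) \<and>
     (\<forall>p\<in>portals P. \<forall>q\<in>portals P. \<forall>e\<in>p. \<forall>e'\<in>q. same_side e e' \<longrightarrow> p = q)"

definition num_vertices :: "portalgon \<Rightarrow> nat" where
  "num_vertices P = (\<Sum>i<num_fragments P. length (fragments P ! i))"

definition num_portal_edges :: "portalgon \<Rightarrow> nat" where
  "num_portal_edges P = card (\<Union>(portals P))"


section \<open>The surface\<close>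

definition fragment_union :: "portalgon \<Rightarrow> (nat \<times> complex) topology" where
  "fragment_union P = sum_topology (\<lambda>i. top_of_set (fragment P i)) {..<num_fragments P}"

text \<open>The relation is symmetric, since a portal \<open>{e, e'}\<close> is an unordered pair.\<close>

definition glued :: "portalgon \<Rightarrow> nat \<times> complex \<Rightarrow> nat \<times> complex \<Rightarrow> bool" where
  "glued P x y \<longleftrightarrow> (\<exists>e e' l. {e, e'} \<in> portals P \<and> 0 \<le> l \<and> l \<le> 1 \<and>
      x = (frag_of e, edge_point P e l) \<and> y = (frag_of e', edge_point P e' l))"

definition to_surface :: "portalgon \<Rightarrow> nat \<times> complex \<Rightarrow> (nat \<times> complex) set" where
  "to_surface P x = {y. equivclp (glued P) x y}"

definition quotient_topology :: "'a topology \<Rightarrow> ('a \<Rightarrow> 'b) \<Rightarrow> 'b topology" where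
  "quotient_topology X f =
     topology (\<lambda>U. U \<subseteq> f ` topspace X \<and> openin X {x \<in> topspace X. f x \<in> U})"

lemma openin_quotient_topology:
  "openin (quotient_topology X f) U \<longleftrightarrow>
     U \<subseteq> f ` topspace X \<and> openin X {x \<in> topspace X. f x \<in> U}"
proof -
  have "istopology (\<lambda>U. U \<subseteq> f ` topspace X \<and> openin X {x \<in> topspace X. f x \<in> U})"
    unfolding istopology_def
  proof (intro conjI allI impI)
    fix S T
    assume "S \<subseteq> f ` topspace X \<and> openin X {x \<in> topspace X. f x \<in> S}"
      and "T \<subseteq> f ` topspace X \<and> openin X {x \<in> topspace X. f x \<in> T}"
    moreover have "{x \<in> topspace X. f x \<in> S \<inter> T} =
        {x \<in> topspace X. f x \<in> S} \<inter> {x \<in> topspace X. f x \<in> T}" by auto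
    ultimately show "S \<inter> T \<subseteq> f ` topspace X" "openin X {x \<in> topspace X. f x \<in> S \<inter> T}"
      by auto
  next
    fix \<K>
    assume *: "\<forall>K\<in>\<K>. K \<subseteq> f ` topspace X \<and> openin X {x \<in> topspace X. f x \<in> K}"
    have "{x \<in> topspace X. f x \<in> \<Union>\<K>} = (\<Union>K\<in>\<K>. {x \<in> topspace X. f x \<in> K})" by auto
    with * show "openin X {x \<in> topspace X. f x \<in> \<Union>\<K>}" by auto
    from * show "\<Union>\<K> \<subseteq> f ` topspace X" by blast
  qed
  then show ?thesis by (simp add: quotient_topology_def topology_inverse')
qed

lemma topspace_quotient_topology: "topspace (quotient_topology X f) = f ` topspace X"
proof
  show "topspace (quotient_topology X f) \<subseteq> f ` topspace X"
    using openin_quotient_topology[of X f "topspace (quotient_topology X f)"] by simp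
  have "{x \<in> topspace X. f x \<in> f ` topspace X} = topspace X" by auto
  then have "openin (quotient_topology X f) (f ` topspace X)"
    by (simp add: openin_quotient_topology)
  then show "f ` topspace X \<subseteq> topspace (quotient_topology X f)"
    by (rule openin_subset)
qed

lemma quotient_map_quotient_topology: "quotient_map X (quotient_topology X f) f"
  by (auto simp: quotient_map_def topspace_quotient_topology openin_quotient_topology)

definition surface :: "portalgon \<Rightarrow> (nat \<times> complex) set topology" where
  "surface P = quotient_topology (fragment_union P) (to_surface P)"

definition surface_vertices :: "portalgon \<Rightarrow> (nat \<times> complex) set set" where
  "surface_vertices P = {to_surface P (i, v) | i v. i < num_fragments P \<and> v \<in> set (fragments P ! i)}"


section \<open>Lengths, distances and shortest paths\<close>

text \<open>Euclidean length of \<open>g\<close> restricted to \<open>{a..b}\<close>: supremum over inscribed polygonal chains.\<close>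

definition curve_length :: "(real \<Rightarrow> complex) \<Rightarrow> real \<Rightarrow> real \<Rightarrow> ennreal" where
  "curve_length g a b =
     (SUP xs \<in> {xs. sorted xs \<and> set xs \<subseteq> {a..b}}.
        \<Sum>i<length xs - 1. ennreal (dist (g (xs ! i)) (g (xs ! Suc i))))"

text \<open>A decomposition of a path on the surface into finitely many subpaths, the \<open>j\<close>-th of which
  lies inside a single fragment: \<open>ps ! j\<close> consists of a fragment and of the subpath in it.\<close>

definition path_decomposition ::
  "portalgon \<Rightarrow> (real \<Rightarrow> (nat \<times> complex) set) \<Rightarrow> real list \<Rightarrow> (nat \<times> (real \<Rightarrow> complex)) list \<Rightarrow> bool"
  where
  "path_decomposition P \<gamma> ts ps \<longleftrightarrow>
     length ts = Suc (length ps) \<and> hd ts = 0 \<and> last ts = 1 \<and> sorted_wrt (<) ts \<and>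
     (\<forall>j<length ps. fst (ps ! j) < num_fragments P \<and>
        continuous_on {ts ! j..ts ! Suc j} (snd (ps ! j)) \<and>
        (\<forall>u\<in>{ts ! j..ts ! Suc j}. snd (ps ! j) u \<in> fragment P (fst (ps ! j)) \<and>
           \<gamma> u = to_surface P (fst (ps ! j), snd (ps ! j) u)))"

text \<open>The gluing maps are isometries of the edges, so that the sum of the lengths does not depend on
  the decomposition; a path which cannot be decomposed is given length \<open>\<infinity>\<close>.\<close>

definition path_length :: "portalgon \<Rightarrow> (real \<Rightarrow> (nat \<times> complex) set) \<Rightarrow> ennreal" where
  "path_length P \<gamma> =
     (INF (ts, ps) \<in> {(ts, ps). path_decomposition P \<gamma> ts ps}.
        \<Sum>j<length ps. curve_length (snd (ps ! j)) (ts ! j) (ts ! Suc j))"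

definition path_between ::
  "portalgon \<Rightarrow> (nat \<times> complex) set \<Rightarrow> (nat \<times> complex) set \<Rightarrow> (real \<Rightarrow> (nat \<times> complex) set) \<Rightarrow> bool"
  where
  "path_between P s t \<gamma> \<longleftrightarrow> pathin (surface P) \<gamma> \<and> \<gamma> 0 = s \<and> \<gamma> 1 = t"

definition surface_dist ::
  "portalgon \<Rightarrow> (nat \<times> complex) set \<Rightarrow> (nat \<times> complex) set \<Rightarrow> ennreal" where
  "surface_dist P s t = (INF \<gamma> \<in> {\<gamma>. path_between P s t \<gamma>}. path_length P \<gamma>)"

definition shortest_path ::
  "portalgon \<Rightarrow> (nat \<times> complex) set \<Rightarrow> (nat \<times> complex) set \<Rightarrow> (real \<Rightarrow> (nat \<times> complex) set) \<Rightarrow> bool"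
  where
  "shortest_path P s t \<gamma> \<longleftrightarrow>
     path_between P s t \<gamma> \<and> path_length P \<gamma> = surface_dist P s t \<and> path_length P \<gamma> < \<infinity>"


section \<open>Happiness\<close>

definition num_components :: "complex set \<Rightarrow> enat" where
  "num_components X = (if finite (components X) then enat (card (components X)) else \<infinity>)"

text \<open>The part of fragment \<open>i\<close> covered by a path.  It is a subset of the fragment before gluing:
  whenever the path leaves the fragment through a portal edge, even if it reenters
  the same fragment, a new connected component is started.\<close>

definition fragment_part :: "portalgon \<Rightarrow> nat \<Rightarrow> (real \<Rightarrow> (nat \<times> complex) set) \<Rightarrow> complex set" where
  "fragment_part P i \<gamma> = {x \<in> fragment P i. to_surface P (i, x) \<in> \<gamma> ` {0..1}}"

definition fragment_happiness :: "portalgon \<Rightarrow> nat \<Rightarrow> enat" where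
  "fragment_happiness P i =
     (SUP (p, q) \<in> topspace (surface P) \<times> topspace (surface P).
        SUP \<gamma> \<in> {\<gamma>. shortest_path P p q \<gamma>}. num_components (fragment_part P i \<gamma>))"

definition happiness :: "portalgon \<Rightarrow> enat" where
  "happiness P = (SUP i\<in>{..<num_fragments P}. fragment_happiness P i)"

definition happy :: "nat \<Rightarrow> portalgon \<Rightarrow> bool" where
  "happy h P \<longleftrightarrow> happiness P \<le> enat h"


section \<open>Complexity\<close>

text \<open>During \<open>{a..b}\<close> the path traverses a line segment from \<open>x\<close> to \<open>y\<close> inside fragment \<open>i\<close> (it may
  pause), without passing through a vertex of the portalgon in between.\<close>

definition straight_piece ::
  "portalgon \<Rightarrow> (real \<Rightarrow> (nat \<times> complex) set) \<Rightarrow> nat \<Rightarrow> complex \<Rightarrow> real \<Rightarrow> complex \<Rightarrow> real \<Rightarrow> bool"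
  where
  "straight_piece P \<gamma> i x a y b \<longleftrightarrow>
     a < b \<and> i < num_fragments P \<and> closed_segment x y \<subseteq> fragment P i \<and>
     (\<forall>z\<in>open_segment x y. to_surface P (i, z) \<notin> surface_vertices P) \<and>
     (\<exists>\<phi>. continuous_on {a..b} \<phi> \<and> mono_on {a..b} \<phi> \<and> \<phi> a = 0 \<and> \<phi> b = 1 \<and>
        (\<forall>u\<in>{a..b}. \<gamma> u = to_surface P (i, linepath x y (\<phi> u))))"

text \<open>\<open>crosses P \<gamma> i x a b E\<close>: during \<open>{a..b}\<close> the path, starting at the point \<open>x\<close> of fragment \<open>i\<close>,
  crosses exactly the portal edges \<open>E\<close>, in this order and in their relative interiors, and it is
  straight between consecutive crossings.  Of each portal crossed, the edge through which the path
  leaves is listed.\<close>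

inductive crosses ::
  "portalgon \<Rightarrow> (real \<Rightarrow> (nat \<times> complex) set) \<Rightarrow> nat \<Rightarrow> complex \<Rightarrow> real \<Rightarrow> real \<Rightarrow> directed_edge list \<Rightarrow> bool"
  for P \<gamma> where
  stay: "straight_piece P \<gamma> i x a y b \<Longrightarrow> crosses P \<gamma> i x a b []"
| cross: "{e, e'} \<in> portals P \<Longrightarrow> 0 < l \<Longrightarrow> l < 1 \<Longrightarrow>
    straight_piece P \<gamma> (frag_of e) x a (edge_point P e l) c \<Longrightarrow>
    crosses P \<gamma> (frag_of e') (edge_point P e' l) c b E \<Longrightarrow>
    crosses P \<gamma> (frag_of e) x a b (e # E)"

text \<open>The alternating sequence \<open>v\<^sub>1, E\<^sub>1, v\<^sub>2, \<dots>, E\<^sub>k, v\<^bsub>k+1\<^esub>\<close>, given by the list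
  \<open>vs\<close> of the \<open>v\<^sub>i\<close> and the list \<open>Es\<close> of the \<open>E\<^sub>i\<close>, describes the path.\<close>

definition describes ::
  "portalgon \<Rightarrow> (nat \<times> complex) set list \<Rightarrow> directed_edge list list \<Rightarrow>
   (real \<Rightarrow> (nat \<times> complex) set) \<Rightarrow> bool" where
  "describes P vs Es \<gamma> \<longleftrightarrow>
     length vs = Suc (length Es) \<and>
     (\<exists>ts. length ts = length vs \<and> hd ts = 0 \<and> last ts = 1 \<and> sorted_wrt (<) ts \<and>
        (\<forall>j<length vs. vs ! j = \<gamma> (ts ! j)) \<and>
        (\<forall>j. 0 < j \<and> j < length Es \<longrightarrow> vs ! j \<in> surface_vertices P) \<and>
        (\<forall>j<length Es. \<exists>i x. crosses P \<gamma> i x (ts ! j) (ts ! Suc j) (Es ! j)))"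

text \<open>The infimum only removes redundant crossings, which a description may list where the path runs
  along a portal edge or touches it at an endpoint of the path.  A path without any (finite)
  description has complexity \<open>\<infinity>\<close>.\<close>

definition path_complexity :: "portalgon \<Rightarrow> (real \<Rightarrow> (nat \<times> complex) set) \<Rightarrow> enat" where
  "path_complexity P \<gamma> =
     (INF (vs, Es) \<in> {(vs, Es). describes P vs Es \<gamma>}. enat (length vs + (\<Sum>E\<leftarrow>Es. length E)))"

definition min_complexity_shortest_path ::
  "portalgon \<Rightarrow> (nat \<times> complex) set \<Rightarrow> (nat \<times> complex) set \<Rightarrow> (real \<Rightarrow> (nat \<times> complex) set) \<Rightarrow> bool"
  where
  "min_complexity_shortest_path P s t \<gamma> \<longleftrightarrow>
     shortest_path P s t \<gamma> \<and>
     (\<forall>\<gamma>'. shortest_path P s t \<gamma>' \<longrightarrow> path_complexity P \<gamma> \<le> path_complexity P \<gamma>')"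

end

theory Submission
  imports Defs
begin

text \<open>Upper bound.  The gluing maps are isometries, so all decompositions of a path have the same length, and
  the pieces of a shortest path can be straightened inside their fragments: near a point of a polygon which is
  no vertex the polygon is convex, hence a shortest curve can only bend at vertices.  Take a shortest path made
  of the least possible number of segments.  Then consecutive segments are separated by a vertex of
  the surface, each of which occurs at most once, or by the crossing of a portal.  A crossing next to a
  segment that runs along a portal edge can be charged to a vertex or an endpoint of the path.  Any other crossing
  into a fragment starts a new connected component of the part of the fragment covered by the path, so
  there are at most \<open>h\<close> of them per fragment that has a portal edge.

  Lower bound.  If \<open>n\<close> dominates, take a row of unit squares, with the remaining vertices on the bottom side
  of the first one; the shortest path along the bottom passes through all of them.  If \<open>h m\<close>
  dominates, take \<open>m / 2\<close> parallel strips winding about \<open>h\<close> times around a flat annulus.  A shortest path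
  is a straight segment in the universal cover that turns at most half a time around the annulus, so it meets
  each strip at most \<open>h\<close> times, while the path straight across the annulus
  crosses each strip \<open>h - 2\<close> times.\<close>

text \<open>Happiness counts components of the preimage of the path before gluing, and in a fragment
  this preimage is larger than the curves drawn there: it also contains the partners of all points
  at which the path touches a portal edge. This shapes the count of crossings. A segment that merely
  ends on a portal edge contributes one isolated partner point, which can be moved between closed
  sets; a segment inside a portal edge contributes a whole copy of itself, which may join visits
  that are otherwise separate, so it is charged elsewhere. Taking the fewest segments, not the least
  complexity, turns every local simplification into a contradiction, and any shortest path bounds a
  path of least complexity from above. In the annulus the slanted sides have direction
  \<open>Complex A 1\<close> with \<open>A = real (k * B)\<close>, a multiple of the circumference
  \<open>k\<close>. Hence the upper end of such a side lies straight above its lower end, and the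
  path of length 1 between them crosses each of the \<open>k\<close> strips \<open>B\<close> times.
  A shortest lift turns by at most \<open>k / 2\<close>, which after rounding gives
  \<open>B + 2\<close> visits; so \<open>B = h - 2\<close>.\<close>

section \<open>Lengths of curves\<close>

fun chain_length :: "(real \<Rightarrow> complex) \<Rightarrow> real list \<Rightarrow> ennreal" where
  "chain_length f (x # y # zs) = ennreal (dist (f x) (f y)) + chain_length f (y # zs)"
| "chain_length f _ = 0"

lemma sum_eq_chain_length:
  "(\<Sum>i<length xs - 1. ennreal (dist (f (xs ! i)) (f (xs ! Suc i)))) = chain_length f xs"
proof (induction xs rule: induct_list012)
  case (3 x y zs)
  have "(\<Sum>i<length (x # y # zs) - 1. ennreal (dist (f ((x # y # zs) ! i)) (f ((x # y # zs) ! Suc i))))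
      = (\<Sum>i<Suc (length zs). ennreal (dist (f ((x # y # zs) ! i)) (f ((x # y # zs) ! Suc i))))"
    by simp
  also have "\<dots> = ennreal (dist (f x) (f y)) + chain_length f (y # zs)"
    by (subst sum.lessThan_Suc_shift) (use 3 in simp)
  finally show ?case by simp
qed auto

lemma curve_length_chain_length:
  "curve_length f a b = (SUP xs \<in> {xs. sorted xs \<and> set xs \<subseteq> {a..b}}. chain_length f xs)"
  unfolding curve_length_def sum_eq_chain_length ..

lemma chain_length_le_curve_length:
  "sorted xs \<Longrightarrow> set xs \<subseteq> {a..b} \<Longrightarrow> chain_length f xs \<le> curve_length f a b"
  unfolding curve_length_chain_length by (rule SUP_upper) auto

lemma curve_length_leI:
  "(\<And>xs. sorted xs \<Longrightarrow> set xs \<subseteq> {a..b} \<Longrightarrow> chain_length f xs \<le> l) \<Longrightarrow> curve_length f a b \<le> l"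
  unfolding curve_length_chain_length by (rule SUP_least) auto

lemma chain_length_cong:
  "(\<And>x. x \<in> set xs \<Longrightarrow> f x = g x) \<Longrightarrow> chain_length f xs = chain_length g xs"
  by (induction xs rule: induct_list012) auto

lemma curve_length_cong:
  "(\<And>x. x \<in> {a..b} \<Longrightarrow> f x = g x) \<Longrightarrow> curve_length f a b = curve_length g a b"
  unfolding curve_length_chain_length by (rule SUP_cong) (auto intro!: chain_length_cong)

lemma dist_le_curve_length:
  "a \<le> b \<Longrightarrow> ennreal (dist (f a) (f b)) \<le> curve_length f a b"
  using chain_length_le_curve_length[of "[a, b]" a b f] by simp

text \<open>Only an inequality, because the link between the two chains is dropped.\<close>

lemma chain_length_append: "chain_length f xs + chain_length f ys \<le> chain_length f (xs @ ys)"
proof (induction xs rule: induct_list012)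
  case (3 x y zs)
  then show ?case by (simp add: add.assoc add_left_mono)
next
  case (2 x)
  then show ?case by (cases ys) auto
qed auto

lemma curve_length_superadditive:
  assumes "a \<le> b" "b \<le> c"
  shows "curve_length f a b + curve_length f b c \<le> curve_length f a c"
proof -
  \<comment> \<open>The empty chain shows that the supremum ranges over a nonempty set, so the other
    summand may be moved inside.\<close>
  have "curve_length f a b + curve_length f b c =
    (SUP xs \<in> {xs. sorted xs \<and> set xs \<subseteq> {a..b}}. chain_length f xs + curve_length f b c)"
    unfolding curve_length_chain_length[of f a b]
    by (subst ennreal_SUP_add_left) (auto intro!: exI[of _ "[]"])
  also have "\<dots> \<le> curve_length f a c"
  proof (rule SUP_least)
    fix xs assume xs: "xs \<in> {xs. sorted xs \<and> set xs \<subseteq> {a..b}}"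
    have "chain_length f xs + curve_length f b c =
      (SUP ys \<in> {xs. sorted xs \<and> set xs \<subseteq> {b..c}}. chain_length f xs + chain_length f ys)"
      unfolding curve_length_chain_length[of f b c]
      by (subst ennreal_SUP_add_right) (auto intro!: exI[of _ "[]"])
    also have "\<dots> \<le> curve_length f a c"
    proof (rule SUP_least)
      fix ys assume ys: "ys \<in> {xs. sorted xs \<and> set xs \<subseteq> {b..c}}"
      have "chain_length f (xs @ ys) \<le> curve_length f a c"
        using xs ys assms by (intro chain_length_le_curve_length) (force simp: sorted_append)+
      then show "chain_length f xs + chain_length f ys \<le> curve_length f a c"
        using chain_length_append order_trans by blast
    qed
    finally show "chain_length f xs + curve_length f b c \<le> curve_length f a c" .
  qed
  finally show ?thesis .
qed

lemma curve_length_mono: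
  assumes "a \<le> a'" "b' \<le> b"
  shows "curve_length f a' b' \<le> curve_length f a b"
proof (rule curve_length_leI)
  fix xs assume "sorted xs" "set xs \<subseteq> {a'..b'}"
  then show "chain_length f xs \<le> curve_length f a b"
    using assms by (intro chain_length_le_curve_length) auto
qed

lemma chain_length_Cons_mono: "chain_length f ys \<le> chain_length f (b # ys)"
  by (cases ys) auto

lemma chain_length_insert:
  "chain_length f (xs @ ys) \<le> chain_length f (xs @ [b]) + chain_length f (b # ys)"
proof (induction xs rule: induct_list012)
  case (3 x y zs)
  then show ?case by (simp add: add.assoc add_left_mono)
next
  case 1
  then show ?case by (simp add: chain_length_Cons_mono)
next
  case (2 x)
  show ?case
  proof (cases ys)
    case (Cons y zs)
    have "ennreal (dist (f x) (f y)) \<le> ennreal (dist (f x) (f b)) + ennreal (dist (f b) (f y))"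
      by (simp add: ennreal_plus[symmetric] dist_triangle del: ennreal_plus)
    then show ?thesis using Cons by (simp add: add.assoc[symmetric] add_right_mono)
  qed auto
qed

text \<open>Inserting \<open>b\<close> into a chain never shortens it, by the triangle inequality,
  and then the chain splits at \<open>b\<close>.\<close>

lemma curve_length_subadditive:
  assumes "a \<le> b" "b \<le> c"
  shows "curve_length f a c \<le> curve_length f a b + curve_length f b c"
proof (rule curve_length_leI)
  fix zs assume zs: "sorted zs" "set zs \<subseteq> {a..c}"
  define xs where "xs = takeWhile (\<lambda>x. x \<le> b) zs"
  define ys where "ys = dropWhile (\<lambda>x. x \<le> b) zs"
  have eq: "zs = xs @ ys" by (simp add: xs_def ys_def)
  have xb: "\<forall>x\<in>set xs. x \<le> b" by (auto simp: xs_def dest: set_takeWhileD)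
  have yb: "\<forall>y\<in>set ys. b \<le> y"
  proof (cases ys)
    case (Cons y ys')
    have "\<not> y \<le> b" using Cons unfolding ys_def by (metis dropWhile_eq_Cons_conv)
    moreover have "sorted ys" using zs eq sorted_append by blast
    ultimately show ?thesis using Cons by auto
  qed auto
  have "chain_length f (xs @ [b]) \<le> curve_length f a b"
    using zs eq xb assms by (intro chain_length_le_curve_length) (auto simp: sorted_append)
  moreover have "chain_length f (b # ys) \<le> curve_length f b c"
    using zs eq yb assms by (intro chain_length_le_curve_length) (auto simp: sorted_append)
  ultimately show "chain_length f zs \<le> curve_length f a b + curve_length f b c"
    unfolding eq using chain_length_insert[of f xs ys b] add_mono order_trans by blast
qed

lemma curve_length_additive:
  "a \<le> b \<Longrightarrow> b \<le> c \<Longrightarrow> curve_length f a c = curve_length f a b + curve_length f b c"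
  by (intro antisym curve_length_subadditive curve_length_superadditive)

lemma chain_length_map: "chain_length (\<lambda>u. f (\<phi> u)) xs = chain_length f (map \<phi> xs)"
  by (induction xs rule: induct_list012) auto

text \<open>A monotone map takes chains of parameters to chains; where it pauses, entries repeat at
  distance 0.\<close>

lemma curve_length_reparam:
  assumes "mono_on {a..b} \<phi>" "\<phi> ` {a..b} \<subseteq> {c..d}"
  shows "curve_length (\<lambda>u. f (\<phi> u)) a b \<le> curve_length f c d"
proof (rule curve_length_leI)
  fix xs assume xs: "sorted xs" "set xs \<subseteq> {a..b}"
  have "sorted (map \<phi> xs)"
    unfolding sorted_map
    by (rule sorted_wrt_mono_rel[OF _ xs(1)]) (use xs(2) assms(1) in \<open>auto simp: monotone_on_def\<close>)
  then have "chain_length f (map \<phi> xs) \<le> curve_length f c d"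
    using xs assms(2) by (intro chain_length_le_curve_length) auto
  then show "chain_length (\<lambda>u. f (\<phi> u)) xs \<le> curve_length f c d" by (simp add: chain_length_map)
qed

lemma curve_length_linepath: "curve_length (linepath x y) 0 1 \<le> ennreal (dist x y)"
proof (rule curve_length_leI)
  \<comment> \<open>Bounding by the part of the segment after the first parameter makes the claim
    inductive.\<close>
  have *: "sorted xs \<Longrightarrow> set xs \<subseteq> {..1} \<Longrightarrow> xs \<noteq> [] \<Longrightarrow>
     chain_length (linepath x y) xs \<le> ennreal ((1 - hd xs) * dist x y)" for xs
  proof (induction xs rule: induct_list012)
    case (3 u v zs)
    have "linepath x y u - linepath x y v = (v - u) *\<^sub>R (x - y)"
      by (simp add: linepath_def algebra_simps)
    moreover have vd: "v * dist x y \<le> dist x y" using mult_right_mono[of v 1 "dist x y"] 3(4) by simp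
    ultimately have "dist (linepath x y u) (linepath x y v) = (v - u) * dist x y"
      using 3 by (simp add: dist_norm)
    then have "chain_length (linepath x y) (u # v # zs) \<le>
        ennreal ((v - u) * dist x y) + ennreal ((1 - v) * dist x y)"
      using 3 by (auto intro: add_left_mono)
    also have "\<dots> = ennreal ((1 - u) * dist x y)"
      using 3 vd by (subst ennreal_plus[symmetric]) (auto simp: left_diff_distrib mult_right_mono)
    finally show ?case by simp
  qed auto
  fix xs :: "real list" assume xs: "sorted xs" "set xs \<subseteq> {0..1}"
  show "chain_length (linepath x y) xs \<le> ennreal (dist x y)"
  proof (cases xs)
    case (Cons u us)
    moreover have "set xs \<subseteq> {..1}" using xs by auto
    ultimately have "chain_length (linepath x y) xs \<le> ennreal ((1 - u) * dist x y)"
      using *[of xs] xs by force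
    also have "\<dots> \<le> ennreal (dist x y)"
      using Cons xs by (intro ennreal_leI) (simp add: mult_left_le_one_le)
    finally show ?thesis .
  qed auto
qed

lemma curve_length_dist_cong:
  assumes "\<And>u v. u \<in> {a..b} \<Longrightarrow> v \<in> {a..b} \<Longrightarrow> dist (f u) (f v) = dist (g u) (g v)"
  shows "curve_length f a b = curve_length g a b"
proof -
  have "set xs \<subseteq> {a..b} \<Longrightarrow> chain_length f xs = chain_length g xs" for xs
    by (induction xs rule: induct_list012) (use assms in auto)
  then show ?thesis unfolding curve_length_chain_length by (intro SUP_cong) auto
qed

text \<open>Every point of such a curve attains equality in the triangle inequality, so it lies on
  the chord; by continuity the distance from \<open>f a\<close> takes all intermediate values, so
  the whole chord is covered.\<close>

lemma curve_length_straight: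
  assumes ab: "a \<le> b" and cont: "continuous_on {a..b} f"
    and len: "curve_length f a b \<le> ennreal (dist (f a) (f b))"
  shows "f ` {a..b} = closed_segment (f a) (f b)"
proof
  have split: "dist (f a) (f b) = dist (f a) (f u) + dist (f u) (f b)" if "u \<in> {a..b}" for u
  proof -
    have "ennreal (dist (f a) (f u) + dist (f u) (f b)) = chain_length f [a, u, b]"
      by simp
    also have "\<dots> \<le> curve_length f a b" using that by (intro chain_length_le_curve_length) auto
    finally have "dist (f a) (f u) + dist (f u) (f b) \<le> dist (f a) (f b)"
      using len by (subst ennreal_le_iff[symmetric]) (auto intro: order_trans)
    then show ?thesis using dist_triangle[of "f a" "f b" "f u"] by linarith
  qed
  show "f ` {a..b} \<subseteq> closed_segment (f a) (f b)"
  proof (rule image_subsetI)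
    fix u assume "u \<in> {a..b}"
    from split[OF this] show "f u \<in> closed_segment (f a) (f b)"
      by (simp add: between_mem_segment[symmetric] between)
  qed
  show "closed_segment (f a) (f b) \<subseteq> f ` {a..b}"
  proof
    fix z assume "z \<in> closed_segment (f a) (f b)"
    then have z: "dist (f a) (f b) = dist (f a) z + dist z (f b)"
      by (simp add: between_mem_segment[symmetric] between)
    have "\<exists>u\<ge>a. u \<le> b \<and> dist (f a) (f u) = dist (f a) z"
    proof (rule IVT')
      show "continuous_on {a..b} (\<lambda>u. dist (f a) (f u))"
        by (intro continuous_intros cont)
    qed (use z ab in auto)
    then obtain u where u: "u \<in> {a..b}" "dist (f a) (f u) = dist (f a) z" by auto
    have zs: "z \<in> closed_segment (f a) (f b)" by fact
    have us: "f u \<in> closed_segment (f a) (f b)"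
      using split[OF u(1)] by (simp add: between_mem_segment[symmetric] between)
    obtain s where s: "0 \<le> s" "z = f a + s *\<^sub>R (f b - f a)"
      using zs by (auto simp: in_segment algebra_simps)
    obtain t where t: "0 \<le> t" "f u = f a + t *\<^sub>R (f b - f a)"
      using us by (auto simp: in_segment algebra_simps)
    have "s * norm (f b - f a) = t * norm (f b - f a)"
      using u(2) s t by (simp add: dist_norm) metis
    then have "f b = f a \<or> s = t" by (metis mult_cancel_right norm_eq_zero right_minus_eq)
    then have "z = f u" using s t by auto
    then show "z \<in> f ` {a..b}" using u by auto
  qed
qed

text \<open>Jumping along the last times at which the curve is in one of the sets, each set is used
  only once.\<close>

lemma dist_le_curve_length_cover:
  assumes "finite I" "a \<le> b" "{a..b} \<subseteq> (\<Union>k\<in>I. K k)" "\<And>k. k \<in> I \<Longrightarrow> closed (K k)"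
    and "\<And>k u v. k \<in> I \<Longrightarrow> u \<in> K k \<Longrightarrow> v \<in> K k \<Longrightarrow> dist (f u) (f v) = dist (g u) (g v)"
  shows "ennreal (dist (f a) (f b)) \<le> curve_length g a b"
  using assms
proof (induction "card I" arbitrary: I a rule: less_induct)
  case less
  obtain k where k: "k \<in> I" "a \<in> K k" using less.prems by auto
  define a' where "a' = Sup (K k \<inter> {a..b})"
  have "compact (K k \<inter> {a..b})" using less.prems k by (simp add: closed_Int_compact)
  then have a': "a' \<in> K k \<inter> {a..b}"
    unfolding a'_def using k less.prems by (intro closed_contains_Sup) (auto simp: compact_imp_closed)
  have max: "u \<le> a'" if "u \<in> K k \<inter> {a..b}" for u
    unfolding a'_def using that by (intro cSup_upper) auto
  have 1: "ennreal (dist (f a) (f a')) \<le> curve_length g a a'"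
    using less.prems(5)[OF k(1) k(2), of a'] a' dist_le_curve_length[of a a' g] by simp
  show ?case
  proof (cases "a' = b")
    case False
    with a' have lt: "a' < b" by auto
    have sub: "{a'<..b} \<subseteq> (\<Union>j\<in>I - {k}. K j)"
    proof
      fix u assume u: "u \<in> {a'<..b}"
      then have "u \<in> {a..b}" "u \<notin> K k" using a' max[of u] by auto
      then show "u \<in> (\<Union>j\<in>I - {k}. K j)" using less.prems(3) by blast
    qed
    have "closed (\<Union>j\<in>I - {k}. K j)" using less.prems by (intro closed_UN) auto
    \<comment> \<open>The set \<open>K k\<close> is not met after \<open>a'\<close>. Passing to the
      closure puts \<open>a'\<close> itself into a remaining set, so that the induction hypothesis
      starts exactly there.\<close>
    then have "closure {a'<..b} \<subseteq> (\<Union>j\<in>I - {k}. K j)"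
      using sub by (intro closure_minimal)
    then have sub': "{a'..b} \<subseteq> (\<Union>j\<in>I - {k}. K j)" using lt by simp
    have 2: "ennreal (dist (f a') (f b)) \<le> curve_length g a' b"
    proof (rule less.hyps[rotated 4])
      show "card (I - {k}) < card I" using k less.prems(1) by (metis card_Diff1_less)
      show "finite (I - {k})" using less.prems(1) by simp
    qed (use lt sub' less.prems(4,5) in auto)
    have "ennreal (dist (f a) (f b)) \<le> ennreal (dist (f a) (f a')) + ennreal (dist (f a') (f b))"
      by (simp add: ennreal_plus[symmetric] dist_triangle del: ennreal_plus)
    also have "\<dots> \<le> curve_length g a a' + curve_length g a' b" using 1 2 by (rule add_mono)
    also have "\<dots> \<le> curve_length g a b" using a' by (intro curve_length_superadditive) auto
    finally show ?thesis .
  qed (use 1 in auto)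
qed

text \<open>The \<open>K k\<close> are closed sets of times and not intervals: two curves with the
  same image on the surface may switch infinitely often between the finitely many ways of being
  identified.\<close>

lemma curve_length_le_cover:
  assumes "finite I" "{a..b} \<subseteq> (\<Union>k\<in>I. K k)" "\<And>k. k \<in> I \<Longrightarrow> closed (K k)"
    and "\<And>k u v. k \<in> I \<Longrightarrow> u \<in> K k \<Longrightarrow> v \<in> K k \<Longrightarrow> dist (f u) (f v) = dist (g u) (g v)"
  shows "curve_length f a b \<le> curve_length g a b"
proof (rule curve_length_leI)
  have *: "sorted xs \<Longrightarrow> set xs \<subseteq> {a..b} \<Longrightarrow> xs \<noteq> [] \<Longrightarrow> chain_length f xs \<le> curve_length g (hd xs) b" for xs
  proof (induction xs rule: induct_list012)
    case (3 u v zs)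
    have "{u..v} \<subseteq> {a..b}" "u \<le> v" using 3(3,4) by auto
    then have "{u..v} \<subseteq> (\<Union>k\<in>I. K k)" using assms(2) by blast
    then have "ennreal (dist (f u) (f v)) \<le> curve_length g u v"
      by (rule dist_le_curve_length_cover[OF assms(1) \<open>u \<le> v\<close> _ assms(3,4)])
    then have "chain_length f (u # v # zs) \<le> curve_length g u v + curve_length g v b"
      using 3 by (auto intro: add_mono)
    also have "\<dots> \<le> curve_length g u b" using 3 by (intro curve_length_superadditive) auto
    finally show ?case by simp
  qed auto
  fix xs assume xs: "sorted xs" "set xs \<subseteq> {a..b}"
  show "chain_length f xs \<le> curve_length g a b"
  proof (cases xs)
    case (Cons u us)
    have "chain_length f xs \<le> curve_length g u b" using *[of xs] xs Cons by auto
    also have "\<dots> \<le> curve_length g a b" using xs Cons by (intro curve_length_mono) auto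
    finally show ?thesis .
  qed auto
qed

lemma curve_length_empty: "b \<le> a \<Longrightarrow> curve_length f a b = 0"
proof -
  assume "b \<le> a"
  then have "u = a" if "u \<in> {a..b}" for u using that by auto
  then have "curve_length f a b = curve_length (\<lambda>_. f a) a b" by (intro curve_length_cong) metis
  also have "\<dots> \<le> 0"
  proof (rule curve_length_leI)
    fix xs show "chain_length (\<lambda>_. f a) xs \<le> 0" by (induction xs rule: induct_list012) auto
  qed
  finally show ?thesis by simp
qed

text \<open>Clamping by \<open>max\<close> and \<open>min\<close> turns cells of the partition that
  miss the interval into reversed intervals, whose length is 0. Cutting off the right end at
  \<open>t n\<close> makes the induction on \<open>n\<close> work.\<close>

lemma curve_length_le_sum_partition:
  assumes "\<And>j. j < n \<Longrightarrow> t j \<le> t (Suc j)" "t 0 \<le> a"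
  shows "curve_length f a (min b (t n)) \<le>
    (\<Sum>j<n. curve_length f (max a (t j)) (min b (t (Suc j))))"
  using assms
proof (induction n)
  case 0
  then show ?case by (simp add: curve_length_empty)
next
  case (Suc n)
  let ?p = "max a (min b (t n))"
  consider "t (Suc n) \<le> a" | "b \<le> a" | "b \<le> t n" | "a < t (Suc n)" "a < b" "t n < b" by linarith
  then show ?case
  proof cases
    case 1
    then show ?thesis by (simp add: curve_length_empty)
  next
    case 2
    then show ?thesis by (simp add: curve_length_empty)
  next
    case 3
    moreover from this Suc.prems(1)[of n] have "b \<le> t (Suc n)" by simp
    ultimately have "min b (t (Suc n)) = b" "min b (t n) = b" by auto
    then show ?thesis using Suc by (auto intro: order_trans)
  next
    case 4
    have "curve_length f a (min b (t (Suc n))) \<le>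
        curve_length f a ?p + curve_length f ?p (min b (t (Suc n)))"
      using 4 Suc.prems(1)[of n] by (intro curve_length_subadditive) auto
    also have "curve_length f a ?p = curve_length f a (min b (t n))"
      by (cases "t n \<le> a") (auto simp: curve_length_empty max_def min_def)
    also have "?p = max a (t n)" using 4 by auto
    finally show ?thesis using Suc by (auto intro: order_trans add_right_mono)
  qed
qed

text \<open>The cells do not overlap, so superadditivity adds them one by one; the clamped right end
  records how far the induction has come.\<close>

lemma sum_partition_le_curve_length:
  assumes "\<And>j. j < n \<Longrightarrow> t j \<le> t (Suc j)" "a \<le> b"
  shows "(\<Sum>j<n. curve_length f (max a (t j)) (min b (t (Suc j)))) \<le>
    curve_length f a (max a (min b (t n)))"
  using assms
proof (induction n)
  case (Suc n)
  let ?p = "max a (min b (t n))" and ?q = "max a (min b (t (Suc n)))"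
  have le: "t n \<le> t (Suc n)" using Suc.prems by auto
  have 1: "curve_length f (max a (t n)) (min b (t (Suc n))) \<le> curve_length f ?p ?q"
    by (cases "max a (t n) \<le> min b (t (Suc n))") (auto intro!: curve_length_mono simp: curve_length_empty)
  have "(\<Sum>j<Suc n. curve_length f (max a (t j)) (min b (t (Suc j)))) \<le>
      curve_length f a ?p + curve_length f ?p ?q"
    using Suc 1 by (auto intro: add_mono)
  also have "\<dots> \<le> curve_length f a ?q"
    using le by (intro curve_length_superadditive) auto
  finally show ?case .
qed simp

section \<open>Points of a portalgon and their identification\<close>

lemma poly_vertex_in_set: "vs \<noteq> [] \<Longrightarrow> poly_vertex vs j \<in> set vs"
  by (simp add: poly_vertex_def)

lemma poly_vertex_Suc_neq:
  assumes "simple_polygon vs" "j < length vs"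
  shows "poly_vertex vs j \<noteq> poly_vertex vs (Suc j)"
proof
  assume "poly_vertex vs j = poly_vertex vs (Suc j)"
  then have "j mod length vs = Suc j mod length vs"
    using assms unfolding simple_polygon_def poly_vertex_def
    by (subst (asm) nth_eq_iff_index_eq) (auto intro!: mod_less_divisor)
  then show False using assms unfolding simple_polygon_def by (auto simp: mod_Suc split: if_splits)
qed

text \<open>In a simple polygon different sides share at most endpoints, and an inner point of a
  side is no endpoint of it.\<close>

lemma open_side_unique:
  assumes "simple_polygon vs" "j < length vs" "k < length vs"
    and "z \<in> open_segment (poly_vertex vs j) (poly_vertex vs (Suc j))" "z \<in> poly_side vs k"
  shows "k = j"
proof (rule ccontr)
  assume "k \<noteq> j"
  then have "poly_side vs j \<inter> poly_side vs k \<subseteq> {poly_vertex vs j, poly_vertex vs (Suc j)}"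
    using assms unfolding simple_polygon_def by blast
  moreover have "z \<in> poly_side vs j \<inter> poly_side vs k"
    using assms by (auto simp: poly_side_def open_segment_def)
  ultimately show False using assms(4) by (auto simp: open_segment_def)
qed

lemma open_side_not_vertex:
  assumes "simple_polygon vs" "j < length vs"
    and "z \<in> open_segment (poly_vertex vs j) (poly_vertex vs (Suc j))"
  shows "z \<notin> set vs"
proof
  assume "z \<in> set vs"
  then obtain k where k: "k < length vs" "z = vs ! k" by (auto simp: in_set_conv_nth)
  then have z: "z = poly_vertex vs k" by (simp add: poly_vertex_def)
  then have "z \<in> poly_side vs k" by (simp add: poly_side_def)
  from open_side_unique[OF assms(1,2) k(1) assms(3) this] z assms(3) show False
    by (auto simp: open_segment_def)
qed

lemma poly_side_cases:
  assumes "vs \<noteq> []" "z \<in> poly_side vs j"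
  shows "z \<in> set vs \<or> z \<in> open_segment (poly_vertex vs j) (poly_vertex vs (Suc j))"
  using assms poly_vertex_in_set[OF assms(1)] unfolding poly_side_def open_segment_def by auto

definition vertex_point :: "portalgon \<Rightarrow> nat \<times> complex \<Rightarrow> bool" where
  "vertex_point P x \<longleftrightarrow> fst x < num_fragments P \<and> snd x \<in> set (fragments P ! fst x)"

text \<open>On relative interiors the gluing is an involution (\<open>crossing_unique\<close>),
  whereas the class of a vertex can be arbitrarily large; hence the separate notion.\<close>

definition crossing :: "portalgon \<Rightarrow> nat \<times> complex \<Rightarrow> nat \<times> complex \<Rightarrow> bool" where
  "crossing P x y \<longleftrightarrow> (\<exists>e e' l. {e, e'} \<in> portals P \<and> 0 < l \<and> l < 1 \<and>
      x = (frag_of e, edge_point P e l) \<and> y = (frag_of e', edge_point P e' l))"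

lemma to_surface_eq_iff: "to_surface P x = to_surface P y \<longleftrightarrow> equivclp (glued P) x y"
proof
  assume "to_surface P x = to_surface P y"
  moreover have "y \<in> to_surface P y" by (simp add: to_surface_def)
  ultimately show "equivclp (glued P) x y" by (metis mem_Collect_eq to_surface_def)
next
  assume *: "equivclp (glued P) x y"
  show "to_surface P x = to_surface P y"
    unfolding to_surface_def using equivclp_trans[of "glued P"] equivclp_sym[OF *] * by blast
qed

lemma glued_sym: "glued P x y \<Longrightarrow> glued P y x"
proof -
  assume "glued P x y"
  then obtain e e' l where *: "{e, e'} \<in> portals P" "0 \<le> l" "l \<le> 1"
      "x = (frag_of e, edge_point P e l)" "y = (frag_of e', edge_point P e' l)"
    unfolding glued_def by blast
  have "{e', e} \<in> portals P" using *(1) by (subst insert_commute)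
  with * show "glued P y x" unfolding glued_def by blast
qed

lemma to_surface_glued: "glued P x y \<Longrightarrow> to_surface P x = to_surface P y"
  by (auto simp: to_surface_eq_iff)

lemma to_surface_edge_point:
  "{e, e'} \<in> portals P \<Longrightarrow> 0 \<le> l \<Longrightarrow> l \<le> 1 \<Longrightarrow>
    to_surface P (frag_of e, edge_point P e l) = to_surface P (frag_of e', edge_point P e' l)"
  by (rule to_surface_glued) (auto simp: glued_def)

lemma crossing_sym: "crossing P x y \<Longrightarrow> crossing P y x"
proof -
  assume "crossing P x y"
  then obtain e e' l where *: "{e, e'} \<in> portals P" "0 < l" "l < 1"
      "x = (frag_of e, edge_point P e l)" "y = (frag_of e', edge_point P e' l)"
    unfolding crossing_def by blast
  have "{e', e} \<in> portals P" using *(1) by (subst insert_commute)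
  with * show "crossing P y x" unfolding crossing_def by blast
qed

lemma dist_edge_point:
  "dist (edge_point P e l) (edge_point P e l') = \<bar>l - l'\<bar> * dist (edge_start P e) (edge_end P e)"
proof -
  have "edge_point P e l - edge_point P e l' = (l' - l) *\<^sub>R (edge_start P e - edge_end P e)"
    by (simp add: edge_point_def linepath_def algebra_simps)
  then show ?thesis by (simp add: dist_norm abs_minus_commute)
qed

lemma continuous_edge_point: "continuous_on A (edge_point P e)"
  unfolding edge_point_def linepath_def by (intro continuous_intros)

locale valid_portalgon =
  fixes P :: portalgon
  assumes portalgon: "is_portalgon P"
begin

lemma simple: "i < num_fragments P \<Longrightarrow> simple_polygon (fragments P ! i)"
  using portalgon by (simp add: is_portalgon_def)

lemma portal_edges:
  assumes "{e, e'} \<in> portals P"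
  shows "is_edge P e" "is_edge P e'" "\<not> same_side e e'"
    "dist (edge_start P e) (edge_end P e) = dist (edge_start P e') (edge_end P e')"
proof -
  have "\<forall>p\<in>portals P. \<exists>e e'. p = {e, e'} \<and> is_edge P e \<and> is_edge P e' \<and> \<not> same_side e e' \<and>
      dist (edge_start P e) (edge_end P e) = dist (edge_start P e') (edge_end P e')"
    using portalgon by (simp add: is_portalgon_def)
  from bspec[OF this assms]
  obtain a b where ab: "{e, e'} = {a, b}" "is_edge P a" "is_edge P b" "\<not> same_side a b"
    "dist (edge_start P a) (edge_end P a) = dist (edge_start P b) (edge_end P b)"
    by blast
  have "e = a \<and> e' = b \<or> e = b \<and> e' = a" using ab(1) unfolding doubleton_eq_iff .
  then show "is_edge P e" "is_edge P e'" "\<not> same_side e e'"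
    "dist (edge_start P e) (edge_end P e) = dist (edge_start P e') (edge_end P e')"
    using ab(2-5) unfolding same_side_def by (metis (no_types))+
qed

text \<open>An edge belongs to one portal whatever its direction, so the two portals agree; they
  cannot be listed in opposite order, because the two edges of a portal lie on different
  sides.\<close>

lemma portal_unique:
  assumes "{e, e'} \<in> portals P" "{d, d'} \<in> portals P" "same_side e d"
  shows "e = d" "e' = d'"
proof -
  have "\<forall>p\<in>portals P. \<forall>q\<in>portals P. \<forall>e\<in>p. \<forall>e'\<in>q. same_side e e' \<longrightarrow> p = q"
    using portalgon by (simp add: is_portalgon_def)
  from this[rule_format, OF assms(1,2) _ _ assms(3)] have "{e, e'} = {d, d'}" by simp
  then have "e = d \<and> e' = d' \<or> e = d' \<and> e' = d" unfolding doubleton_eq_iff .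
  then show "e = d" "e' = d'" using portal_edges(3)[OF assms(1)] assms(3)
    by (auto simp: same_side_def)
qed

lemma edge_fragment: "is_edge P e \<Longrightarrow> frag_of e < num_fragments P"
  by (simp add: is_edge_def)

lemma edge_start_neq: "is_edge P e \<Longrightarrow> edge_start P e \<noteq> edge_end P e"
  using poly_vertex_Suc_neq[OF simple, of "frag_of e" "side_of e"]
  by (auto simp: is_edge_def edge_start_def edge_end_def)

lemma edge_segment:
  "closed_segment (edge_start P e) (edge_end P e) = poly_side (fragments P ! frag_of e) (side_of e)"
  "open_segment (edge_start P e) (edge_end P e) =
    open_segment (poly_vertex (fragments P ! frag_of e) (side_of e))
      (poly_vertex (fragments P ! frag_of e) (Suc (side_of e)))"
  by (auto simp: edge_start_def edge_end_def poly_side_def closed_segment_commute open_segment_commute)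

lemma edge_point_image: "edge_point P e ` {0..1} = closed_segment (edge_start P e) (edge_end P e)"
  by (simp add: edge_point_def linepath_image_01)

lemma edge_point_open:
  "is_edge P e \<Longrightarrow> 0 < l \<Longrightarrow> l < 1 \<Longrightarrow>
    edge_point P e l \<in> open_segment (edge_start P e) (edge_end P e)"
  using edge_start_neq by (auto simp: edge_point_def linepath_def in_segment)

lemma edge_point_closed:
  "0 \<le> l \<Longrightarrow> l \<le> 1 \<Longrightarrow> edge_point P e l \<in> closed_segment (edge_start P e) (edge_end P e)"
  unfolding edge_point_image[symmetric] by auto

lemma edge_point_inj: "is_edge P e \<Longrightarrow> edge_point P e l = edge_point P e l' \<Longrightarrow> l = l'"
  using edge_start_neq[of e] dist_edge_point[of P e l l'] by simp

lemma edge_point_not_vertex: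
  "is_edge P e \<Longrightarrow> 0 < l \<Longrightarrow> l < 1 \<Longrightarrow> edge_point P e l \<notin> set (fragments P ! frag_of e)"
  using edge_point_open[of e l] open_side_not_vertex[OF simple, of "frag_of e" "side_of e"]
  by (simp add: edge_segment is_edge_def)

lemma fragment_nonempty: "i < num_fragments P \<Longrightarrow> fragments P ! i \<noteq> []"
  using simple[of i] by (auto simp: simple_polygon_def)

lemma edge_ends_vertices:
  assumes "is_edge P e"
  shows "edge_start P e \<in> set (fragments P ! frag_of e)" "edge_end P e \<in> set (fragments P ! frag_of e)"
  using assms fragment_nonempty unfolding edge_start_def edge_end_def is_edge_def
  by (auto intro: poly_vertex_in_set)

lemma edge_point_vertex_iff:
  assumes "is_edge P e" "0 \<le> l" "l \<le> 1"
  shows "edge_point P e l \<in> set (fragments P ! frag_of e) \<longleftrightarrow> l = 0 \<or> l = 1"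
proof -
  have "edge_point P e 0 = edge_start P e" "edge_point P e 1 = edge_end P e"
    by (simp_all add: edge_point_def linepath_def)
  then show ?thesis using assms edge_point_not_vertex[of e l] edge_ends_vertices[of e] by force
qed

lemma edge_point_fragment:
  assumes "is_edge P e" "0 \<le> l" "l \<le> 1"
  shows "edge_point P e l \<in> fragment P (frag_of e)"
  using edge_point_closed[OF assms(2,3), of e] assms(1)
  unfolding edge_segment fragment_def poly_region_def poly_boundary_def is_edge_def by auto

text \<open>An inner point of a side lies on no other side, so both edges occupy the same side and
  \<open>portal_unique\<close> applies.\<close>

lemma edge_point_same:
  assumes "{e, e'} \<in> portals P" "{d, d'} \<in> portals P" "frag_of e = frag_of d"
    and "0 < l" "l < 1" "edge_point P e l \<in> closed_segment (edge_start P d) (edge_end P d)"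
  shows "e = d" "e' = d'"
proof -
  have e: "is_edge P e" and d: "is_edge P d" using portal_edges assms(1,2) by blast+
  have "side_of d = side_of e"
  proof (rule open_side_unique)
    show "simple_polygon (fragments P ! frag_of e)" using e simple by (auto simp: is_edge_def)
  qed (use e d assms edge_point_open[OF e assms(4,5)] in \<open>simp_all add: is_edge_def edge_segment\<close>)
  then have "same_side e d" using assms by (simp add: same_side_def)
  from portal_unique[OF assms(1,2) this] show "e = d" "e' = d'" .
qed

lemma glued_cases:
  assumes "glued P x y"
  shows "(vertex_point P x \<and> vertex_point P y) \<or>
    (crossing P x y \<and> \<not> vertex_point P x \<and> \<not> vertex_point P y)"
proof -
  obtain e e' l where *: "{e, e'} \<in> portals P" "0 \<le> l" "l \<le> 1"
      "x = (frag_of e, edge_point P e l)" "y = (frag_of e', edge_point P e' l)"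
    using assms by (auto simp: glued_def)
  have e: "is_edge P e" "is_edge P e'" using portal_edges *(1) by blast+
  then have "vertex_point P x \<longleftrightarrow> l = 0 \<or> l = 1" "vertex_point P y \<longleftrightarrow> l = 0 \<or> l = 1"
    using * edge_point_vertex_iff[OF e(1) *(2,3)] edge_point_vertex_iff[OF e(2) *(2,3)]
    unfolding vertex_point_def by (simp_all add: edge_fragment)
  moreover have "crossing P x y" if "l \<noteq> 0" "l \<noteq> 1"
    unfolding crossing_def using * that by (intro exI[of _ e] exI[of _ e'] exI[of _ l]) auto
  ultimately show ?thesis by blast
qed

lemma crossing_unique:
  assumes "crossing P x y" "crossing P y z"
  shows "z = x"
proof -
  obtain e e' l where 1: "{e, e'} \<in> portals P" "0 < l" "l < 1"
      "x = (frag_of e, edge_point P e l)" "y = (frag_of e', edge_point P e' l)"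
    using assms(1) by (auto simp: crossing_def)
  obtain d d' k where 2: "{d, d'} \<in> portals P" "0 < k" "k < 1"
      "y = (frag_of d, edge_point P d k)" "z = (frag_of d', edge_point P d' k)"
    using assms(2) by (auto simp: crossing_def)
  have 3: "{e', e} \<in> portals P" using 1(1) by (subst insert_commute)
  have "edge_point P e' l = edge_point P d k" "frag_of e' = frag_of d" using 1 2 by auto
  moreover from this have "e' = d" "e = d'"
    using edge_point_same[OF 3 2(1) _ 1(2,3)] edge_point_closed[of k d] 2 by auto
  ultimately have "l = k" using edge_point_inj[of d] portal_edges 2(1) by auto
  then show "z = x" using 1 2 \<open>e = d'\<close> by simp
qed

text \<open>Gluing takes vertices to vertices only, and elsewhere a second gluing step undoes the
  first. So a class consists of vertices, or is a pair of crossing partners, or a single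
  point.\<close>

lemma to_surface_eq_cases:
  assumes "to_surface P x = to_surface P y"
  shows "x = y \<or> (vertex_point P x \<and> vertex_point P y) \<or>
    (crossing P x y \<and> \<not> vertex_point P x \<and> \<not> vertex_point P y)"
proof -
  have "equivclp (glued P) x y" using assms by (simp add: to_surface_eq_iff)
  then show ?thesis
  proof (induction rule: equivclp_induct)
    case (step y z)
    then have "glued P y z" using glued_sym by blast
    from glued_cases[OF this] step show ?case using crossing_unique by blast
  qed simp
qed

lemma surface_vertex_iff:
  assumes "i < num_fragments P"
  shows "to_surface P (i, z) \<in> surface_vertices P \<longleftrightarrow> z \<in> set (fragments P ! i)"
proof
  assume "to_surface P (i, z) \<in> surface_vertices P"
  then obtain j v where "vertex_point P (j, v)" "to_surface P (i, z) = to_surface P (j, v)"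
    by (auto simp: surface_vertices_def vertex_point_def)
  with to_surface_eq_cases[of "(i, z)" "(j, v)"] show "z \<in> set (fragments P ! i)"
    by (auto simp: vertex_point_def)
qed (use assms in \<open>auto simp: surface_vertices_def\<close>)

lemma card_surface_vertices: "finite (surface_vertices P)" "card (surface_vertices P) \<le> num_vertices P"
proof -
  have eq: "surface_vertices P = (\<Union>i<num_fragments P. (\<lambda>v. to_surface P (i, v)) ` set (fragments P ! i))"
    by (auto simp: surface_vertices_def)
  show "finite (surface_vertices P)" unfolding eq by auto
  have "card (surface_vertices P) \<le>
      (\<Sum>i<num_fragments P. card ((\<lambda>v. to_surface P (i, v)) ` set (fragments P ! i)))"
    unfolding eq by (rule card_UN_le) auto
  also have "\<dots> \<le> num_vertices P"
    unfolding num_vertices_def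
    by (intro sum_mono order_trans[OF card_image_le card_length]) auto
  finally show "card (surface_vertices P) \<le> num_vertices P" .
qed

lemma finite_portal_edges: "finite (\<Union>(portals P))"
proof -
  have "\<Union>(portals P) \<subseteq> (\<lambda>((i, j), b). DEdge i j b) `
      ((\<Union>i<num_fragments P. {i} \<times> {..<length (fragments P ! i)}) \<times> UNIV)"
  proof
    fix e assume "e \<in> \<Union>(portals P)"
    then have "is_edge P e" using portalgon unfolding is_portalgon_def by fastforce
    then show "e \<in> (\<lambda>((i, j), b). DEdge i j b) `
      ((\<Union>i<num_fragments P. {i} \<times> {..<length (fragments P ! i)}) \<times> UNIV)"
      by (cases e) (force simp: is_edge_def image_iff)
  qed
  then show ?thesis by (rule finite_subset) auto
qed

lemma closed_fragment: "closed (fragment P i)"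
proof -
  let ?B = "poly_boundary (fragments P ! i)"
  have "closed ?B" unfolding poly_boundary_def poly_side_def by (intro closed_UN) auto
  then have "closed (- outside ?B)" by (intro closed_Compl open_outside)
  then show ?thesis by (simp add: fragment_def poly_region_def union_with_inside)
qed

end

section \<open>Chains of curves in fragments\<close>

definition piece :: "portalgon \<Rightarrow> nat \<times> (real \<Rightarrow> complex) \<Rightarrow> bool" where
  "piece P p \<longleftrightarrow> fst p < num_fragments P \<and> continuous_on {0..1} (snd p) \<and>
     snd p ` {0..1} \<subseteq> fragment P (fst p)"

definition piece_point :: "portalgon \<Rightarrow> nat \<times> (real \<Rightarrow> complex) \<Rightarrow> real \<Rightarrow> (nat \<times> complex) set" where
  "piece_point P p u = to_surface P (fst p, snd p u)"

text \<open>Pieces are all parametrized over the unit interval and need to agree only on the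
  surface. Hence a piece can be exchanged without touching the others, and passing a portal is a
  mere change of representative.\<close>

fun chain ::
  "portalgon \<Rightarrow> (nat \<times> complex) set \<Rightarrow> (nat \<times> (real \<Rightarrow> complex)) list \<Rightarrow> (nat \<times> complex) set \<Rightarrow> bool"
where
  "chain P s [] t \<longleftrightarrow> s = t"
| "chain P s (p # ps) t \<longleftrightarrow> piece P p \<and> piece_point P p 0 = s \<and> chain P (piece_point P p 1) ps t"

definition chain_len :: "(nat \<times> (real \<Rightarrow> complex)) list \<Rightarrow> ennreal" where
  "chain_len ps = (\<Sum>p\<leftarrow>ps. curve_length (snd p) 0 1)"

text \<open>All pieces get equally long time intervals. The cap at \<open>length ps - 1\<close> is
  for \<open>u = 1\<close>, where the floor points behind the last piece.\<close>

definition chain_path ::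
  "portalgon \<Rightarrow> (nat \<times> (real \<Rightarrow> complex)) list \<Rightarrow> real \<Rightarrow> (nat \<times> complex) set" where
  "chain_path P ps u =
     (let j = min (length ps - 1) (nat \<lfloor>u * length ps\<rfloor>) in piece_point P (ps ! j) (u * length ps - j))"

lemma chain_len_simps [simp]:
  "chain_len [] = 0" "chain_len (p # ps) = curve_length (snd p) 0 1 + chain_len ps"
  "chain_len (ps @ qs) = chain_len ps + chain_len qs"
  by (simp_all add: chain_len_def)

lemma chain_append: "chain P s (ps @ qs) t \<longleftrightarrow> (\<exists>w. chain P s ps w \<and> chain P w qs t)"
  by (induction ps arbitrary: s) auto

lemma chain_nth:
  assumes "chain P s ps t"
  shows chain_piece: "j < length ps \<Longrightarrow> piece P (ps ! j)"
    and chain_junction: "Suc j < length ps \<Longrightarrow> piece_point P (ps ! j) 1 = piece_point P (ps ! Suc j) 0"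
    and chain_start: "ps \<noteq> [] \<Longrightarrow> piece_point P (ps ! 0) 0 = s"
    and chain_end: "ps \<noteq> [] \<Longrightarrow> piece_point P (ps ! (length ps - 1)) 1 = t"
proof -
  show "piece P (ps ! j)" if "j < length ps"
    using assms that
  proof (induction ps arbitrary: s j)
    case (Cons p ps)
    then show ?case by (cases j) auto
  qed simp
  show "piece_point P (ps ! j) 1 = piece_point P (ps ! Suc j) 0" if "Suc j < length ps"
    using assms that
  proof (induction ps arbitrary: s j)
    case (Cons p ps)
    then show ?case by (cases j; cases ps) auto
  qed simp
  show "piece_point P (ps ! 0) 0 = s" if "ps \<noteq> []"
    using assms that by (cases ps) auto
  show "piece_point P (ps ! (length ps - 1)) 1 = t" if "ps \<noteq> []"
    using assms that
  proof (induction ps arbitrary: s)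
    case (Cons p ps)
    then show ?case by (cases ps) auto
  qed simp
qed

lemma chainI:
  assumes "\<And>j. j < length ps \<Longrightarrow> piece P (ps ! j)"
    and "\<And>j. Suc j < length ps \<Longrightarrow> piece_point P (ps ! j) 1 = piece_point P (ps ! Suc j) 0"
    and "ps \<noteq> []" "piece_point P (ps ! 0) 0 = s" "piece_point P (ps ! (length ps - 1)) 1 = t"
  shows "chain P s ps t"
  using assms
proof (induction ps arbitrary: s)
  case (Cons p ps)
  show ?case
  proof (cases "ps = []")
    case True
    then show ?thesis using Cons.prems by force
  next
    case False
    have "chain P (piece_point P p 1) ps t"
    proof (rule Cons.IH)
      show "piece P (ps ! j)" if "j < length ps" for j using Cons.prems(1)[of "Suc j"] that by simp
      show "piece_point P (ps ! j) 1 = piece_point P (ps ! Suc j) 0" if "Suc j < length ps" for j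
        using Cons.prems(2)[of "Suc j"] that by simp
      show "piece_point P (ps ! 0) 0 = piece_point P p 1" using Cons.prems(2)[of 0] False by simp
    qed (use Cons.prems False in \<open>auto simp: nth_Cons'\<close>)
    then show ?thesis using Cons.prems(1)[of 0] Cons.prems(4) by simp
  qed
qed simp

text \<open>Both ends of the time interval are included: at an inner right end
  \<open>chain_path\<close> already uses the next piece, which starts at the same surface
  point.\<close>

lemma chain_path_eq:
  fixes u :: real
  assumes ps: "chain P s ps t" "j < length ps"
    and u: "real j \<le> u * length ps" "u * length ps \<le> real (Suc j)"
  shows "chain_path P ps u = piece_point P (ps ! j) (u * length ps - j)"
proof (cases "u * length ps < real (Suc j)")
  case True
  then have "\<lfloor>u * length ps\<rfloor> = int j" using u by (intro floor_unique) auto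
  then have "min (length ps - 1) (nat \<lfloor>u * length ps\<rfloor>) = j" using ps by auto
  then show ?thesis by (simp add: chain_path_def Let_def)
next
  case False
  then have eq: "u * length ps = real (Suc j)" using u by simp
  then have nat: "nat \<lfloor>u * length ps\<rfloor> = Suc j" by (metis floor_of_nat nat_int)
  show ?thesis
  proof (cases "Suc j < length ps")
    case True
    then have "min (length ps - 1) (nat \<lfloor>u * length ps\<rfloor>) = Suc j" using nat by auto
    then show ?thesis using chain_junction[OF ps(1) True] eq by (simp add: chain_path_def Let_def)
  next
    case False
    then have "min (length ps - 1) (nat \<lfloor>u * length ps\<rfloor>) = j" using nat ps by auto
    then show ?thesis by (simp add: chain_path_def Let_def)
  qed
qed

lemma path_decomposition_chain_path:
  assumes "chain P s ps t" "ps \<noteq> []"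
  defines "N \<equiv> length ps"
  shows "path_decomposition P (chain_path P ps) (map (\<lambda>j. real j / real N) [0..<Suc N])
    (map (\<lambda>j. (fst (ps ! j), \<lambda>u::real. snd (ps ! j) (u * real N - real j))) [0..<N])"
proof -
  let ?ts = "map (\<lambda>j. real j / real N) [0..<Suc N]"
  have N: "N > 0" using assms by simp
  have "last ?ts = 1" using N by simp
  moreover have "hd ?ts = 0" by (simp add: upt_conv_Cons del: upt_Suc)
  moreover have "sorted_wrt (<) ?ts"
    using N by (auto simp: sorted_wrt_iff_nth_less divide_strict_right_mono simp del: upt_Suc)
  moreover have "fst (ps ! j) < num_fragments P \<and>
      continuous_on {?ts ! j..?ts ! Suc j} (\<lambda>u::real. snd (ps ! j) (u * real N - real j)) \<and>
      (\<forall>u\<in>{?ts ! j..?ts ! Suc j}. snd (ps ! j) (u * real N - real j) \<in> fragment P (fst (ps ! j)) \<and>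
        chain_path P ps u = to_surface P (fst (ps ! j), snd (ps ! j) (u * real N - real j)))"
    if j: "j < N" for j
  proof -
    have ts: "?ts ! j = j / N" "?ts ! Suc j = Suc j / N"
      using j by (auto simp del: upt_Suc)
    have range: "real j \<le> u * N" "u * N \<le> real (Suc j)" if "u \<in> {?ts ! j..?ts ! Suc j}" for u :: real
      using that N unfolding ts by (auto simp: field_simps)
    have p: "piece P (ps ! j)" using chain_piece[OF assms(1)] j N_def by simp
    have "continuous_on {?ts ! j..?ts ! Suc j} (snd (ps ! j) \<circ> (\<lambda>u::real. u * real N - real j))"
    proof (rule continuous_on_compose)
      show "continuous_on ((\<lambda>u::real. u * real N - real j) ` {?ts ! j..?ts ! Suc j}) (snd (ps ! j))"
        by (rule continuous_on_subset[of "{0..1}"]) (use p range in \<open>force simp: piece_def\<close>)+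
    qed (intro continuous_intros)
    moreover have "snd (ps ! j) (u * real N - real j) \<in> fragment P (fst (ps ! j))"
      if "u \<in> {?ts ! j..?ts ! Suc j}" for u :: real
    proof -
      have "u * real N - real j \<in> {0..1}" using range[OF that] by simp
      then show ?thesis using p by (auto simp: piece_def)
    qed
    ultimately show ?thesis
      using p range chain_path_eq[OF assms(1), of j] j
      by (auto simp: piece_def piece_point_def N_def o_def)
  qed
  ultimately show ?thesis unfolding path_decomposition_def by (simp del: upt_Suc)
qed

lemma topspace_surface: "topspace (surface P) = {to_surface P (i, x) | i x. i < num_fragments P \<and> x \<in> fragment P i}"
  by (force simp: surface_def topspace_quotient_topology fragment_union_def)

lemma continuous_map_to_surface:
  "i < num_fragments P \<Longrightarrow> continuous_map (top_of_set (fragment P i)) (surface P) (\<lambda>x. to_surface P (i, x))"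
proof -
  assume i: "i < num_fragments P"
  have "continuous_map (top_of_set (fragment P i)) (fragment_union P) (\<lambda>x. (i, x))"
    unfolding fragment_union_def
    using continuous_map_component_injection[of i "{..<num_fragments P}" "\<lambda>i. top_of_set (fragment P i)"] i
    by simp
  moreover have "continuous_map (fragment_union P) (surface P) (to_surface P)"
    unfolding surface_def by (intro quotient_imp_continuous_map quotient_map_quotient_topology)
  ultimately show ?thesis using continuous_map_compose by (fastforce simp: o_def)
qed

lemma strict_partition_cover:
  fixes t :: "nat \<Rightarrow> real"
  assumes "t 0 \<le> u" "u \<le> t n" "0 < n"
  shows "\<exists>j<n. t j \<le> u \<and> u \<le> t (Suc j)"
  using assms
proof (induction n)
  case (Suc n)
  then show ?case by (cases "u \<le> t n \<and> 0 < n") (auto simp: less_Suc_eq)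
qed simp

lemma decomposition_facts:
  assumes "path_decomposition P \<gamma> ts ps"
  shows "ps \<noteq> []" "ts ! 0 = 0" "ts ! length ps = 1"
    and "\<And>j. j < length ps \<Longrightarrow> ts ! j < ts ! Suc j"
    and "\<And>j. j \<le> length ps \<Longrightarrow> 0 \<le> ts ! j \<and> ts ! j \<le> 1"
    and "\<And>u. u \<in> {0..1} \<Longrightarrow> \<exists>j<length ps. ts ! j \<le> u \<and> u \<le> ts ! Suc j"
proof -
  have len: "length ts = Suc (length ps)" and ends: "hd ts = 0" "last ts = 1" and "sorted_wrt (<) ts"
    using assms by (auto simp: path_decomposition_def)
  then have less: "ts ! j < ts ! k" if "j < k" "k \<le> length ps" for j k
    using that by (auto simp: sorted_wrt_iff_nth_less)
  have ne: "ts \<noteq> []" using len by auto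
  show t0: "ts ! 0 = 0" using ends ne by (simp add: hd_conv_nth)
  show t1: "ts ! length ps = 1" using ends ne len by (simp add: last_conv_nth)
  show "ps \<noteq> []" using t0 t1 by auto
  then show "\<exists>j<length ps. ts ! j \<le> u \<and> u \<le> ts ! Suc j" if "u \<in> {0..1}" for u
    using strict_partition_cover[of "\<lambda>j. ts ! j" u "length ps"] t0 t1 that by auto
  show "ts ! j < ts ! Suc j" if "j < length ps" for j using less that by auto
  show "0 \<le> ts ! j \<and> ts ! j \<le> 1" if "j \<le> length ps" for j
    using less[of 0 j] less[of j "length ps"] t0 t1 that by (cases "j = 0"; cases "j = length ps") auto
qed

text \<open>Each piece followed by the quotient map is continuous, and finitely many closed time
  intervals can be pasted together.\<close>

lemma decomposition_pathin:
  assumes D: "path_decomposition P \<gamma> ts ps"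
  shows "pathin (surface P) \<gamma>"
  unfolding pathin_def
proof (rule pasting_lemma_closed[of "{..<length ps}" _ "\<lambda>j. {ts ! j..ts ! Suc j}" _ "\<lambda>_. \<gamma>"])
  show "\<exists>j. j \<in> {..<length ps} \<and> x \<in> {ts ! j..ts ! Suc j} \<and> \<gamma> x = \<gamma> x"
    if "x \<in> topspace (top_of_set {0..1})" for x
    using decomposition_facts(6)[OF D, of x] that by auto
  fix j assume j: "j \<in> {..<length ps}"
  have sub: "{ts ! j..ts ! Suc j} \<subseteq> {0..1}"
    using decomposition_facts(5)[OF D, of j] decomposition_facts(5)[OF D, of "Suc j"] j by auto
  show "closedin (top_of_set {0..1}) {ts ! j..ts ! Suc j}"
    using sub by (intro closed_subset) auto
  let ?f = "snd (ps ! j)" and ?i = "fst (ps ! j)"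
  have *: "?i < num_fragments P" "continuous_on {ts ! j..ts ! Suc j} ?f"
      "\<And>u. u \<in> {ts ! j..ts ! Suc j} \<Longrightarrow> ?f u \<in> fragment P ?i \<and> \<gamma> u = to_surface P (?i, ?f u)"
    using D j by (auto simp: path_decomposition_def)
  have "continuous_map (top_of_set {ts ! j..ts ! Suc j}) (top_of_set (fragment P ?i)) ?f"
    using * by (auto simp: continuous_map_in_subtopology)
  from continuous_map_compose[OF this continuous_map_to_surface[OF *(1)]]
  have "continuous_map (top_of_set {ts ! j..ts ! Suc j}) (surface P) \<gamma>"
    by (rule continuous_map_eq) (use * in auto)
  then show "continuous_map (subtopology (top_of_set {0..1}) {ts ! j..ts ! Suc j}) (surface P) \<gamma>"
    by (simp only: subtopology_subtopology Int_absorb1[OF sub])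
qed auto

lemma path_between_chain_path:
  assumes "chain P s ps t" "ps \<noteq> []"
  shows "path_between P s t (chain_path P ps)"
  unfolding path_between_def
proof (intro conjI)
  show "pathin (surface P) (chain_path P ps)"
    using decomposition_pathin[OF path_decomposition_chain_path[OF assms]] .
  show "chain_path P ps 0 = s"
    using chain_path_eq[OF assms(1), of 0 0] chain_start[OF assms(1,2)] assms by simp
  have "length ps - 1 < length ps" using assms by simp
  from chain_path_eq[OF assms(1) this, of 1] show "chain_path P ps 1 = t"
    using chain_end[OF assms(1,2)] assms by (simp add: of_nat_diff Suc_le_eq)
qed

lemma path_length_chain_path:
  assumes "chain P s ps t" "ps \<noteq> []"
  shows "path_length P (chain_path P ps) \<le> chain_len ps"
proof -
  define N where "N = length ps"
  have N: "N > 0" using assms N_def by simp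
  let ?ts = "map (\<lambda>j. real j / real N) [0..<Suc N]"
  let ?ps = "map (\<lambda>j. (fst (ps ! j), \<lambda>u::real. snd (ps ! j) (u * real N - real j))) [0..<N]"
  have "path_length P (chain_path P ps) \<le>
      (\<Sum>j<length ?ps. curve_length (snd (?ps ! j)) (?ts ! j) (?ts ! Suc j))"
    unfolding path_length_def
    by (rule INF_lower2[of "(?ts, ?ps)"])
       (use path_decomposition_chain_path[OF assms] in \<open>auto simp: N_def simp del: upt_Suc\<close>)
  also have "\<dots> \<le> (\<Sum>j<N. curve_length (snd (ps ! j)) 0 1)"
  proof (simp only: length_map length_upt diff_zero, rule sum_mono)
    fix j assume j: "j \<in> {..<N}"
    have ts: "?ts ! j = j / N" "?ts ! Suc j = Suc j / N"
      using j by (auto simp del: upt_Suc)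
    have "curve_length (\<lambda>u::real. snd (ps ! j) (u * real N - real j)) (j / N) (Suc j / N) \<le> curve_length (snd (ps ! j)) 0 1"
    proof (rule curve_length_reparam)
      show "mono_on {j / N..Suc j / N} (\<lambda>u. u * real N - real j)"
        by (auto simp: monotone_on_def intro: mult_right_mono)
      show "(\<lambda>u. u * real N - real j) ` {j / N..Suc j / N} \<subseteq> {0..1}"
        using N by (auto simp: field_simps)
    qed
    then show "curve_length (snd (?ps ! j)) (?ts ! j) (?ts ! Suc j) \<le> curve_length (snd (ps ! j)) 0 1"
      using j unfolding ts by simp
  qed
  also have "\<dots> = chain_len ps"
    by (simp add: chain_len_def sum_list_sum_nth N_def atLeast0LessThan)
  finally show ?thesis .
qed

lemma surface_dist_le_chain:
  assumes "chain P s ps t" "ps \<noteq> []"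
  shows "surface_dist P s t \<le> chain_len ps"
  unfolding surface_dist_def
  using path_length_chain_path[OF assms] path_between_chain_path[OF assms] by (auto intro: INF_lower2)

lemma shortest_chain_path:
  assumes "chain P s ps t" "ps \<noteq> []" "chain_len ps \<le> surface_dist P s t" "chain_len ps < \<infinity>"
  shows "shortest_path P s t (chain_path P ps)"
proof -
  have "surface_dist P s t \<le> path_length P (chain_path P ps)"
    unfolding surface_dist_def using path_between_chain_path[OF assms(1,2)] by (auto intro: INF_lower)
  then show ?thesis
    using path_length_chain_path[OF assms(1,2)] path_between_chain_path[OF assms(1,2)] assms(3,4)
    unfolding shortest_path_def by (auto intro: antisym order_trans order_le_less_trans)
qed

lemma chain_path_image:
  assumes "chain P s ps t" "ps \<noteq> []"
  shows "chain_path P ps ` {0..1} = (\<Union>p\<in>set ps. piece_point P p ` {0..1})"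
proof
  have N: "length ps > 0" using assms by simp
  show "chain_path P ps ` {0..1} \<subseteq> (\<Union>p\<in>set ps. piece_point P p ` {0..1})"
  proof (rule image_subsetI)
    fix u :: real assume u: "u \<in> {0..1}"
    obtain j where j: "j < length ps" "real j \<le> u * length ps" "u * length ps \<le> real (Suc j)"
      using strict_partition_cover[of real "u * length ps" "length ps"] u N
      by (auto simp: mult_left_le_one_le)
    then have "chain_path P ps u = piece_point P (ps ! j) (u * length ps - j)"
      using chain_path_eq[OF assms(1)] by blast
    then show "chain_path P ps u \<in> (\<Union>p\<in>set ps. piece_point P p ` {0..1})"
      using j by (intro UN_I[of "ps ! j"] image_eqI[of _ _ "u * length ps - j"]) auto
  qed
  show "(\<Union>p\<in>set ps. piece_point P p ` {0..1}) \<subseteq> chain_path P ps ` {0..1}"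
  proof clarify
    fix p u assume "p \<in> set ps" and u: "u \<in> {0..1::real}"
    then obtain j where j: "j < length ps" "p = ps ! j" by (auto simp: in_set_conv_nth)
    let ?v = "(j + u) / length ps"
    have v: "?v * length ps = j + u" using N by simp
    have "real j + u \<le> length ps" using j u by auto
    then have "?v \<in> {0..1}" using N u by auto
    moreover have "chain_path P ps ?v = piece_point P p u"
      using chain_path_eq[OF assms(1) j(1), of ?v] u j v by simp
    ultimately show "piece_point P p u \<in> chain_path P ps ` {0..1}" by (metis image_eqI)
  qed
qed

section \<open>Independence of the length from the decomposition\<close>

context valid_portalgon
begin

text \<open>At every time the two curves correspond under one of finitely many partial isometries
  between the fragments, and each of these applies on a closed set of times.\<close>

lemma curve_length_same_surface_curve:
  assumes i: "i < num_fragments P" "j < num_fragments P"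
    and cont: "continuous_on {a..b} f" "continuous_on {a..b} g"
    and eq: "\<And>u. u \<in> {a..b} \<Longrightarrow> to_surface P (i, f u) = to_surface P (j, g u)"
  shows "curve_length f a b \<le> curve_length g a b"
proof -
  let ?E = "\<Union>(portals P)"
  \<comment> \<open>The graphs of these isometries: the identity, the pairs of vertices as one-point
    maps, and the gluing map of every portal in either direction.\<close>
  define I where "I = (if i = j then {{y. \<exists>x::complex. y = (x, x)}} else {}) \<union>
    (\<lambda>x. {x}) ` (set (fragments P ! i) \<times> set (fragments P ! j)) \<union>
    (\<lambda>(e, e'). (\<lambda>l. (edge_point P e l, edge_point P e' l)) ` {0..1}) ` {(e, e') \<in> ?E \<times> ?E. {e, e'} \<in> portals P}"
  define K where "K = (\<lambda>\<rho>. {u \<in> {a..b}. (f u, g u) \<in> \<rho>})"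
  have fin: "finite I"
  proof -
    have "finite {(e, e') \<in> ?E \<times> ?E. {e, e'} \<in> portals P}"
      by (rule finite_subset[of _ "?E \<times> ?E"]) (auto simp: finite_portal_edges)
    then show ?thesis by (simp add: I_def)
  qed
  have clo: "closed \<rho>" if "\<rho> \<in> I" for \<rho>
  proof -
    have "closed ((\<lambda>l. (edge_point P e l, edge_point P e' l)) ` {0..1})" for e e'
      by (intro compact_imp_closed compact_continuous_image continuous_intros continuous_edge_point) auto
    then show ?thesis using that closed_diagonal[where 'a = complex]
      by (auto simp: I_def split: if_splits)
  qed
  have iso: "dist (fst x) (fst y) = dist (snd x) (snd y)" if "\<rho> \<in> I" "x \<in> \<rho>" "y \<in> \<rho>" for \<rho> x y
    using that portal_edges(4) by (auto simp: I_def dist_edge_point split: if_splits)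
  show ?thesis
  proof (rule curve_length_le_cover[OF fin, where K = K])
    show "{a..b} \<subseteq> (\<Union>\<rho>\<in>I. K \<rho>)"
    proof
      fix u assume u: "u \<in> {a..b}"
      have "\<exists>\<rho>\<in>I. (f u, g u) \<in> \<rho>"
        using to_surface_eq_cases[OF eq[OF u]]
      proof (elim disjE conjE)
        assume "crossing P (i, f u) (j, g u)"
        then obtain e e' l where "{e, e'} \<in> portals P" "0 < l" "l < 1"
          "f u = edge_point P e l" "g u = edge_point P e' l"
          by (auto simp: crossing_def)
        moreover from this have "(e, e') \<in> {(e, e') \<in> ?E \<times> ?E. {e, e'} \<in> portals P}" by auto
        then have "(\<lambda>l. (edge_point P e l, edge_point P e' l)) ` {0..1} \<in> I"
          unfolding I_def by (intro UnI2 image_eqI[of _ _ "(e, e')"]) auto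
        ultimately show ?thesis by (intro bexI) auto
      qed (auto simp: I_def vertex_point_def)
      then show "u \<in> (\<Union>\<rho>\<in>I. K \<rho>)" using u by (auto simp: K_def)
    qed
    show "closed (K \<rho>)" if "\<rho> \<in> I" for \<rho>
    proof -
      have "closed ({a..b} \<inter> (\<lambda>u. (f u, g u)) -` \<rho>)"
        using clo[OF that] by (intro continuous_closed_preimage continuous_intros cont) auto
      moreover have "K \<rho> = {a..b} \<inter> (\<lambda>u. (f u, g u)) -` \<rho>" by (auto simp: K_def)
      ultimately show ?thesis by simp
    qed
    show "dist (f u) (f v) = dist (g u) (g v)" if "\<rho> \<in> I" "u \<in> K \<rho>" "v \<in> K \<rho>" for \<rho> u v
      using iso[OF that(1), of "(f u, g u)" "(f v, g v)"] that by (auto simp: K_def)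
  qed
qed

text \<open>The lengths are compared on the common refinement: on the overlap of two cells both
  curves represent the same part of the path, and cells that do not overlap contribute 0.\<close>

lemma decomposition_length_le:
  assumes D: "path_decomposition P \<gamma> ts ps" and D': "path_decomposition P \<gamma> us qs"
  shows "(\<Sum>j<length ps. curve_length (snd (ps ! j)) (ts ! j) (ts ! Suc j)) \<le>
    (\<Sum>k<length qs. curve_length (snd (qs ! k)) (us ! k) (us ! Suc k))"
proof -
  let ?f = "\<lambda>j. snd (ps ! j)" and ?g = "\<lambda>k. snd (qs ! k)"
  let ?m = "\<lambda>j k. max (ts ! j) (us ! k)" and ?M = "\<lambda>j k. min (ts ! Suc j) (us ! Suc k)"
  have "(\<Sum>j<length ps. curve_length (?f j) (ts ! j) (ts ! Suc j)) \<le>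
      (\<Sum>j<length ps. \<Sum>k<length qs. curve_length (?f j) (?m j k) (?M j k))"
  proof (rule sum_mono)
    fix j assume "j \<in> {..<length ps}"
    then have "us ! 0 \<le> ts ! j" "ts ! Suc j \<le> us ! length qs"
      using decomposition_facts(2,3)[OF D'] decomposition_facts(5)[OF D, of j]
        decomposition_facts(5)[OF D, of "Suc j"] by auto
    then show "curve_length (?f j) (ts ! j) (ts ! Suc j) \<le>
        (\<Sum>k<length qs. curve_length (?f j) (?m j k) (?M j k))"
      using curve_length_le_sum_partition[of "length qs" "\<lambda>k. us ! k" "ts ! j" "?f j" "ts ! Suc j"]
        decomposition_facts(4)[OF D'] by (simp add: less_imp_le min_absorb1)
  qed
  also have "\<dots> \<le> (\<Sum>j<length ps. \<Sum>k<length qs. curve_length (?g k) (?m j k) (?M j k))"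
  proof (intro sum_mono)
    fix j k assume jk: "j \<in> {..<length ps}" "k \<in> {..<length qs}"
    have sub: "{?m j k..?M j k} \<subseteq> {ts ! j..ts ! Suc j}" "{?m j k..?M j k} \<subseteq> {us ! k..us ! Suc k}" by auto
    show "curve_length (?f j) (?m j k) (?M j k) \<le> curve_length (?g k) (?m j k) (?M j k)"
    proof (rule curve_length_same_surface_curve)
      show "continuous_on {?m j k..?M j k} (?f j)" "continuous_on {?m j k..?M j k} (?g k)"
        using D D' jk sub unfolding path_decomposition_def by (blast intro: continuous_on_subset)+
      show "to_surface P (fst (ps ! j), ?f j u) = to_surface P (fst (qs ! k), ?g k u)"
        if "u \<in> {?m j k..?M j k}" for u
        using D D' jk that sub unfolding path_decomposition_def by (metis lessThan_iff subsetD)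
    qed (use D D' jk in \<open>auto simp: path_decomposition_def\<close>)
  qed
  also have "\<dots> = (\<Sum>k<length qs. \<Sum>j<length ps. curve_length (?g k) (max (us ! k) (ts ! j)) (min (us ! Suc k) (ts ! Suc j)))"
    by (subst sum.swap) (simp add: max.commute min.commute)
  also have "\<dots> \<le> (\<Sum>k<length qs. curve_length (?g k) (us ! k) (us ! Suc k))"
  proof (rule sum_mono)
    fix k assume k: "k \<in> {..<length qs}"
    then have "us ! k \<le> us ! Suc k" "us ! Suc k \<le> ts ! length ps"
      using decomposition_facts(3)[OF D] decomposition_facts(4)[OF D', of k] decomposition_facts(5)[OF D', of "Suc k"]
      by auto
    then show "(\<Sum>j<length ps. curve_length (?g k) (max (us ! k) (ts ! j)) (min (us ! Suc k) (ts ! Suc j))) \<le>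
        curve_length (?g k) (us ! k) (us ! Suc k)"
      using sum_partition_le_curve_length[of "length ps" "\<lambda>j. ts ! j" "us ! k" "us ! Suc k" "?g k"]
        decomposition_facts(4)[OF D] by (simp add: less_imp_le min_absorb1 max_absorb2)
  qed
  finally show ?thesis .
qed

lemma path_length_decomposition:
  assumes D: "path_decomposition P \<gamma> ts ps"
  shows "path_length P \<gamma> = (\<Sum>j<length ps. curve_length (snd (ps ! j)) (ts ! j) (ts ! Suc j))"
  unfolding path_length_def
proof (rule antisym)
  show "(INF (ts, ps)\<in>{(ts, ps). path_decomposition P \<gamma> ts ps}.
      \<Sum>j<length ps. curve_length (snd (ps ! j)) (ts ! j) (ts ! Suc j)) \<le>
      (\<Sum>j<length ps. curve_length (snd (ps ! j)) (ts ! j) (ts ! Suc j))"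
    by (rule INF_lower2[of "(ts, ps)"]) (use D in auto)
qed (auto intro!: INF_greatest decomposition_length_le[OF D])

lemma finite_path_length_decomposition:
  assumes "path_length P \<gamma> < \<infinity>"
  obtains ts ps where "path_decomposition P \<gamma> ts ps"
proof -
  have "{(ts, ps). path_decomposition P \<gamma> ts ps} \<noteq> {}"
  proof
    assume "{(ts, ps). path_decomposition P \<gamma> ts ps} = {}"
    then show False using assms unfolding path_length_def by (simp only: image_empty Inf_empty) simp
  qed
  then show ?thesis using that by auto
qed

lemma decomposition_chain:
  assumes D: "path_decomposition P \<gamma> ts ps"
  obtains qs where "chain P (\<gamma> 0) qs (\<gamma> 1)" "qs \<noteq> []" "chain_len qs \<le> path_length P \<gamma>"
proof -
  note facts = decomposition_facts[OF D]
  define \<phi> where "\<phi> = (\<lambda>j u. ts ! j + u * (ts ! Suc j - ts ! j))"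
  define qs where "qs = map (\<lambda>j. (fst (ps ! j), \<lambda>u. snd (ps ! j) (\<phi> j u))) [0..<length ps]"
  have \<phi>: "\<phi> j u \<in> {ts ! j..ts ! Suc j}" if "j < length ps" "u \<in> {0..1}" for j u
  proof -
    define d where "d = ts ! Suc j - ts ! j"
    have d: "d > 0" "ts ! Suc j = ts ! j + d" using facts(4)[OF that(1)] by (auto simp: d_def)
    have "u * d \<le> 1 * d" "0 \<le> u * d" using d that(2) by (auto intro: mult_right_mono)
    then show ?thesis unfolding \<phi>_def d_def[symmetric] using d(2) by auto
  qed
  have q: "piece P (qs ! j)" "\<And>u. u \<in> {0..1} \<Longrightarrow> piece_point P (qs ! j) u = \<gamma> (\<phi> j u)"
    if j: "j < length ps" for j
  proof -
    have Dj: "fst (ps ! j) < num_fragments P" "continuous_on {ts ! j..ts ! Suc j} (snd (ps ! j))"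
      "\<And>u. u \<in> {ts ! j..ts ! Suc j} \<Longrightarrow> snd (ps ! j) u \<in> fragment P (fst (ps ! j))"
      using D j by (auto simp: path_decomposition_def)
    have "continuous_on {0..1} (snd (ps ! j) \<circ> \<phi> j)"
    proof (rule continuous_on_compose)
      show "continuous_on (\<phi> j ` {0..1}) (snd (ps ! j))"
        by (rule continuous_on_subset[OF Dj(2)]) (use \<phi>[OF j] in blast)
    qed (auto simp: \<phi>_def intro!: continuous_intros)
    then show "piece P (qs ! j)"
      using Dj(1,3) j \<phi>[OF j] by (auto simp: piece_def qs_def o_def)
    show "\<And>u. u \<in> {0..1} \<Longrightarrow> piece_point P (qs ! j) u = \<gamma> (\<phi> j u)"
      using D j \<phi>[OF j] by (auto simp: piece_point_def qs_def path_decomposition_def)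
  qed
  have len: "length qs = length ps" by (simp add: qs_def)
  have "chain P (\<gamma> 0) qs (\<gamma> 1)"
  proof (rule chainI)
    show "qs \<noteq> []" using facts(1) len by auto
    then have "length qs - 1 < length ps" "Suc (length qs - 1) = length ps"
      using len by (cases qs; simp)+
    then show "piece_point P (qs ! (length qs - 1)) 1 = \<gamma> 1" using q(2)[of "length qs - 1" 1] facts(3)
      by (simp add: \<phi>_def)
    show "piece_point P (qs ! 0) 0 = \<gamma> 0" using q(2)[of 0 0] facts(1,2) by (simp add: \<phi>_def)
    show "piece_point P (qs ! j) 1 = piece_point P (qs ! Suc j) 0" if "Suc j < length qs" for j
      using q(2)[of j 1] q(2)[of "Suc j" 0] that len by (simp add: \<phi>_def)
  qed (use q len in auto)
  moreover have "chain_len qs \<le> path_length P \<gamma>"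
  proof -
    have "chain_len qs = (\<Sum>j<length ps. curve_length (\<lambda>u. snd (ps ! j) (\<phi> j u)) 0 1)"
      by (simp add: chain_len_def sum_list_sum_nth qs_def atLeast0LessThan)
    also have "\<dots> \<le> (\<Sum>j<length ps. curve_length (snd (ps ! j)) (ts ! j) (ts ! Suc j))"
    proof (rule sum_mono)
      fix j assume j: "j \<in> {..<length ps}"
      show "curve_length (\<lambda>u. snd (ps ! j) (\<phi> j u)) 0 1 \<le> curve_length (snd (ps ! j)) (ts ! j) (ts ! Suc j)"
      proof (rule curve_length_reparam)
        show "mono_on {0..1} (\<phi> j)"
          using facts(4)[of j] j by (auto simp: monotone_on_def \<phi>_def intro: mult_right_mono)
      qed (use \<phi> j in auto)
    qed
    finally show ?thesis by (simp add: path_length_decomposition[OF D])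
  qed
  ultimately show ?thesis using that len facts(1) by (metis length_0_conv)
qed

lemma shortest_path_chain:
  assumes "shortest_path P s t \<gamma>"
  obtains ps where "chain P s ps t" "ps \<noteq> []" "chain_len ps \<le> surface_dist P s t" "surface_dist P s t < \<infinity>"
proof -
  have *: "path_length P \<gamma> = surface_dist P s t" "path_length P \<gamma> < \<infinity>" "\<gamma> 0 = s" "\<gamma> 1 = t"
    using assms by (auto simp: shortest_path_def path_between_def)
  obtain ts ps where "path_decomposition P \<gamma> ts ps" using finite_path_length_decomposition[OF *(2)] .
  from decomposition_chain[OF this] obtain qs
    where "chain P (\<gamma> 0) qs (\<gamma> 1)" "qs \<noteq> []" "chain_len qs \<le> path_length P \<gamma>" .
  then show ?thesis using that * by simp
qed

end

section \<open>Geodesics in a polygon\<close>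

definition joined :: "complex set \<Rightarrow> complex \<Rightarrow> complex \<Rightarrow> ennreal \<Rightarrow> bool" where
  "joined F x y l \<longleftrightarrow> (\<exists>g. continuous_on {0..1} g \<and> g ` {0..1} \<subseteq> F \<and> g 0 = x \<and> g 1 = y \<and>
     curve_length g 0 1 \<le> l)"

lemma joined_segment: "closed_segment x y \<subseteq> F \<Longrightarrow> joined F x y (ennreal (dist x y))"
  unfolding joined_def
  by (intro exI[of _ "linepath x y"])
     (auto simp: linepath_image_01 curve_length_linepath linepath_0' linepath_1' intro: continuous_on_linepath)

lemma joined_trans:
  assumes "joined F x y l" "joined F y z k"
  shows "joined F x z (l + k)"
proof -
  obtain f where f: "continuous_on {0..1} f" "f ` {0..1} \<subseteq> F" "f 0 = x" "f 1 = y" "curve_length f 0 1 \<le> l"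
    using assms(1) by (auto simp: joined_def)
  obtain g where g: "continuous_on {0..1} g" "g ` {0..1} \<subseteq> F" "g 0 = y" "g 1 = z" "curve_length g 0 1 \<le> k"
    using assms(2) by (auto simp: joined_def)
  let ?h = "f +++ g"
  have "path ?h" using f g by (intro path_join_imp) (auto simp: path_def pathstart_def pathfinish_def)
  moreover have "path_image ?h \<subseteq> F"
    using f g path_image_join_subset[of f g] unfolding path_image_def by blast
  moreover have "?h 0 = x" "?h 1 = z" using f g by (auto simp: joinpaths_def)
  moreover have "curve_length ?h 0 1 \<le> l + k"
  proof -
    have "curve_length ?h 0 1 \<le> curve_length ?h 0 (1/2) + curve_length ?h (1/2) 1"
      by (rule curve_length_subadditive) auto
    also have "curve_length ?h 0 (1/2) = curve_length (\<lambda>u. f (2 * u)) 0 (1/2)"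
      by (intro curve_length_cong) (auto simp: joinpaths_def)
    also have "\<dots> \<le> curve_length f 0 1" by (rule curve_length_reparam) (auto simp: monotone_on_def)
    also have "curve_length ?h (1/2) 1 = curve_length (\<lambda>u. g (2 * u - 1)) (1/2) 1"
    proof (intro curve_length_cong)
      fix u :: real assume "u \<in> {1/2..1}"
      then consider "u = 1/2" | "u > 1/2" by force
      then show "?h u = g (2 * u - 1)"
      proof cases
        case 1
        show ?thesis unfolding 1 using f g by (simp add: joinpaths_def)
      qed (simp add: joinpaths_def)
    qed
    also have "\<dots> \<le> curve_length g 0 1" by (rule curve_length_reparam) (auto simp: monotone_on_def)
    finally show ?thesis using f g by (meson add_mono order_trans add_right_mono add_left_mono)
  qed
  ultimately show ?thesis unfolding joined_def path_def path_image_def by blast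
qed

text \<open>Otherwise the corner at \<open>q\<close> can be cut off inside the convex neighbourhood.\<close>

lemma straight_at_convex_point:
  assumes pq: "closed_segment p q \<subseteq> F" and qr: "closed_segment q r \<subseteq> F"
    and \<epsilon>: "0 < \<epsilon>" "convex (F \<inter> ball q \<epsilon>)"
    and shortest: "\<And>l. joined F p r l \<Longrightarrow> ennreal (dist p q + dist q r) \<le> l"
  shows "q \<in> closed_segment p r"
proof -
  \<comment> \<open>\<open>M\<close> exceeds both arms of the corner, so scaling them by
    \<open>t\<close> brings their ends into the ball around \<open>q\<close>.\<close>
  define M where "M = 1 + dist p q + dist q r"
  define t where "t = min 1 (\<epsilon> / M)"
  have M: "M \<ge> 1" "M > dist p q" "M > dist q r" by (auto simp: M_def add_nonneg_pos add_pos_nonneg)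
  have t: "0 < t" "t \<le> 1" "t * M \<le> \<epsilon>" using M \<epsilon> by (auto simp: t_def field_simps min_def)
  define p' where "p' = q + t *\<^sub>R (p - q)"
  define r' where "r' = q + t *\<^sub>R (r - q)"
  have p'eq: "p' = (1 - t) *\<^sub>R q + t *\<^sub>R p" and r'eq: "r' = (1 - t) *\<^sub>R q + t *\<^sub>R r"
    by (simp_all add: p'_def r'_def algebra_simps)
  have p'seg: "p' \<in> closed_segment q p" and r'seg: "r' \<in> closed_segment q r"
    unfolding in_segment p'eq r'eq using t by (auto intro!: exI[of _ t])
  have "t * dist p q < \<epsilon>" "t * dist q r < \<epsilon>"
    using t M mult_strict_left_mono[of "dist p q" M t] mult_strict_left_mono[of "dist q r" M t]
    by (linarith, linarith)
  then have "p' \<in> ball q \<epsilon>" "r' \<in> ball q \<epsilon>"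
    using t by (simp_all add: p'_def r'_def dist_norm norm_minus_commute)
  then have "p' \<in> F \<inter> ball q \<epsilon>" "r' \<in> F \<inter> ball q \<epsilon>"
    using p'seg r'seg pq qr by (auto simp: closed_segment_commute)
  then have "closed_segment p' r' \<subseteq> F" using \<epsilon>(2) by (meson closed_segment_subset le_infE)
  moreover have "closed_segment p p' \<subseteq> F" "closed_segment r' r \<subseteq> F"
    using p'seg r'seg pq qr
    by (metis closed_segment_commute ends_in_segment(1) ends_in_segment(2) subset_closed_segment subset_trans)+
  ultimately have "joined F p r (ennreal (dist p p') + (ennreal (dist p' r') + ennreal (dist r' r)))"
    by (intro joined_trans[OF joined_segment joined_trans[OF joined_segment joined_segment]])
  from shortest[OF this] have "dist p q + dist q r \<le> dist p p' + dist p' r' + dist r' r"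
    by (simp add: ennreal_plus[symmetric] add.assoc del: ennreal_plus)
  moreover have "p - p' = (1 - t) *\<^sub>R (p - q)" "r' - r = (1 - t) *\<^sub>R (q - r)" "p' - r' = t *\<^sub>R (p - r)"
    by (simp_all add: p'_def r'_def algebra_simps)
  then have "dist p p' = (1 - t) * dist p q" "dist r' r = (1 - t) * dist q r" "dist p' r' = t * dist p r"
    using t by (simp_all add: dist_norm)
  ultimately have "t * (dist p q + dist q r) \<le> t * dist p r" by (simp add: algebra_simps)
  then have "dist p q + dist q r \<le> dist p r" using t by simp
  then have "dist p r = dist p q + dist q r" using dist_triangle[of p r q] by simp
  then show ?thesis by (simp add: between_mem_segment[symmetric] between)
qed

text \<open>Minimality is required between any two parameters, so that it is inherited by
  subintervals. Competitors stay in \<open>F\<close>.\<close>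

definition geodesic :: "complex set \<Rightarrow> (real \<Rightarrow> complex) \<Rightarrow> real \<Rightarrow> real \<Rightarrow> bool" where
  "geodesic F f a b \<longleftrightarrow> continuous_on {a..b} f \<and> f ` {a..b} \<subseteq> F \<and>
     (\<forall>x z l. a \<le> x \<longrightarrow> x \<le> z \<longrightarrow> z \<le> b \<longrightarrow> joined F (f x) (f z) l \<longrightarrow> curve_length f x z \<le> l)"

lemma geodesicD:
  assumes "geodesic F f a b" "a \<le> x" "x \<le> z" "z \<le> b" "joined F (f x) (f z) l"
  shows "curve_length f x z \<le> l"
  using assms unfolding geodesic_def by blast

lemma geodesic_subset:
  assumes "geodesic F f a b" "a \<le> a'" "b' \<le> b"
  shows "geodesic F f a' b'"
  using assms continuous_on_subset[of "{a..b}" f "{a'..b'}"] unfolding geodesic_def by force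

text \<open>Equal points are joined by a constant curve of length 0, so a geodesic can pause at a
  point but never return to it.\<close>

lemma geodesic_constant:
  assumes "geodesic F f a b" "a \<le> u" "u \<le> w" "w \<le> v" "v \<le> b" "f u = f v"
  shows "f w = f u"
proof -
  have "f u \<in> F" using assms by (auto simp: geodesic_def)
  then have "joined F (f u) (f v) 0" using joined_segment[of "f u" "f u" F] assms by simp
  then have "curve_length f u v \<le> 0" using assms by (intro geodesicD[OF assms(1)]) auto
  moreover have "ennreal (dist (f u) (f w)) \<le> curve_length f u w" using assms by (intro dist_le_curve_length)
  moreover have "curve_length f u w \<le> curve_length f u v" using assms by (intro curve_length_mono) auto
  ultimately have "ennreal (dist (f u) (f w)) \<le> 0" by (meson order_trans)
  then show ?thesis by (simp add: ennreal_eq_0_iff)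
qed

text \<open>Compactness makes the radius of convexity uniform along the curve. On a partition finer
  than this radius every step is a segment in \<open>F\<close>, and no corner is possible between
  the chord reached so far and the next step.\<close>

lemma geodesic_straight:
  assumes f: "geodesic F f x y" "x \<le> y"
    and convex: "\<And>u. u \<in> {x..y} \<Longrightarrow> \<exists>\<epsilon>>0. convex (F \<inter> ball (f u) \<epsilon>)"
  shows "curve_length f x y \<le> ennreal (dist (f x) (f y))"
proof -
  have cont: "continuous_on {x..y} f" and fF: "f ` {x..y} \<subseteq> F" using f by (auto simp: geodesic_def)
  define \<G> where "\<G> = {ball w \<epsilon> | w \<epsilon>. convex (F \<inter> ball w \<epsilon>)}"
  have "compact (f ` {x..y})" using cont by (intro compact_continuous_image) auto
  moreover have "f ` {x..y} \<subseteq> \<Union>\<G>"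
  proof (rule image_subsetI)
    fix u assume "u \<in> {x..y}"
    then obtain \<epsilon> where "\<epsilon> > 0" "convex (F \<inter> ball (f u) \<epsilon>)" using convex by blast
    then show "f u \<in> \<Union>\<G>" unfolding \<G>_def by (intro UnionI[of "ball (f u) \<epsilon>"]) auto
  qed
  ultimately obtain e where e: "0 < e" "\<And>w. w \<in> f ` {x..y} \<Longrightarrow> \<exists>G\<in>\<G>. ball w e \<subseteq> G"
    by (rule Heine_Borel_lemma) (auto simp: \<G>_def)
  have conv: "convex (F \<inter> ball w e)" if w: "w \<in> f ` {x..y}" for w
  proof -
    obtain G where G: "G \<in> \<G>" "ball w e \<subseteq> G" using e(2)[OF w] by blast
    then have "convex (F \<inter> G)" by (auto simp: \<G>_def)
    then have "convex ((F \<inter> G) \<inter> ball w e)" by (rule convex_Int) simp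
    moreover have "(F \<inter> G) \<inter> ball w e = F \<inter> ball w e" using G by auto
    ultimately show ?thesis by simp
  qed
  have "uniformly_continuous_on {x..y} f" using cont by (intro compact_uniformly_continuous) auto
  then obtain \<delta> where \<delta>: "\<delta> > 0" "\<And>u v. u \<in> {x..y} \<Longrightarrow> v \<in> {x..y} \<Longrightarrow> dist v u < \<delta> \<Longrightarrow> dist (f v) (f u) < e"
    unfolding uniformly_continuous_on_def using e(1) by metis
  obtain N :: nat where N: "(y - x) / \<delta> < N" using reals_Archimedean2 by blast
  have N0: "N > 0" using N f(2) \<delta>(1) by (metis divide_nonneg_pos diff_ge_0_iff_ge not_le of_nat_0 gr0I)
  define t where "t = (\<lambda>k. x + real k * ((y - x) / N))"
  have t_mono: "t k \<le> t (Suc k)" for k using f(2) N0 by (simp add: t_def divide_right_mono distrib_right)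
  have t_range: "t k \<in> {x..y}" if "k \<le> N" for k
  proof -
    have "real k * ((y - x) / N) \<le> N * ((y - x) / N)" using that f(2) by (intro mult_right_mono) auto
    then show ?thesis using f(2) N0 by (auto simp: t_def)
  qed
  have t_step: "dist (t (Suc k)) (t k) < \<delta>" for k
  proof -
    have "t (Suc k) - t k = (y - x) / N"
      unfolding t_def of_nat_Suc by (simp only: left_diff_distrib[symmetric] add_diff_cancel_left) simp
    moreover have "(y - x) / N < \<delta>" using N N0 \<delta>(1) by (simp add: field_simps)
    ultimately show ?thesis using f(2) N0 by (simp add: dist_real_def)
  qed
  \<comment> \<open>That the chord lies in \<open>F\<close> is carried along, because the corner
    argument needs both arms inside \<open>F\<close>.\<close>
  have "closed_segment (f x) (f (t k)) \<subseteq> F \<and> curve_length f x (t k) \<le> ennreal (dist (f x) (f (t k)))"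
    if "k \<le> N" for k
    using that
  proof (induction k)
    case 0
    then show ?case using fF f(2) by (auto simp: t_def curve_length_empty)
  next
    case (Suc k)
    let ?p = "f x" and ?q = "f (t k)" and ?r = "f (t (Suc k))"
    have tk: "t k \<in> {x..y}" "t (Suc k) \<in> {x..y}" using t_range[of k] t_range[of "Suc k"] Suc.prems by auto
    have IH: "closed_segment ?p ?q \<subseteq> F" "curve_length f x (t k) \<le> ennreal (dist ?p ?q)" using Suc by auto
    have "?q \<in> F \<inter> ball ?q e" "?r \<in> F \<inter> ball ?q e"
      using fF tk e(1) \<delta>(2)[OF tk t_step] by (auto simp: dist_commute)
    then have qr: "closed_segment ?q ?r \<subseteq> F" using conv[of ?q] tk
      by (meson closed_segment_subset le_infE imageI)
    have len: "curve_length f (t k) (t (Suc k)) \<le> ennreal (dist ?q ?r)"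
      using f(1) joined_segment[OF qr] tk t_mono[of k] by (auto simp: geodesic_def)
    have q: "?q \<in> closed_segment ?p ?r"
    proof (rule straight_at_convex_point[OF IH(1) qr e(1)])
      show "convex (F \<inter> ball ?q e)" using conv tk by auto
      fix l assume "joined F ?p ?r l"
      then have "curve_length f x (t (Suc k)) \<le> l" using f(1) tk by (auto simp: geodesic_def)
      moreover have "ennreal (dist ?p ?q + dist ?q ?r) \<le> curve_length f x (t k) + curve_length f (t k) (t (Suc k))"
        using tk t_mono[of k] by (auto intro!: add_mono dist_le_curve_length)
      moreover have "\<dots> \<le> curve_length f x (t (Suc k))"
        using tk t_mono[of k] by (intro curve_length_superadditive) auto
      ultimately show "ennreal (dist ?p ?q + dist ?q ?r) \<le> l" by (meson order_trans)
    qed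
    then have "closed_segment ?p ?r \<subseteq> F" using Un_closed_segment[OF q] IH(1) qr by blast
    moreover have "curve_length f x (t (Suc k)) \<le> ennreal (dist ?p ?q) + ennreal (dist ?q ?r)"
      using curve_length_subadditive[of x "t k" "t (Suc k)" f] tk t_mono[of k] add_mono[OF IH(2) len] by auto
    moreover have "dist ?p ?r = dist ?p ?q + dist ?q ?r"
      using q by (simp add: between_mem_segment[symmetric] between)
    ultimately show ?case by simp
  qed
  from this[of N] show ?thesis using N0 by (simp add: t_def)
qed

text \<open>The ends may be vertices, where local convexity fails. Between inner times the curve is
  straight, and the chords stay in the closed set \<open>F\<close> when these times tend to the
  ends.\<close>

lemma geodesic_straight_open:
  assumes f: "geodesic F f a b" "a < b" and F: "closed F"
    and convex: "\<And>u. u \<in> {a<..<b} \<Longrightarrow> \<exists>\<epsilon>>0. convex (F \<inter> ball (f u) \<epsilon>)"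
  shows "curve_length f a b \<le> ennreal (dist (f a) (f b))"
proof -
  have cont: "continuous_on {a..b} f" using f by (simp add: geodesic_def)
  have "closed_segment (f a) (f b) \<subseteq> F"
  proof
    fix z assume "z \<in> closed_segment (f a) (f b)"
    then obtain l where l: "0 \<le> l" "l \<le> 1" "z = linepath (f a) (f b) l"
      by (auto simp: linepath_image_01[symmetric])
    \<comment> \<open>For \<open>u > 0\<close> this is a point of the chord between two inner times,
      hence in \<open>F\<close>; for \<open>u = 0\<close> it is \<open>z\<close>.\<close>
    define h where "h = (\<lambda>u. linepath (f (a + u * (b - a))) (f (b - u * (b - a))) l)"
    have in_ab: "a + u * (b - a) \<in> {a..b}" "b - u * (b - a) \<in> {a..b}" if "u \<in> {0..1/4}" for u
    proof -
      define d where "d = b - a"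
      have d: "d > 0" "b = a + d" using f(2) by (auto simp: d_def)
      have "0 \<le> u * d" "u * d \<le> (1/4) * d" using that d by (auto intro: mult_right_mono)
      then show "a + u * (b - a) \<in> {a..b}" "b - u * (b - a) \<in> {a..b}"
        unfolding d_def[symmetric] using d by auto
    qed
    have "continuous_on {0..1/4} h"
      unfolding h_def linepath_def
      by (intro continuous_intros continuous_on_compose2[OF cont]) (use in_ab in auto)
    moreover have "h ` {0<..1/4} \<subseteq> F"
    proof (rule image_subsetI)
      fix u :: real assume u: "u \<in> {0<..1/4}"
      let ?x = "a + u * (b - a)" and ?y = "b - u * (b - a)"
      have 1: "0 < u * (b - a)" and 2: "u * (b - a) \<le> (1/4) * (b - a)"
        using u f(2) by (auto intro: mult_right_mono)
      have xy: "a < ?x" "?x \<le> ?y" "?y < b"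
        subgoal using 1 by linarith
        subgoal
        proof -
          have "x \<le> (1/4) * y \<Longrightarrow> 0 < y \<Longrightarrow> b = a + y \<Longrightarrow> a + x \<le> b - x" for x y by linarith
          from this[OF 2] f(2) show ?thesis by auto
        qed
        subgoal using 1 by linarith
        done
      have g: "geodesic F f ?x ?y" by (rule geodesic_subset[OF f(1)]) (use xy in auto)
      have "f ` {?x..?y} = closed_segment (f ?x) (f ?y)"
      proof (rule curve_length_straight[OF xy(2)])
        show "continuous_on {?x..?y} f" using g by (simp add: geodesic_def)
        show "curve_length f ?x ?y \<le> ennreal (dist (f ?x) (f ?y))"
          by (rule geodesic_straight[OF g xy(2)]) (rule convex, use xy in auto)
      qed
      moreover have "h u \<in> closed_segment (f ?x) (f ?y)"
        unfolding h_def linepath_image_01[symmetric] using l by auto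
      ultimately show "h u \<in> F" using g by (auto simp: geodesic_def)
    qed
    ultimately have "h ` closure {0<..1/4} \<subseteq> F" using F by (intro image_closure_subset) auto
    moreover have "h 0 = z" by (simp add: h_def l(3))
    ultimately show "z \<in> F" by (auto simp: image_subset_iff)
  qed
  from joined_segment[OF this] show ?thesis using f by (auto simp: geodesic_def)
qed

fun polyline :: "complex set \<Rightarrow> complex set \<Rightarrow> complex \<Rightarrow> (complex \<times> complex) list \<Rightarrow> complex \<Rightarrow> bool" where
  "polyline F V x [] y \<longleftrightarrow> x = y"
| "polyline F V x ((p, q) # qs) y \<longleftrightarrow> p = x \<and> closed_segment p q \<subseteq> F \<and> open_segment p q \<inter> V = {} \<and>
     polyline F V q qs y"

lemma polyline_append: "polyline F V x (ps @ qs) y \<longleftrightarrow> (\<exists>w. polyline F V x ps w \<and> polyline F V w qs y)"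
  by (induction ps arbitrary: x) auto

text \<open>Induction on the number of points of \<open>V\<close> met between the ends. Splitting at
  such a point makes it an end of both halves, and by \<open>geodesic_constant\<close> no half meets
  the far end of the other.\<close>

lemma geodesic_polyline:
  assumes "geodesic F f a b" "a \<le> b" "closed F" "finite V"
    and "\<And>z. z \<in> F - V \<Longrightarrow> \<exists>\<epsilon>>0. convex (F \<inter> ball z \<epsilon>)"
  shows "\<exists>qs. polyline F V (f a) qs (f b) \<and>
    ennreal (\<Sum>(p, q)\<leftarrow>qs. dist p q) \<le> curve_length f a b"
  using assms(1,2)
proof (induction "card {v \<in> V. v \<in> f ` {a..b} \<and> v \<noteq> f a \<and> v \<noteq> f b}" arbitrary: a b rule: less_induct)
  case less
  let ?W = "\<lambda>a b. {v \<in> V. v \<in> f ` {a..b} \<and> v \<noteq> f a \<and> v \<noteq> f b}"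
  have cont: "continuous_on {a..b} f" and fF: "f ` {a..b} \<subseteq> F" using less.prems by (auto simp: geodesic_def)
  show ?case
  proof (cases "?W a b = {}")
    case False
    then obtain c where c: "c \<in> {a..b}" "f c \<in> V" "f c \<noteq> f a" "f c \<noteq> f b" by blast
    have "?W a c \<subset> ?W a b"
    proof
      show "?W a c \<subseteq> ?W a b"
        using c geodesic_constant[OF less.prems(1), of _ c b] by fastforce
      show "?W a c \<noteq> ?W a b" using c by blast
    qed
    then have "card (?W a c) < card (?W a b)" using assms(4) by (intro psubset_card_mono) auto
    from less.hyps[OF this] obtain ps where ps: "polyline F V (f a) ps (f c)"
        "ennreal (\<Sum>(p, q)\<leftarrow>ps. dist p q) \<le> curve_length f a c"
      using geodesic_subset[OF less.prems(1)] c by fastforce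
    have "?W c b \<subset> ?W a b"
    proof
      show "?W c b \<subseteq> ?W a b"
      proof clarify
        fix u assume u: "u \<in> {c..b}" "f u \<noteq> f c" "f u \<noteq> f b"
        have "f u \<noteq> f a"
        proof
          assume "f u = f a"
          then have "f c = f a" using geodesic_constant[OF less.prems(1), of a c u] u c by auto
          then show False using c by simp
        qed
        then show "f u \<in> f ` {a..b} \<and> f u \<noteq> f a \<and> f u \<noteq> f b" using u c by auto
      qed
      show "?W c b \<noteq> ?W a b" using c by blast
    qed
    then have "card (?W c b) < card (?W a b)" using assms(4) by (intro psubset_card_mono) auto
    from less.hyps[OF this] obtain qs where qs: "polyline F V (f c) qs (f b)"
        "ennreal (\<Sum>(p, q)\<leftarrow>qs. dist p q) \<le> curve_length f c b"
      using geodesic_subset[OF less.prems(1)] c by fastforce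
    have nonneg: "0 \<le> (\<Sum>(p, q)\<leftarrow>xs. dist p q)" for xs :: "(complex \<times> complex) list"
      by (intro sum_list_nonneg) auto
    have "ennreal (\<Sum>(p, q)\<leftarrow>ps @ qs. dist p q) \<le> curve_length f a c + curve_length f c b"
      using add_mono[OF ps(2) qs(2)] nonneg by (simp add: ennreal_plus[symmetric] del: ennreal_plus)
    also have "\<dots> \<le> curve_length f a b" using c by (intro curve_length_superadditive) auto
    finally show ?thesis using ps(1) qs(1) by (intro exI[of _ "ps @ qs"]) (auto simp: polyline_append)
  next
    case True
    show ?thesis
    proof (cases "f a = f b")
      case True
      then show ?thesis by (intro exI[of _ "[]"]) auto
    next
      case False
      \<comment> \<open>The last time at \<open>f a\<close>, and below the first time after it at
        \<open>f b\<close>: pauses at the ends are cut off, since the ends may lie in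
        \<open>V\<close>.\<close>
      define \<alpha> where "\<alpha> = Sup ({a..b} \<inter> f -` {f a})"
      have "closed ({a..b} \<inter> f -` {f a})" by (intro continuous_closed_preimage cont) auto
      moreover have "a \<in> {a..b} \<inter> f -` {f a}" using less.prems by auto
      moreover have bdd: "bdd_above ({a..b} \<inter> f -` {f a})" by (rule bdd_above_mono[of "{a..b}"]) auto
      ultimately have "\<alpha> \<in> {a..b} \<inter> f -` {f a}"
        unfolding \<alpha>_def by (intro closed_contains_Sup) auto
      then have \<alpha>: "\<alpha> \<in> {a..b}" "f \<alpha> = f a" by auto
      have \<alpha>_max: "u \<le> \<alpha>" if "u \<in> {a..b}" "f u = f a" for u
        unfolding \<alpha>_def using that bdd by (intro cSup_upper) auto
      define \<beta> where "\<beta> = Inf ({\<alpha>..b} \<inter> f -` {f b})"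
      have "closed ({\<alpha>..b} \<inter> f -` {f b})"
        using \<alpha> by (intro continuous_closed_preimage continuous_on_subset[OF cont]) auto
      moreover have "b \<in> {\<alpha>..b} \<inter> f -` {f b}" using \<alpha> by auto
      moreover have bdd: "bdd_below ({\<alpha>..b} \<inter> f -` {f b})" by (rule bdd_below_mono[of "{\<alpha>..b}"]) auto
      ultimately have "\<beta> \<in> {\<alpha>..b} \<inter> f -` {f b}"
        unfolding \<beta>_def by (intro closed_contains_Inf) auto
      then have \<beta>: "\<beta> \<in> {\<alpha>..b}" "f \<beta> = f b" by auto
      have \<beta>_min: "\<beta> \<le> u" if "u \<in> {\<alpha>..b}" "f u = f b" for u
        unfolding \<beta>_def using that bdd by (intro cInf_lower) auto
      have less': "\<alpha> < \<beta>" using \<alpha> \<beta> False by (cases "\<alpha> = \<beta>") auto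
      have avoid: "f u \<notin> V" if "u \<in> {\<alpha><..<\<beta>}" for u
      proof -
        have "u \<in> {a..b}" "f u \<noteq> f a" "f u \<noteq> f b" using that \<alpha>_max[of u] \<beta>_min[of u] \<alpha> \<beta> by auto
        then show ?thesis using True by blast
      qed
      have g: "geodesic F f \<alpha> \<beta>" by (rule geodesic_subset[OF less.prems(1)]) (use \<alpha> \<beta> in auto)
      have "curve_length f \<alpha> \<beta> \<le> ennreal (dist (f \<alpha>) (f \<beta>))"
      proof (rule geodesic_straight_open[OF g less' assms(3)])
        fix u assume u: "u \<in> {\<alpha><..<\<beta>}"
        show "\<exists>\<epsilon>>0. convex (F \<inter> ball (f u) \<epsilon>)"
          by (rule assms(5)) (use avoid[OF u] u fF \<alpha> \<beta> in auto)
      qed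
      then have img: "f ` {\<alpha>..\<beta>} = closed_segment (f a) (f b)"
        using curve_length_straight[of \<alpha> \<beta> f] g less' \<alpha> \<beta> by (auto simp: geodesic_def)
      have "z \<notin> V" if z: "z \<in> open_segment (f a) (f b)" for z
      proof -
        have "z \<in> f ` {\<alpha>..\<beta>}" using z unfolding img open_segment_def by blast
        then obtain u where u: "u \<in> {\<alpha>..\<beta>}" "z = f u" by blast
        then have "u \<noteq> \<alpha>" "u \<noteq> \<beta>" using z \<alpha> \<beta> by (auto simp: open_segment_def)
        then show ?thesis using u avoid by auto
      qed
      moreover have "closed_segment (f a) (f b) \<subseteq> F" using img g by (auto simp: geodesic_def)
      ultimately show ?thesis
        using dist_le_curve_length[OF less.prems(2), of f]
        by (intro exI[of _ "[(f a, f b)]"]) auto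
    qed
  qed
qed

text \<open>Up to the factor \<open>norm d\<close>, \<open>Im ((w - z) / d)\<close> is the signed
  distance of \<open>w\<close> from the line through \<open>z\<close> in direction \<open>d\<close>,
  and it is affine in \<open>w\<close>.\<close>

lemma convex_Im_vimage:
  assumes "convex I"
  shows "convex {w. Im ((w - z) / d) \<in> I}"
proof -
  have "linear (\<lambda>w. Im (w / d))"
    by (intro bounded_linear.linear bounded_linear_compose[OF bounded_linear_Im] bounded_linear_divide)
  then have "convex ((\<lambda>w. Im (w / d)) -` ((+) (Im (z / d)) ` I))"
    using assms by (intro convex_linear_vimage convex_translation)
  moreover have "(\<lambda>w. Im (w / d)) -` ((+) (Im (z / d)) ` I) = {w. Im ((w - z) / d) \<in> I}"
  proof -
    have "Im (w / d) \<in> (+) (Im (z / d)) ` I \<longleftrightarrow> Im ((w - z) / d) \<in> I" for w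
    proof -
      have "Im ((w - z) / d) = Im (w / d) - Im (z / d)" by (simp add: diff_divide_distrib)
      then show ?thesis by (auto simp: image_iff intro!: bexI[of _ "Im (w / d) - Im (z / d)"])
    qed
    then show ?thesis by auto
  qed
  ultimately show ?thesis by simp
qed

text \<open>Near an interior point of a side, each of the two open half discs lies inside or outside.\<close>

lemma poly_region_locally_convex:
  assumes vs: "simple_polygon vs" and z: "z \<in> poly_region vs" "z \<notin> set vs"
  shows "\<exists>\<epsilon>>0. convex (poly_region vs \<inter> ball z \<epsilon>)"
proof (cases "z \<in> poly_boundary vs")
  case False
  then have "z \<in> inside (poly_boundary vs)" using z by (auto simp: poly_region_def)
  moreover have "open (inside (poly_boundary vs))"
    unfolding poly_boundary_def poly_side_def by (intro open_inside closed_UN) auto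
  ultimately obtain \<epsilon> where "\<epsilon> > 0" "ball z \<epsilon> \<subseteq> inside (poly_boundary vs)"
    by (meson open_contains_ball)
  then have "poly_region vs \<inter> ball z \<epsilon> = ball z \<epsilon>" by (auto simp: poly_region_def)
  then show ?thesis using \<open>\<epsilon> > 0\<close> by (intro exI[of _ \<epsilon>]) simp
next
  case True
  then obtain j where j: "j < length vs" "z \<in> poly_side vs j" by (auto simp: poly_boundary_def)
  define a where "a = poly_vertex vs j"
  define b where "b = poly_vertex vs (Suc j)"
  let ?B = "poly_boundary vs" and ?h = "\<lambda>w. Im ((w - z) / (b - a))"
  have "vs \<noteq> []" using j by auto
  then have zo: "z \<in> open_segment a b" using poly_side_cases j(2) z(2) unfolding a_def b_def by blast
  have ab: "a \<noteq> b" using zo by auto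
  define C where "C = (\<Union>k\<in>{..<length vs} - {j}. poly_side vs k)"
  have "closed C" unfolding C_def poly_side_def by (intro closed_UN) auto
  moreover have "z \<notin> C"
    using open_side_unique[OF vs j(1)] zo unfolding a_def b_def C_def by auto
  ultimately obtain r where r: "r > 0" "ball z r \<subseteq> - C"
    using open_contains_ball[of "- C"] by auto
  \<comment> \<open>The ball meets no other side and does not reach the ends of this one, so inside
    it the boundary is the line through \<open>a\<close> and \<open>b\<close>.\<close>
  define \<epsilon> where "\<epsilon> = min r (min (dist z a) (dist z b))"
  have \<epsilon>: "\<epsilon> > 0" using r zo by (auto simp: \<epsilon>_def open_segment_def)
  obtain l where l: "0 < l" "l < 1" "z = a + l *\<^sub>R (b - a)"
    using zo by (auto simp: in_segment algebra_simps)
  have line: "w \<in> ?B \<longleftrightarrow> ?h w = 0" if w: "w \<in> ball z \<epsilon>" for w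
  proof
    assume "w \<in> ?B"
    then have "w \<in> closed_segment a b" using w r by (auto simp: poly_boundary_def C_def \<epsilon>_def poly_side_def a_def b_def)
    then obtain k where k: "w = a + k *\<^sub>R (b - a)" by (auto simp: in_segment algebra_simps)
    have "w - z = of_real (k - l) * (b - a)"
      unfolding k l(3) add_diff_cancel_left by (simp add: scaleR_conv_of_real left_diff_distrib)
    then show "?h w = 0" using ab by (metis Im_complex_of_real nonzero_mult_div_cancel_right right_minus_eq)
  next
    assume h: "?h w = 0"
    define k where "k = Re ((w - z) / (b - a))"
    have "(w - z) / (b - a) = of_real k" using h by (simp add: k_def complex_eq_iff)
    then have wz: "w - z = k *\<^sub>R (b - a)" using ab by (simp add: field_simps scaleR_conv_of_real)
    have d: "dist w z < dist z a" "dist w z < dist z b" using w by (auto simp: \<epsilon>_def dist_commute)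
    have "b - z = (1 - l) *\<^sub>R (b - a)" using l by (simp add: algebra_simps)
    then have "dist z b = (1 - l) * norm (b - a)"
      using l(2) by (simp add: dist_norm norm_minus_commute[of z b] del: l(3))
    moreover have "dist z a = l * norm (b - a)" using l by (simp add: dist_norm)
    moreover have "dist w z = \<bar>k\<bar> * norm (b - a)" using wz by (simp add: dist_norm)
    ultimately have "\<bar>k\<bar> < l" "\<bar>k\<bar> < 1 - l" using d ab by auto
    moreover have "w = a + l *\<^sub>R (b - a) + k *\<^sub>R (b - a)"
      using wz unfolding l(3)[symmetric] diff_eq_eq by (simp only: add.commute)
    then have "w = (1 - (l + k)) *\<^sub>R a + (l + k) *\<^sub>R b" by (simp add: algebra_simps)
    ultimately have "w \<in> closed_segment a b" unfolding in_segment by (intro exI[of _ "l + k"]) auto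
    then show "w \<in> ?B" using j by (auto simp: poly_boundary_def poly_side_def a_def b_def)
  qed
  \<comment> \<open>The part of the disc on one side of the line is convex and misses the boundary,
    so a single point inside puts all of it inside.\<close>
  have half: "{w \<in> ball z \<epsilon>. ?h w \<in> I} \<subseteq> inside ?B"
    if I: "convex I" "0 \<notin> I" and w: "w \<in> ball z \<epsilon>" "?h w \<in> I" "w \<in> inside ?B" for I w
  proof
    let ?H = "ball z \<epsilon> \<inter> {w. ?h w \<in> I}"
    fix v assume "v \<in> {w \<in> ball z \<epsilon>. ?h w \<in> I}"
    moreover have "connected ?H" using I by (intro convex_connected convex_Int convex_Im_vimage) auto
    moreover have "?H \<subseteq> - ?B" using line I(2) by auto
    ultimately have "connected_component (- ?B) w v"
      unfolding connected_component_def using w by (intro exI[of _ ?H]) auto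
    then show "v \<in> inside ?B" using inside_same_component w(3) by blast
  qed
  have region: "w \<in> poly_region vs \<longleftrightarrow> ?h w = 0 \<or> w \<in> inside ?B" if "w \<in> ball z \<epsilon>" for w
    using line[OF that] by (auto simp: poly_region_def)
  define pos where "pos \<longleftrightarrow> (\<exists>w\<in>ball z \<epsilon>. ?h w > 0 \<and> w \<in> inside ?B)"
  define neg where "neg \<longleftrightarrow> (\<exists>w\<in>ball z \<epsilon>. ?h w < 0 \<and> w \<in> inside ?B)"
  \<comment> \<open>Whichever of the half discs lie inside, the region near \<open>z\<close> is the
    preimage of a convex set of signed distances.\<close>
  define J where "J = (if pos then if neg then UNIV else {0..} else if neg then {..0} else {0::real})"
  have J: "convex J" by (auto simp: J_def)
  have "w \<in> poly_region vs \<longleftrightarrow> ?h w \<in> J" if w: "w \<in> ball z \<epsilon>" for w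
  proof -
    have "w \<in> inside ?B \<longleftrightarrow> pos" if "?h w > 0"
      using half[of "{0<..}"] w that unfolding pos_def by force
    moreover have "w \<in> inside ?B \<longleftrightarrow> neg" if "?h w < 0"
      using half[of "{..<0}"] w that unfolding neg_def by force
    ultimately show ?thesis unfolding region[OF w] J_def
      by (cases "?h w" "0::real" rule: linorder_cases) auto
  qed
  then have "poly_region vs \<inter> ball z \<epsilon> = {w. ?h w \<in> J} \<inter> ball z \<epsilon>" by auto
  moreover have "convex ({w. ?h w \<in> J} \<inter> ball z \<epsilon>)"
    using J by (intro convex_Int convex_Im_vimage) auto
  ultimately show ?thesis using \<epsilon> by auto
qed

section \<open>Shortest chains of segments\<close>

type_synonym seg = "nat \<times> complex \<times> complex"

abbreviation frg :: "seg \<Rightarrow> nat" where "frg x \<equiv> fst x"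
abbreviation src :: "seg \<Rightarrow> complex" where "src x \<equiv> fst (snd x)"
abbreviation tgt :: "seg \<Rightarrow> complex" where "tgt x \<equiv> snd (snd x)"

definition seg_in :: "portalgon \<Rightarrow> seg \<Rightarrow> bool" where
  "seg_in P x \<longleftrightarrow> frg x < num_fragments P \<and> closed_segment (src x) (tgt x) \<subseteq> fragment P (frg x) \<and>
     open_segment (src x) (tgt x) \<inter> set (fragments P ! frg x) = {}"

definition seg_piece :: "seg \<Rightarrow> nat \<times> (real \<Rightarrow> complex)" where
  "seg_piece x = (frg x, linepath (src x) (tgt x))"

definition seg_start :: "portalgon \<Rightarrow> seg \<Rightarrow> (nat \<times> complex) set" where
  "seg_start P x = to_surface P (frg x, src x)"

definition seg_end :: "portalgon \<Rightarrow> seg \<Rightarrow> (nat \<times> complex) set" where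
  "seg_end P x = to_surface P (frg x, tgt x)"

fun seg_chain :: "portalgon \<Rightarrow> (nat \<times> complex) set \<Rightarrow> seg list \<Rightarrow> (nat \<times> complex) set \<Rightarrow> bool" where
  "seg_chain P s [] t \<longleftrightarrow> s = t"
| "seg_chain P s (x # xs) t \<longleftrightarrow> seg_in P x \<and> seg_start P x = s \<and> seg_chain P (seg_end P x) xs t"

definition seg_len :: "seg list \<Rightarrow> real" where
  "seg_len xs = (\<Sum>x\<leftarrow>xs. dist (src x) (tgt x))"

lemma seg_len_simps [simp]:
  "seg_len [] = 0" "seg_len (x # xs) = dist (src x) (tgt x) + seg_len xs"
  "seg_len (xs @ ys) = seg_len xs + seg_len ys"
  by (simp_all add: seg_len_def)

lemma seg_len_nonneg: "0 \<le> seg_len xs"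
  by (induction xs) auto

lemma seg_chain_append: "seg_chain P s (xs @ ys) t \<longleftrightarrow> (\<exists>w. seg_chain P s xs w \<and> seg_chain P w ys t)"
  by (induction xs arbitrary: s) auto

lemma piece_linepath:
  "i < num_fragments P \<Longrightarrow> closed_segment a b \<subseteq> fragment P i \<Longrightarrow> piece P (i, linepath a b)"
  by (simp add: piece_def linepath_image_01 continuous_on_linepath)

lemma seg_piece_point:
  "piece_point P (seg_piece x) 0 = seg_start P x" "piece_point P (seg_piece x) 1 = seg_end P x"
  by (simp_all add: piece_point_def seg_piece_def seg_start_def seg_end_def linepath_0' linepath_1')

lemma seg_chain_chain: "seg_chain P s xs t \<Longrightarrow> chain P s (map seg_piece xs) t"
proof (induction xs arbitrary: s)
  case (Cons x xs)
  then show ?case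
    using piece_linepath[of "frg x" P "src x" "tgt x"] seg_piece_point[of P x]
    by (auto simp: seg_in_def seg_piece_def)
qed simp

lemma chain_len_seg_piece: "chain_len (map seg_piece xs) \<le> ennreal (seg_len xs)"
proof (induction xs)
  case (Cons x xs)
  have "chain_len (map seg_piece (x # xs)) \<le> ennreal (dist (src x) (tgt x)) + ennreal (seg_len xs)"
    using add_mono[OF curve_length_linepath[of "src x" "tgt x"] Cons] by (simp add: seg_piece_def[of x])
  then show ?case by (simp add: seg_len_nonneg)
qed simp

lemma seg_chain_nth:
  assumes "seg_chain P s xs t"
  shows seg_chain_in: "r < length xs \<Longrightarrow> seg_in P (xs ! r)"
    and seg_chain_junction: "Suc r < length xs \<Longrightarrow> seg_end P (xs ! r) = seg_start P (xs ! Suc r)"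
proof -
  show "seg_in P (xs ! r)" if "r < length xs"
    using assms that
  proof (induction xs arbitrary: s r)
    case (Cons p ps)
    then show ?case by (cases r) auto
  qed simp
  show "seg_end P (xs ! r) = seg_start P (xs ! Suc r)" if "Suc r < length xs"
    using assms that
  proof (induction xs arbitrary: s r)
    case (Cons p ps)
    then show ?case by (cases r; cases ps) auto
  qed simp
qed

text \<open>A path needs at least one segment, also when \<open>s = t\<close>. The opposite
  inequality of lengths holds for every nonempty chain by
  \<open>surface_dist_le_chain\<close>.\<close>

definition optimal :: "portalgon \<Rightarrow> (nat \<times> complex) set \<Rightarrow> seg list \<Rightarrow> (nat \<times> complex) set \<Rightarrow> bool" where
  "optimal P s xs t \<longleftrightarrow> xs \<noteq> [] \<and> seg_chain P s xs t \<and> ennreal (seg_len xs) \<le> surface_dist P s t"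

definition minimal :: "portalgon \<Rightarrow> (nat \<times> complex) set \<Rightarrow> seg list \<Rightarrow> (nat \<times> complex) set \<Rightarrow> bool" where
  "minimal P s xs t \<longleftrightarrow> optimal P s xs t \<and> (\<forall>ys. optimal P s ys t \<longrightarrow> length xs \<le> length ys)"

text \<open>The middle may be exchanged for arbitrary curves, not just segments; the two outer parts
  have finite length and cancel.\<close>

lemma optimal_middle:
  assumes opt: "optimal P s (us @ ms @ vs) t" and us: "seg_chain P s us w" and vs: "seg_chain P w' vs t"
    and qs: "chain P w qs w'" "qs \<noteq> []"
  shows "ennreal (seg_len ms) \<le> chain_len qs"
proof -
  let ?us = "map seg_piece us" and ?vs = "map seg_piece vs"
  have "chain P s (?us @ qs @ ?vs) t"
    using seg_chain_chain[OF us] seg_chain_chain[OF vs] qs(1) by (auto simp: chain_append)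
  then have "surface_dist P s t \<le> chain_len (?us @ qs @ ?vs)"
    using qs(2) by (intro surface_dist_le_chain) auto
  also have "\<dots> \<le> ennreal (seg_len us) + (chain_len qs + ennreal (seg_len vs))"
    unfolding chain_len_simps by (intro add_mono chain_len_seg_piece order_refl)
  finally have "surface_dist P s t \<le> (ennreal (seg_len us) + ennreal (seg_len vs)) + chain_len qs"
    by (simp add: add_ac)
  moreover have "(ennreal (seg_len us) + ennreal (seg_len vs)) + ennreal (seg_len ms) \<le> surface_dist P s t"
    using opt seg_len_nonneg unfolding optimal_def by (simp add: add_ac)
  ultimately have "(ennreal (seg_len us) + ennreal (seg_len vs)) + ennreal (seg_len ms) \<le>
      (ennreal (seg_len us) + ennreal (seg_len vs)) + chain_len qs"
    by (rule order_trans[rotated])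
  then show ?thesis unfolding ennreal_add_left_cancel_le by simp
qed

lemma closed_segment_linepath_subset:
  assumes "0 \<le> l" "l \<le> 1"
  shows "closed_segment a (linepath a b l) \<subseteq> closed_segment a b"
    "closed_segment (linepath a b l) b \<subseteq> closed_segment a b"
  using linepath_in_path[of l a b] assms by (simp_all add: subset_closed_segment)

lemma dist_linepath:
  assumes "0 \<le> l" "l \<le> 1"
  shows "dist a (linepath a b l) = l * dist a b" "dist (linepath a b l) b = (1 - l) * dist a b"
proof -
  have "a - linepath a b l = l *\<^sub>R (a - b)" "linepath a b l - b = (1 - l) *\<^sub>R (a - b)"
    by (simp_all add: linepath_def algebra_simps)
  then show "dist a (linepath a b l) = l * dist a b" "dist (linepath a b l) b = (1 - l) * dist a b"
    using assms by (simp_all add: dist_norm)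
qed

lemma minimal_remove_constant:
  assumes min: "minimal P s xs t" and N: "2 \<le> length xs" and x: "x \<in> set xs"
  shows "src x \<noteq> tgt x"
proof
  assume eq: "src x = tgt x"
  obtain us vs where xs: "xs = us @ x # vs" using x by (meson split_list)
  have "optimal P s (us @ vs) t"
    using min N eq unfolding minimal_def optimal_def xs
    by (auto simp: seg_chain_append seg_start_def seg_end_def)
  then show False using min unfolding minimal_def xs by auto
qed

text \<open>If the path came back to a point, cutting out the loop would shorten it, unless the loop
  has length 0. The only exception is the end of a segment together with the start of its
  successor.\<close>

lemma minimal_inj:
  assumes min: "minimal P s xs t" and N: "2 \<le> length xs" and r: "r \<le> q" "q < length xs"
    and l: "0 \<le> l" "l \<le> 1" and m: "0 \<le> m" "m \<le> 1"
    and eq: "piece_point P (seg_piece (xs ! r)) l = piece_point P (seg_piece (xs ! q)) m"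
  shows "(r = q \<and> l = m) \<or> (q = Suc r \<and> l = 1 \<and> m = 0)"
proof -
  let ?x = "xs ! r" and ?y = "xs ! q"
  have opt: "optimal P s xs t" using min by (simp add: minimal_def)
  have pos: "dist (src x) (tgt x) > 0" if "x \<in> set xs" for x
    using minimal_remove_constant[OF min N that] by simp
  have half: "piece P (frg x, linepath (src x) (linepath (src x) (tgt x) k))"
      "piece P (frg x, linepath (linepath (src x) (tgt x) k) (tgt x))"
    if "seg_in P x" "0 \<le> k" "k \<le> 1" for x k
    using that closed_segment_linepath_subset[OF that(2,3), of "src x" "tgt x"]
    by (auto simp: seg_in_def intro!: piece_linepath)
  \<comment> \<open>The shortcut: segment \<open>r\<close> up to parameter \<open>a\<close>, then
    segment \<open>q\<close> from parameter \<open>b\<close> on.\<close>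
  define pc where "pc = (\<lambda>a b. [(frg ?x, linepath (src ?x) (linepath (src ?x) (tgt ?x) a)),
      (frg ?y, linepath (linepath (src ?y) (tgt ?y) b) (tgt ?y))])"
  have len: "chain_len (pc a b) \<le> ennreal (a * dist (src ?x) (tgt ?x) + (1 - b) * dist (src ?y) (tgt ?y))"
    if "0 \<le> a" "a \<le> 1" "0 \<le> b" "b \<le> 1" for a b
  proof -
    have "chain_len (pc a b) \<le> ennreal (dist (src ?x) (linepath (src ?x) (tgt ?x) a)) +
        ennreal (dist (linepath (src ?y) (tgt ?y) b) (tgt ?y))"
      unfolding pc_def by (simp add: add_mono curve_length_linepath)
    then show ?thesis using that by (simp add: dist_linepath ennreal_plus[symmetric] del: ennreal_plus)
  qed
  have seg: "seg_in P ?x" "seg_in P ?y" using opt r seg_chain_in unfolding optimal_def by auto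
  have chain: "chain P (seg_start P ?x) (pc a b) (seg_end P ?y)"
    if "0 \<le> a" "a \<le> 1" "0 \<le> b" "b \<le> 1"
      "piece_point P (seg_piece ?x) a = piece_point P (seg_piece ?y) b" for a b
    using that half seg
    by (auto simp: pc_def piece_point_def seg_start_def seg_end_def seg_piece_def linepath_0' linepath_1')
  show ?thesis
  proof (cases "r = q")
    case True
    define a b where "a = min l m" and "b = max l m"
    have ab: "0 \<le> a" "a \<le> 1" "0 \<le> b" "b \<le> 1" "a \<le> b" using l m by (auto simp: a_def b_def)
    have "piece_point P (seg_piece ?x) a = piece_point P (seg_piece ?y) b"
      using eq True by (auto simp: a_def b_def min_def max_def)
    note ch = chain[OF ab(1-4) this]
    obtain us vs where xs: "xs = us @ [?x] @ vs" "length us = r"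
      using id_take_nth_drop[of r xs] r by (metis append_Cons append_Nil le_less_trans length_take min.absorb4)
    have "optimal P s (us @ [?x] @ vs) t" using opt xs(1) by simp
    moreover have "seg_chain P s us (seg_start P ?x)" "seg_chain P (seg_end P ?y) vs t"
      using opt xs(1) True unfolding optimal_def by (metis append_Cons append_Nil seg_chain.simps(2) seg_chain_append)+
    ultimately have "ennreal (seg_len [?x]) \<le> chain_len (pc a b)"
      using ch by (rule optimal_middle) (simp add: pc_def)
    then have "ennreal (dist (src ?x) (tgt ?x)) \<le> ennreal (a * dist (src ?x) (tgt ?x) + (1 - b) * dist (src ?x) (tgt ?x))"
      using len[OF ab(1-4)] True by (auto intro: order_trans)
    then have "dist (src ?x) (tgt ?x) \<le> a * dist (src ?x) (tgt ?x) + (1 - b) * dist (src ?x) (tgt ?x)"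
      using ab by (subst (asm) ennreal_le_iff) auto
    then have "(b - a) * dist (src ?x) (tgt ?x) \<le> 0" by (simp add: algebra_simps)
    then have "b \<le> a" using pos[of ?x] r by (auto simp: mult_le_0_iff)
    then show ?thesis using True by (auto simp: a_def b_def min_def max_def split: if_splits)
  next
    case False
    then have rq: "r < q" using r by simp
    define us ms vs where "us = take r xs" and "ms = drop (Suc r) (take q xs)" and "vs = drop (Suc q) xs"
    have xs: "xs = us @ (?x # ms @ [?y]) @ vs"
    proof -
      have "take q xs = us @ ?x # ms"
        using rq r id_take_nth_drop[of r "take q xs"] unfolding us_def ms_def by (simp add: min_def)
      then show ?thesis using id_take_nth_drop[of q xs] r unfolding vs_def by simp
    qed
    have mslen: "length ms = q - Suc r" using r by (simp add: ms_def)
    have ch: "seg_chain P s (us @ (?x # ms @ [?y]) @ vs) t" using opt xs unfolding optimal_def by metis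
    then have "seg_chain P s us (seg_start P ?x)" "seg_chain P (seg_end P ?y) vs t"
      by (auto simp: seg_chain_append)
    moreover have "optimal P s (us @ (?x # ms @ [?y]) @ vs) t" using opt xs by metis
    ultimately have "ennreal (seg_len (?x # ms @ [?y])) \<le> chain_len (pc l m)"
      using chain[OF l m eq] by (intro optimal_middle[of P s us _ vs t]) (auto simp: pc_def)
    then have "ennreal (seg_len (?x # ms @ [?y])) \<le> ennreal (l * dist (src ?x) (tgt ?x) + (1 - m) * dist (src ?y) (tgt ?y))"
      using len[OF l m] by (rule order_trans)
    then have "seg_len (?x # ms @ [?y]) \<le> l * dist (src ?x) (tgt ?x) + (1 - m) * dist (src ?y) (tgt ?y)"
      using l m by (subst (asm) ennreal_le_iff) auto
    \<comment> \<open>The left side is what the shortcut saves; its three terms are nonnegative, so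
      each of them vanishes.\<close>
    then have *: "(1 - l) * dist (src ?x) (tgt ?x) + seg_len ms + m * dist (src ?y) (tgt ?y) \<le> 0"
      by (simp add: algebra_simps)
    have nn: "0 \<le> (1 - l) * dist (src ?x) (tgt ?x)" "0 \<le> m * dist (src ?y) (tgt ?y)" "0 \<le> seg_len ms"
      using l m seg_len_nonneg by auto
    have "(1 - l) * dist (src ?x) (tgt ?x) = 0" "m * dist (src ?y) (tgt ?y) = 0" "seg_len ms = 0"
      using * nn by linarith+
    moreover have "?x \<in> set xs" "?y \<in> set xs" using r by auto
    ultimately have lm: "l = 1" "m = 0" using pos by (metis eq_iff_diff_eq_0 less_irrefl mult_eq_0_iff)+
    have "ms = []"
    proof (cases ms)
      case (Cons z zs)
      then have "z \<in> set xs" using xs by (metis Un_iff list.set_intros(1) list.set_intros(2) set_append append_Cons)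
      from pos[OF this] show ?thesis using Cons \<open>seg_len ms = 0\<close> seg_len_nonneg[of zs]
        by (metis add_pos_nonneg less_irrefl seg_len_simps(2))
    qed simp
    then have "q = Suc r" using mslen rq by simp
    then show ?thesis using lm by simp
  qed
qed

context valid_portalgon
begin

lemma locally_convex_fragment:
  assumes "i < num_fragments P" "z \<in> fragment P i" "z \<notin> set (fragments P ! i)"
  shows "\<exists>\<epsilon>>0. convex (fragment P i \<inter> ball z \<epsilon>)"
  using poly_region_locally_convex[OF simple[OF assms(1)]] assms by (simp add: fragment_def)

lemma polyline_seg_chain:
  assumes "polyline (fragment P i) (set (fragments P ! i)) x qs y" "i < num_fragments P"
  shows "seg_chain P (to_surface P (i, x)) (map (Pair i) qs) (to_surface P (i, y))"
  using assms
proof (induction qs arbitrary: x)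
  case (Cons q qs)
  then show ?case by (cases q) (auto simp: seg_in_def seg_start_def seg_end_def)
qed simp

text \<open>A competitor for a part of a piece, inserted between the two remaining parts of that
  piece, gives another chain from \<open>s\<close> to \<open>t\<close>.\<close>

lemma chain_geodesic:
  assumes "chain P s (us @ p # vs) t" "chain_len (us @ p # vs) \<le> surface_dist P s t"
    "surface_dist P s t < \<infinity>"
  shows "geodesic (fragment P (fst p)) (snd p) 0 1"
proof -
  let ?i = "fst p" and ?f = "snd p"
  obtain w where ch: "chain P s us w" "piece P p" "piece_point P p 0 = w" "chain P (piece_point P p 1) vs t"
    using assms(1) by (auto simp: chain_append)
  have p: "?i < num_fragments P" "continuous_on {0..1} ?f" "?f ` {0..1} \<subseteq> fragment P ?i"
    using ch(2) by (auto simp: piece_def)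
  have "curve_length ?f x z \<le> l"
    if xz: "0 \<le> x" "x \<le> z" "z \<le> 1" and j: "joined (fragment P ?i) (?f x) (?f z) l" for x z l
  proof -
    obtain g where g: "continuous_on {0..1} g" "g ` {0..1} \<subseteq> fragment P ?i" "g 0 = ?f x" "g 1 = ?f z"
        "curve_length g 0 1 \<le> l"
      using j by (auto simp: joined_def)
    define \<alpha> where "\<alpha> = (\<lambda>u. u * x)"
    define \<beta> where "\<beta> = (\<lambda>u. z + u * (1 - z))"
    have \<alpha>: "\<alpha> ` {0..1} \<subseteq> {0..x}" "mono_on {0..1} \<alpha>"
      using xz by (auto simp: \<alpha>_def monotone_on_def mult_right_mono mult_left_le_one_le)
    have \<beta>: "\<beta> ` {0..1} \<subseteq> {z..1}" "mono_on {0..1} \<beta>"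
    proof -
      have "u * (1 - z) \<le> 1 * (1 - z)" if "u \<le> 1" for u using xz that by (intro mult_right_mono) auto
      then show "\<beta> ` {0..1} \<subseteq> {z..1}" using xz by (fastforce simp: \<beta>_def)
      show "mono_on {0..1} \<beta>" using xz by (auto simp: \<beta>_def monotone_on_def intro: mult_right_mono)
    qed
    let ?qs = "[(?i, \<lambda>u. ?f (\<alpha> u)), (?i, g), (?i, \<lambda>u. ?f (\<beta> u))]"
    have sub: "\<alpha> ` {0..1} \<subseteq> {0..1}" "\<beta> ` {0..1} \<subseteq> {0..1}" 
    proof -
      have "{0..x} \<subseteq> {0..1}" "{z..1} \<subseteq> {0..1}" using xz by auto
      then show "\<alpha> ` {0..1} \<subseteq> {0..1}" "\<beta> ` {0..1} \<subseteq> {0..1}" using \<alpha>(1) \<beta>(1) by blast+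
    qed
    have "continuous_on {0..1} \<alpha>" "continuous_on {0..1} \<beta>"
      unfolding \<alpha>_def \<beta>_def by (intro continuous_intros)+
    from continuous_on_compose2[OF p(2) this(1) sub(1)] continuous_on_compose2[OF p(2) this(2) sub(2)]
    have "continuous_on {0..1} (\<lambda>u. ?f (\<alpha> u))" "continuous_on {0..1} (\<lambda>u. ?f (\<beta> u))" by auto
    then have "piece P (?i, \<lambda>u. ?f (\<alpha> u))" "piece P (?i, \<lambda>u. ?f (\<beta> u))" "piece P (?i, g)"
      using p g sub by (auto simp: piece_def image_subset_iff)
    then have "chain P w ?qs (piece_point P p 1)"
      using ch(3) g(3,4) by (simp add: piece_point_def \<alpha>_def \<beta>_def)
    then have new: "chain P s (us @ ?qs @ vs) t" using ch chain_append by blast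
    have le1: "chain_len (us @ p # vs) \<le> chain_len (us @ ?qs @ vs)"
      by (rule order_trans[OF assms(2) surface_dist_le_chain[OF new]]) simp
    have "chain_len us + (curve_length (\<lambda>u. ?f (\<alpha> u)) 0 1 + (curve_length g 0 1 + (curve_length (\<lambda>u. ?f (\<beta> u)) 0 1 + chain_len vs))) \<le>
        chain_len us + (curve_length ?f 0 x + (l + (curve_length ?f z 1 + chain_len vs)))"
      using curve_length_reparam[OF \<alpha>(2,1), of ?f] g(5) curve_length_reparam[OF \<beta>(2,1), of ?f]
      by (intro add_mono order_refl)
    then have le2: "chain_len (us @ ?qs @ vs) \<le>
        chain_len us + (curve_length ?f 0 x + (l + (curve_length ?f z 1 + chain_len vs)))"
      by (simp only: chain_len_simps append.simps fst_conv snd_conv add.assoc)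
    have "chain_len us + (curve_length ?f 0 1 + chain_len vs) \<le>
        chain_len us + (curve_length ?f 0 x + (l + (curve_length ?f z 1 + chain_len vs)))"
      using order_trans[OF le1 le2] by (simp only: chain_len_simps)
    moreover have "curve_length ?f 0 1 = curve_length ?f 0 x + curve_length ?f x z + curve_length ?f z 1"
      using xz curve_length_additive[of 0 x 1 ?f] curve_length_additive[of x z 1 ?f] by (simp add: add.assoc)
    ultimately have "(chain_len us + curve_length ?f 0 x + curve_length ?f z 1 + chain_len vs) + curve_length ?f x z \<le>
        (chain_len us + curve_length ?f 0 x + curve_length ?f z 1 + chain_len vs) + l"
      by (simp add: add_ac)
    \<comment> \<open>Finite length of the unchanged parts is what allows them to be
      cancelled.\<close>
    moreover have "chain_len us + curve_length ?f 0 x + curve_length ?f z 1 + chain_len vs < \<infinity>"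
    proof -
      have "chain_len (us @ p # vs) < \<infinity>" using assms(2,3) by (rule order_le_less_trans)
      moreover have "curve_length ?f 0 x \<le> curve_length ?f 0 1" "curve_length ?f z 1 \<le> curve_length ?f 0 1"
        using xz by (auto intro: curve_length_mono)
      ultimately show ?thesis by (auto simp: less_top[symmetric] top_unique)
    qed
    ultimately show ?thesis by (auto simp: ennreal_add_left_cancel_le)
  qed
  then show ?thesis using p unfolding geodesic_def by blast
qed

lemma chain_to_seg_chain:
  assumes "chain P s ps t" "\<And>p. p \<in> set ps \<Longrightarrow> geodesic (fragment P (fst p)) (snd p) 0 1"
  shows "\<exists>xs. seg_chain P s xs t \<and> ennreal (seg_len xs) \<le> chain_len ps"
  using assms
proof (induction ps arbitrary: s)
  case (Cons p ps)
  obtain xs where xs: "seg_chain P (piece_point P p 1) xs t" "ennreal (seg_len xs) \<le> chain_len ps"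
    using Cons.IH[of "piece_point P p 1"] Cons.prems by (metis chain.simps(2) list.set_intros(2))
  have p: "fst p < num_fragments P" "piece_point P p 0 = s" using Cons.prems by (auto simp: piece_def)
  obtain qs where qs: "polyline (fragment P (fst p)) (set (fragments P ! fst p)) (snd p 0) qs (snd p 1)"
      "ennreal (\<Sum>(a, b)\<leftarrow>qs. dist a b) \<le> curve_length (snd p) 0 1"
    using geodesic_polyline[of "fragment P (fst p)" "snd p" 0 1 "set (fragments P ! fst p)"]
      Cons.prems(2)[of p] closed_fragment locally_convex_fragment[OF p(1)] by auto
  have "seg_chain P s (map (Pair (fst p)) qs @ xs) t"
    using polyline_seg_chain[OF qs(1) p(1)] xs(1) p(2) by (auto simp: seg_chain_append piece_point_def)
  moreover have "seg_len (map (Pair (fst p)) qs) = (\<Sum>(a, b)\<leftarrow>qs. dist a b)"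
    by (simp add: seg_len_def o_def case_prod_beta')
  then have "ennreal (seg_len (map (Pair (fst p)) qs @ xs)) \<le> chain_len (p # ps)"
    using add_mono[OF qs(2) xs(2)] seg_len_nonneg[of xs] seg_len_nonneg[of "map (Pair (fst p)) qs"] by simp
  ultimately show ?case by blast
qed (auto intro!: exI[of _ "[]"])

lemma exists_minimal:
  assumes "shortest_path P s t \<gamma>"
  obtains xs where "minimal P s xs t"
proof -
  obtain ps where ps: "chain P s ps t" "ps \<noteq> []" "chain_len ps \<le> surface_dist P s t" "surface_dist P s t < \<infinity>"
    using shortest_path_chain[OF assms] .
  have "geodesic (fragment P (fst p)) (snd p) 0 1" if p: "p \<in> set ps" for p
  proof -
    obtain us vs where "ps = us @ p # vs" using p by (meson split_list)
    then show ?thesis using chain_geodesic[of s us p vs t] ps by simp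
  qed
  from chain_to_seg_chain[OF ps(1) this] obtain xs where xs: "seg_chain P s xs t" "ennreal (seg_len xs) \<le> chain_len ps"
    by blast
  have "\<exists>xs. optimal P s xs t"
  proof (cases xs)
    case Nil
    have p: "piece P (ps ! 0)" "piece_point P (ps ! 0) 0 = s" using chain_piece[OF ps(1), of 0] chain_start[OF ps(1)] ps(2) by auto
    let ?z = "snd (ps ! 0) 0" and ?i = "fst (ps ! 0)"
    have "?z \<in> fragment P ?i" using p(1) by (auto simp: piece_def)
    \<comment> \<open>No segment is left, so \<open>s = t\<close>; a one-point segment keeps the
      chain nonempty.\<close>
    then have "optimal P s [(?i, ?z, ?z)] t"
      using p xs(1) Nil by (auto simp: optimal_def seg_in_def seg_start_def seg_end_def piece_def piece_point_def)
    then show ?thesis by blast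
  next
    case (Cons x ys)
    then have "optimal P s xs t" using xs ps(3) by (auto simp: optimal_def intro: order_trans)
    then show ?thesis by blast
  qed
  then obtain xs where "optimal P s xs t" "\<And>ys. optimal P s ys t \<Longrightarrow> length xs \<le> length ys"
    using ex_has_least_nat[of "\<lambda>xs. optimal P s xs t" _ length] by blast
  then show ?thesis using that by (auto simp: minimal_def)
qed

text \<open>Away from vertices a fragment is locally convex, so the path is straight at the
  junction, and one segment of the same total length could replace the two.\<close>

lemma minimal_no_merge:
  assumes min: "minimal P s (us @ x # y # vs) t" and eq: "frg x = frg y" "tgt x = src y"
  shows "tgt x \<in> set (fragments P ! frg x)"
proof (rule ccontr)
  assume nv: "tgt x \<notin> set (fragments P ! frg x)"
  let ?F = "fragment P (frg x)" and ?V = "set (fragments P ! frg x)"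
  let ?p = "src x" and ?q = "tgt x" and ?r = "tgt y"
  have opt: "optimal P s (us @ [x, y] @ vs) t" using min by (simp add: minimal_def)
  have ch: "seg_chain P s us (seg_start P x)" "seg_in P x" "seg_in P y" "seg_chain P (seg_end P y) vs t"
    using opt by (auto simp: optimal_def seg_chain_append)
  have seg: "frg x < num_fragments P" "closed_segment ?p ?q \<subseteq> ?F" "closed_segment ?q ?r \<subseteq> ?F"
    "open_segment ?p ?q \<inter> ?V = {}" "open_segment ?q ?r \<inter> ?V = {}"
    using ch(2,3) eq by (auto simp: seg_in_def)
  have "?q \<in> ?F" using seg(2) by auto
  from locally_convex_fragment[OF seg(1) this nv]
  obtain \<epsilon> where \<epsilon>: "\<epsilon> > 0" "convex (?F \<inter> ball ?q \<epsilon>)" by blast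
  have q: "?q \<in> closed_segment ?p ?r"
  proof (rule straight_at_convex_point[OF seg(2,3) \<epsilon>])
    fix l assume "joined ?F ?p ?r l"
    then obtain g where g: "continuous_on {0..1} g" "g ` {0..1} \<subseteq> ?F" "g 0 = ?p" "g 1 = ?r"
        "curve_length g 0 1 \<le> l" by (auto simp: joined_def)
    have "chain P (seg_start P x) [(frg x, g)] (seg_end P y)"
      using g seg(1) eq by (auto simp: piece_def piece_point_def seg_start_def seg_end_def)
    from optimal_middle[OF opt ch(1,4) this] show "ennreal (dist ?p ?q + dist ?q ?r) \<le> l"
      using g(5) eq by (auto intro: order_trans)
  qed
  let ?z = "(frg x, ?p, ?r)"
  have un: "closed_segment ?p ?r = closed_segment ?p ?q \<union> closed_segment ?q ?r"
    using Un_closed_segment[OF q] by simp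
  then have "open_segment ?p ?r \<inter> ?V = {}"
    using seg(4,5) nv unfolding open_segment_def by blast
  then have "seg_in P ?z" using seg un by (auto simp: seg_in_def)
  then have chz: "seg_chain P s (us @ [?z] @ vs) t"
    using ch eq by (auto simp: seg_chain_append seg_start_def seg_end_def)
  have lenz: "seg_len (us @ [?z] @ vs) = seg_len (us @ [x, y] @ vs)"
    using q eq by (simp add: between_mem_segment[symmetric] between add.assoc)
  have "optimal P s (us @ [?z] @ vs) t"
    using opt chz unfolding optimal_def lenz by blast
  then show False using min by (auto simp: minimal_def)
qed

end

section \<open>Counting crossings\<close>

text \<open>Such a segment shows up a second time in the preimage of the path, along the partner of
  the edge.\<close>

definition runs_along :: "portalgon \<Rightarrow> seg \<Rightarrow> bool" where
  "runs_along P x \<longleftrightarrow> (\<exists>e\<in>\<Union>(portals P). frag_of e = frg x \<and>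
     closed_segment (src x) (tgt x) \<subseteq> closed_segment (edge_start P e) (edge_end P e))"

text \<open>Apart from the segment itself, if it lies in fragment \<open>i\<close>, this collects
  everything glued to it: vertices, isolated partner points, and whole pieces of edges.\<close>

definition trace :: "portalgon \<Rightarrow> nat \<Rightarrow> seg \<Rightarrow> complex set" where
  "trace P i x = {w \<in> fragment P i. \<exists>z\<in>closed_segment (src x) (tgt x).
     to_surface P (i, w) = to_surface P (frg x, z)}"

context valid_portalgon
begin

lemma portal_partner:
  assumes "e \<in> \<Union>(portals P)"
  shows "\<exists>e'. {e, e'} \<in> portals P"
proof -
  obtain p where p: "p \<in> portals P" "e \<in> p" using assms by blast
  have "\<forall>p\<in>portals P. \<exists>e e'. p = {e, e'} \<and> is_edge P e \<and> is_edge P e' \<and> \<not> same_side e e' \<and>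
      dist (edge_start P e) (edge_end P e) = dist (edge_start P e') (edge_end P e')"
    using portalgon by (simp add: is_portalgon_def)
  from bspec[OF this p(1)] obtain a b where ab: "p = {a, b}" by blast
  show ?thesis
  proof (cases "e = a")
    case False
    then have "{e, a} = p" using p ab by auto
    then show ?thesis using p by auto
  qed (use p ab in auto)
qed

text \<open>The trace is a finite union of closed sets: the segment, its image under the gluing of
  each portal, and single vertices. If \<open>Y\<close> swallows or misses each of them, what
  remains is again such a union.\<close>

lemma closed_trace_diff:
  assumes i: "i < num_fragments P" and x: "seg_in P x"
    and self: "frg x = i \<Longrightarrow> closed_segment (src x) (tgt x) \<inter> Y = {}"
    and other: "\<And>e e'. {e, e'} \<in> portals P \<Longrightarrow> frag_of e = frg x \<Longrightarrow> frag_of e' = i \<Longrightarrow>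
      edge_point P e' ` {l \<in> {0..1}. edge_point P e l \<in> closed_segment (src x) (tgt x)} \<inter> Y = {} \<or>
      edge_point P e' ` {l \<in> {0..1}. edge_point P e l \<in> closed_segment (src x) (tgt x)} \<subseteq> Y"
  shows "closed (trace P i x - Y)"
proof -
  let ?S = "closed_segment (src x) (tgt x)" and ?E = "\<Union>(portals P)"
  define I where "I = (\<lambda>(e, e'). edge_point P e' ` {l \<in> {0..1}. edge_point P e l \<in> ?S})"
  define D where "D = {(e, e') \<in> ?E \<times> ?E. {e, e'} \<in> portals P \<and> frag_of e = frg x \<and> frag_of e' = i}"
  define K where "K = (if frg x = i then {?S} else {}) \<union> I ` D \<union> (\<lambda>v. {v}) ` (trace P i x \<inter> set (fragments P ! i))"
  have "finite D" by (rule finite_subset[of _ "?E \<times> ?E"]) (auto simp: D_def finite_portal_edges)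
  then have fin: "finite K" by (auto simp: K_def)
  have comp: "compact (I (e, e'))" for e e'
  proof -
    have "closed ({0..1} \<inter> edge_point P e -` ?S)"
      by (intro continuous_closed_preimage continuous_edge_point) auto
    then have "compact ({0..1} \<inter> ({0..1} \<inter> edge_point P e -` ?S))" by (rule compact_Int_closed[OF compact_Icc])
    then have "compact (edge_point P e' ` ({0..1} \<inter> ({0..1} \<inter> edge_point P e -` ?S)))"
      by (intro compact_continuous_image continuous_edge_point)
    moreover have "I (e, e') = edge_point P e' ` ({0..1} \<inter> ({0..1} \<inter> edge_point P e -` ?S))"
      by (auto simp: I_def)
    ultimately show ?thesis by simp
  qed
  have clo: "closed k" if "k \<in> K" for k
    using that comp by (auto simp: K_def D_def compact_imp_closed split: if_splits)
  have eq: "trace P i x = \<Union>K"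
  proof
    show "trace P i x \<subseteq> \<Union>K"
    proof
      fix w assume w: "w \<in> trace P i x"
      then obtain z where z: "z \<in> ?S" "to_surface P (i, w) = to_surface P (frg x, z)" by (auto simp: trace_def)
      from to_surface_eq_cases[OF z(2)] show "w \<in> \<Union>K"
      proof (elim disjE conjE)
        assume "crossing P (i, w) (frg x, z)"
        from crossing_sym[OF this]
        obtain e e' l where "{e, e'} \<in> portals P" "0 < l" "l < 1" "i = frag_of e'" "w = edge_point P e' l"
            "frg x = frag_of e" "z = edge_point P e l"
          unfolding crossing_def by blast
        then have "(e, e') \<in> D" "w \<in> I (e, e')" using z by (auto simp: D_def I_def)
        then show ?thesis by (auto simp: K_def)
      next
        assume "vertex_point P (i, w)"
        then show ?thesis using w by (auto simp: K_def vertex_point_def)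
      qed (use z in \<open>auto simp: K_def\<close>)
    qed
    show "\<Union>K \<subseteq> trace P i x"
    proof
      fix w assume "w \<in> \<Union>K"
      then consider "frg x = i" "w \<in> ?S" | "w \<in> trace P i x"
        | e e' l where "(e, e') \<in> D" "0 \<le> l" "l \<le> 1" "w = edge_point P e' l" "edge_point P e l \<in> ?S"
        by (auto simp: K_def I_def split: if_splits)
      then show "w \<in> trace P i x"
      proof cases
        case 1
        then show ?thesis using x by (auto simp: trace_def seg_in_def)
      next
        case 3
        then have p: "{e, e'} \<in> portals P" "frag_of e = frg x" "frag_of e' = i" by (auto simp: D_def)
        have "to_surface P (i, w) = to_surface P (frg x, edge_point P e l)"
          using to_surface_edge_point[OF p(1) 3(2,3)] p 3(4) by simp
        moreover have "w \<in> fragment P i" using edge_point_fragment[of e' l] portal_edges(2)[OF p(1)] p 3 by simp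
        ultimately show ?thesis using 3(5) by (auto simp: trace_def)
      qed
    qed
  qed
  have dich: "k \<inter> Y = {} \<or> k \<subseteq> Y" if k: "k \<in> K" for k
  proof -
    consider "frg x = i" "k = ?S" | e e' where "(e, e') \<in> D" "k = I (e, e')" | v where "k = {v}"
      using k by (auto simp: K_def split: if_splits)
    then show ?thesis
    proof cases
      case 1
      then show ?thesis using self by simp
    next
      case 2
      then have "{e, e'} \<in> portals P" "frag_of e = frg x" "frag_of e' = i" by (auto simp: D_def)
      from other[OF this] show ?thesis unfolding 2 I_def by simp
    qed auto
  qed
  have "trace P i x - Y = \<Union>{k \<in> K. k \<inter> Y = {}}"
    unfolding eq using dich by blast
  moreover have "closed (\<Union>{k \<in> K. k \<inter> Y = {}})" using fin clo by (intro closed_Union) auto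
  ultimately show ?thesis by simp
qed

text \<open>A second common point would make the segment collinear with the edge. Not being
  contained in the edge, it would then leave it through an end of the edge, which is a vertex inside
  the segment.\<close>

lemma segment_meets_edge_once:
  assumes e: "is_edge P e" and x: "open_segment a b \<inter> set (fragments P ! frag_of e) = {}"
    and b: "b = edge_point P e l" "0 < l" "l < 1"
    and not: "\<not> closed_segment a b \<subseteq> closed_segment (edge_start P e) (edge_end P e)"
    and z: "0 \<le> k" "k \<le> 1" "edge_point P e k \<in> closed_segment a b"
  shows "k = l"
proof (rule ccontr)
  assume "k \<noteq> l"
  have diff: "edge_point P e u - edge_point P e v = (u - v) *\<^sub>R (edge_end P e - edge_start P e)" for u v
    by (simp add: edge_point_def linepath_def algebra_simps)
  obtain v where v: "0 \<le> v" "v \<le> 1" "edge_point P e k = b + v *\<^sub>R (a - b)"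
    using z(3) unfolding closed_segment_commute[of a b] by (auto simp: in_segment algebra_simps)
  have kb: "edge_point P e k - b = (k - l) *\<^sub>R (edge_end P e - edge_start P e)" using diff b by simp
  have "v \<noteq> 0" using v(3) kb \<open>k \<noteq> l\<close> edge_start_neq[OF e] by auto
  \<comment> \<open>The parameter of \<open>a\<close> on the line through the edge.\<close>
  define c where "c = l + (k - l) / v"
  have "v *\<^sub>R (a - b) = (k - l) *\<^sub>R (edge_end P e - edge_start P e)" using v(3) kb by simp
  then have "a - b = ((k - l) / v) *\<^sub>R (edge_end P e - edge_start P e)"
    using \<open>v \<noteq> 0\<close> by (metis divide_inverse_commute inverse_eq_divide mult.commute real_vector.scale_scale
        scaleR_one right_inverse divide_inverse left_inverse)
  moreover have "edge_point P e c - b = ((k - l) / v) *\<^sub>R (edge_end P e - edge_start P e)"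
    using diff[of c l] b by (simp add: c_def)
  ultimately have a: "a = edge_point P e c" by (metis diff_add_cancel)
  have conv: "edge_point P e ((1 - u) * c + u * l) = (1 - u) *\<^sub>R a + u *\<^sub>R b" for u
    by (simp add: a b edge_point_def linepath_def algebra_simps)
  have ends: "edge_point P e 0 = edge_start P e" "edge_point P e 1 = edge_end P e"
    by (simp_all add: edge_point_def linepath_def)
  \<comment> \<open>An end of the edge strictly between the parameters of \<open>a\<close> and
    \<open>b\<close> would be a vertex in the open segment.\<close>
  have vertex: False if "d = 0 \<or> d = 1" "(l < d \<and> d < c) \<or> (c < d \<and> d < l)" for d :: real
  proof -
    define u where "u = (c - d) / (c - l)"
    have "0 < u" "u < 1" using that(2) by (auto simp: u_def field_simps)
    moreover have "(1 - u) * c + u * l = d"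
    proof -
      have "u * (c - l) = c - d" using that(2) by (auto simp: u_def)
      then show ?thesis by (simp add: algebra_simps)
    qed
    ultimately have "edge_point P e d = (1 - u) *\<^sub>R a + u *\<^sub>R b" using conv[of u] by simp
    moreover have "a \<noteq> b" using that(2) edge_point_inj[OF e] a b by force
    ultimately have "edge_point P e d \<in> open_segment a b"
      unfolding in_segment using \<open>0 < u\<close> \<open>u < 1\<close> by blast
    moreover have "edge_point P e d \<in> set (fragments P ! frag_of e)"
      using that(1) ends edge_ends_vertices[OF e] by auto
    ultimately show False using x by auto
  qed
  show False
  proof (cases "0 \<le> c \<and> c \<le> 1")
    case True
    then have "a \<in> closed_segment (edge_start P e) (edge_end P e)" "b \<in> closed_segment (edge_start P e) (edge_end P e)"
      using a b edge_point_closed by auto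
    then show False using not by (simp add: subset_closed_segment)
  next
    case False
    then show False using vertex[of 0] vertex[of 1] b by auto
  qed
qed

text \<open>The segment touches the edge at \<open>b\<close> only, so its copy across this portal is
  the single point \<open>y\<close>. Since the segment itself does not pass through
  \<open>y\<close>, this point is isolated in the trace.\<close>

lemma closed_trace_diff_crossing:
  assumes x: "seg_in P x" and nr: "\<not> runs_along P x"
    and b: "b = src x \<or> b = tgt x" and cr: "crossing P (frg x, b) (i, y)"
    and y: "frg x = i \<Longrightarrow> y \<notin> closed_segment (src x) (tgt x)"
  shows "closed (trace P i x - {y})"
proof -
  obtain e e' l where e: "{e, e'} \<in> portals P" "0 < l" "l < 1" "frg x = frag_of e" "b = edge_point P e l"
      "i = frag_of e'" "y = edge_point P e' l"
    using cr by (auto simp: crossing_def)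
  have ed: "is_edge P e" "is_edge P e'" using portal_edges e(1) by blast+
  have e': "{e', e} \<in> portals P" using e(1) by (subst insert_commute)
  show ?thesis
  proof (rule closed_trace_diff[OF _ x])
    show "i < num_fragments P" using ed e edge_fragment by simp
    show "closed_segment (src x) (tgt x) \<inter> {y} = {}" if "frg x = i" using y[OF that] by simp
    fix d d' assume d: "{d, d'} \<in> portals P" "frag_of d = frg x" "frag_of d' = i"
    let ?I = "edge_point P d' ` {l \<in> {0..1}. edge_point P d l \<in> closed_segment (src x) (tgt x)}"
    show "?I \<inter> {y} = {} \<or> ?I \<subseteq> {y}"
    proof (rule disjCI)
      assume "\<not> ?I \<subseteq> {y}"
      show "?I \<inter> {y} = {}"
      proof (rule ccontr)
        assume "?I \<inter> {y} \<noteq> {}"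
        \<comment> \<open>\<open>y\<close> is an inner point of \<open>e'\<close>, so any portal
          whose image contains it is the portal of this crossing.\<close>
        then have yd: "y \<in> closed_segment (edge_start P d') (edge_end P d')"
          using edge_point_closed by auto
        have "{d', d} \<in> portals P" using d(1) by (subst insert_commute)
        moreover have "frag_of e' = frag_of d'" "edge_point P e' l \<in> closed_segment (edge_start P d') (edge_end P d')"
          using yd e(6,7) d(3) by simp_all
        ultimately have "e' = d'" "e = d"
          using edge_point_same[OF e' _ _ e(2,3)] by blast+
        moreover have "k = l" if "k \<in> {0..1}" "edge_point P e k \<in> closed_segment (src x) (tgt x)" for k
        proof -
          obtain a where a: "closed_segment a b = closed_segment (src x) (tgt x)"
              "open_segment a b = open_segment (src x) (tgt x)"
            using b
          proof
            assume "b = src x"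
            then show ?thesis using that[of "tgt x"] by (simp add: closed_segment_commute open_segment_commute)
          next
            assume "b = tgt x"
            then show ?thesis using that[of "src x"] by simp
          qed
          show "k = l"
          proof (rule segment_meets_edge_once[OF ed(1), of a b])
            show "open_segment a b \<inter> set (fragments P ! frag_of e) = {}"
              using x e(4) unfolding a(2) seg_in_def by simp
            show "\<not> closed_segment a b \<subseteq> closed_segment (edge_start P e) (edge_end P e)"
              using nr e(1,4) unfolding a(1) runs_along_def by (metis UnionI insertI1)
            show "edge_point P e k \<in> closed_segment a b" unfolding a(1) by (rule that(2))
          qed (use e that in auto)
        qed
        ultimately have "?I \<subseteq> {y}" using e by auto
        then show False using \<open>\<not> ?I \<subseteq> {y}\<close> by simp
      qed
    qed
  qed
qed

lemma closed_trace: "i < num_fragments P \<Longrightarrow> seg_in P x \<Longrightarrow> closed (trace P i x)"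
  using closed_trace_diff[of i x "{}"] by simp

end

section \<open>Junctions of a chain with the fewest segments\<close>

locale minimal_chain = valid_portalgon +
  fixes s t :: "(nat \<times> complex) set" and xs :: "seg list"
  assumes min: "minimal P s xs t" and two: "2 \<le> length xs"
begin

lemma optimal: "optimal P s xs t"
  using min by (simp add: minimal_def)

lemma chain: "seg_chain P s xs t"
  using optimal by (simp add: optimal_def)

lemma seg_in: "r < length xs \<Longrightarrow> seg_in P (xs ! r)"
  using seg_chain_in[OF chain] .

lemma junction: "Suc r < length xs \<Longrightarrow> seg_end P (xs ! r) = seg_start P (xs ! Suc r)"
  using seg_chain_junction[OF chain] .

definition vertex_junctions :: "nat set" where
  "vertex_junctions = {r. Suc r < length xs \<and> seg_end P (xs ! r) \<in> surface_vertices P}"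

definition crossings :: "nat set" where
  "crossings = {r. Suc r < length xs \<and> seg_end P (xs ! r) \<notin> surface_vertices P}"

lemma inj:
  assumes "r \<le> q" "q < length xs" "0 \<le> l" "l \<le> 1" "0 \<le> m" "m \<le> 1"
    and "to_surface P (frg (xs ! r), linepath (src (xs ! r)) (tgt (xs ! r)) l) =
      to_surface P (frg (xs ! q), linepath (src (xs ! q)) (tgt (xs ! q)) m)"
  shows "(r = q \<and> l = m) \<or> (q = Suc r \<and> l = 1 \<and> m = 0)"
  using minimal_inj[OF min two assms(1-6)] assms(7) by (simp add: piece_point_def seg_piece_def)

lemma inj_points:
  assumes "r < q" "q < length xs"
    and "z \<in> closed_segment (src (xs ! r)) (tgt (xs ! r))" "z' \<in> closed_segment (src (xs ! q)) (tgt (xs ! q))"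
    and "to_surface P (frg (xs ! r), z) = to_surface P (frg (xs ! q), z')"
  shows "q = Suc r \<and> z = tgt (xs ! r) \<and> z' = src (xs ! q)"
proof -
  obtain l where l: "0 \<le> l" "l \<le> 1" "z = linepath (src (xs ! r)) (tgt (xs ! r)) l"
    using assms(3) by (auto simp: linepath_image_01[symmetric])
  obtain m where m: "0 \<le> m" "m \<le> 1" "z' = linepath (src (xs ! q)) (tgt (xs ! q)) m"
    using assms(4) by (auto simp: linepath_image_01[symmetric])
  show ?thesis using inj[of r q l m] assms l m by (auto simp: linepath_0' linepath_1')
qed

lemma inj_seg:
  assumes "r < length xs" "z \<in> closed_segment (src (xs ! r)) (tgt (xs ! r))"
    "z' \<in> closed_segment (src (xs ! r)) (tgt (xs ! r))"
    "to_surface P (frg (xs ! r), z) = to_surface P (frg (xs ! r), z')"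
  shows "z = z'"
proof -
  obtain l where l: "0 \<le> l" "l \<le> 1" "z = linepath (src (xs ! r)) (tgt (xs ! r)) l"
    using assms(2) by (auto simp: linepath_image_01[symmetric])
  obtain m where m: "0 \<le> m" "m \<le> 1" "z' = linepath (src (xs ! r)) (tgt (xs ! r)) m"
    using assms(3) by (auto simp: linepath_image_01[symmetric])
  show ?thesis using inj[of r r l m] assms l m by auto
qed

lemma seg_end_nonvertex:
  "r < length xs \<Longrightarrow> seg_end P (xs ! r) \<in> surface_vertices P \<longleftrightarrow> tgt (xs ! r) \<in> set (fragments P ! frg (xs ! r))"
  using seg_in[of r] surface_vertex_iff by (simp add: seg_end_def seg_in_def)

text \<open>Otherwise two segments of one fragment would meet at a point that is no vertex, and
  could be merged.\<close>

lemma crossings_neq: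
  assumes "r \<in> crossings"
  shows "(frg (xs ! r), tgt (xs ! r)) \<noteq> (frg (xs ! Suc r), src (xs ! Suc r))"
proof
  assume eq: "(frg (xs ! r), tgt (xs ! r)) = (frg (xs ! Suc r), src (xs ! Suc r))"
  have r: "Suc r < length xs" using assms by (simp add: crossings_def)
  have "xs = take r xs @ xs ! r # xs ! Suc r # drop (Suc (Suc r)) xs"
    using r by (metis Cons_nth_drop_Suc Suc_lessD append_take_drop_id)
  then have "minimal P s (take r xs @ xs ! r # xs ! Suc r # drop (Suc (Suc r)) xs) t" using min by simp
  from minimal_no_merge[OF this] eq show False
    using assms seg_end_nonvertex[of r] r by (auto simp: crossings_def)
qed

text \<open>Two different representatives of a surface point that is no vertex can only be partners
  across a portal.\<close>

lemma crossings_crossing: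
  assumes "r \<in> crossings"
  shows "crossing P (frg (xs ! r), tgt (xs ! r)) (frg (xs ! Suc r), src (xs ! Suc r))"
    "\<not> vertex_point P (frg (xs ! r), tgt (xs ! r))" "\<not> vertex_point P (frg (xs ! Suc r), src (xs ! Suc r))"
proof -
  have r: "Suc r < length xs" using assms by (simp add: crossings_def)
  have "\<not> vertex_point P (frg (xs ! r), tgt (xs ! r))"
    using assms seg_end_nonvertex[of r] r by (auto simp: crossings_def vertex_point_def)
  then show "crossing P (frg (xs ! r), tgt (xs ! r)) (frg (xs ! Suc r), src (xs ! Suc r))"
    "\<not> vertex_point P (frg (xs ! r), tgt (xs ! r))" "\<not> vertex_point P (frg (xs ! Suc r), src (xs ! Suc r))"
    using to_surface_eq_cases[of "(frg (xs ! r), tgt (xs ! r))" "(frg (xs ! Suc r), src (xs ! Suc r))"]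
      crossings_neq[OF assms] junction[OF r] by (auto simp: seg_end_def seg_start_def)
qed

text \<open>Since the path passes each point once, different junctions are different surface
  vertices.\<close>

lemma card_vertex_junctions: "finite vertex_junctions" "card vertex_junctions \<le> num_vertices P"
proof -
  show "finite vertex_junctions" by (rule finite_subset[of _ "{..<length xs}"]) (auto simp: vertex_junctions_def)
  have "inj_on (\<lambda>r. seg_end P (xs ! r)) vertex_junctions"
  proof (rule linorder_inj_onI)
    fix r q assume rq: "r < q" "r \<in> vertex_junctions" "q \<in> vertex_junctions"
    show "seg_end P (xs ! r) \<noteq> seg_end P (xs ! q)"
    proof
      assume "seg_end P (xs ! r) = seg_end P (xs ! q)"
      then have "tgt (xs ! q) = src (xs ! q)"
        using inj_points[of r q "tgt (xs ! r)" "tgt (xs ! q)"] rq by (auto simp: vertex_junctions_def seg_end_def)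
      then show False
        using minimal_remove_constant[OF min two, of "xs ! q"] rq by (auto simp: vertex_junctions_def)
    qed
  qed auto
  then have "card vertex_junctions \<le> card (surface_vertices P)"
    by (rule card_inj_on_le) (auto simp: vertex_junctions_def card_surface_vertices)
  then show "card vertex_junctions \<le> num_vertices P" using card_surface_vertices(2) by linarith
qed

text \<open>Otherwise the segment could be moved to the partner of the edge, and the two crossings disappear.\<close>

lemma runs_along_not_between_crossings:
  assumes r: "r \<in> crossings" "Suc r \<in> crossings"
  shows "\<not> runs_along P (xs ! Suc r)"
proof
  assume "runs_along P (xs ! Suc r)"
  then obtain e where e: "e \<in> \<Union>(portals P)" "frag_of e = frg (xs ! Suc r)"
      "closed_segment (src (xs ! Suc r)) (tgt (xs ! Suc r)) \<subseteq> closed_segment (edge_start P e) (edge_end P e)"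
    by (auto simp: runs_along_def)
  let ?x = "xs ! r" and ?y = "xs ! Suc r" and ?z = "xs ! Suc (Suc r)"
  have len: "Suc (Suc r) < length xs" using r by (simp add: crossings_def)
  obtain e' where e': "{e, e'} \<in> portals P" using portal_partner[OF e(1)] by blast
  \<comment> \<open>An inner point of one side lies on no other side, so a crossing at a point of
    \<open>e\<close> goes through \<open>e\<close>. This applies to both ends of the
    segment.\<close>
  have partner: "\<exists>l. 0 < l \<and> l < 1 \<and> v = edge_point P e l \<and> w = edge_point P e' l \<and> j = frag_of e'"
    if c: "crossing P (frg ?y, v) (j, w)" and v: "v \<in> closed_segment (src ?y) (tgt ?y)" for v w j
  proof -
    obtain d d' l where d: "{d, d'} \<in> portals P" "0 < l" "l < 1" "frg ?y = frag_of d" "v = edge_point P d l"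
        "j = frag_of d'" "w = edge_point P d' l"
      using c by (auto simp: crossing_def)
    have "d = e" "d' = e'" using edge_point_same[OF d(1) e' _ d(2,3)] d e v by auto
    then show ?thesis using d by blast
  qed
  obtain l where l: "0 < l" "l < 1" "src ?y = edge_point P e l" "tgt ?x = edge_point P e' l" "frg ?x = frag_of e'"
    using partner[of "src ?y" "frg ?x" "tgt ?x"] crossing_sym[OF crossings_crossing(1)[OF r(1)]] by auto
  obtain m where m: "0 < m" "m < 1" "tgt ?y = edge_point P e m" "src ?z = edge_point P e' m" "frg ?z = frag_of e'"
    using partner[of "tgt ?y" "frg ?z" "src ?z"] crossings_crossing(1)[OF r(2)] by auto
  have ed: "is_edge P e" "is_edge P e'" using portal_edges e' by blast+
  \<comment> \<open>The copy of the segment on the partner edge; it lies in the fragment of both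
    neighbouring segments.\<close>
  let ?w = "(frag_of e', edge_point P e' l, edge_point P e' m)"
  have sub: "closed_segment (edge_point P e' l) (edge_point P e' m) \<subseteq> edge_point P e' ` {0<..<1}"
  proof
    fix z assume "z \<in> closed_segment (edge_point P e' l) (edge_point P e' m)"
    then obtain u where u: "0 \<le> u" "u \<le> 1" "z = (1 - u) *\<^sub>R edge_point P e' l + u *\<^sub>R edge_point P e' m"
      by (auto simp: in_segment)
    then have "z = edge_point P e' ((1 - u) * l + u * m)"
      by (simp add: edge_point_def linepath_def algebra_simps)
    moreover have "(1 - u) * l + u * m \<in> {0<..<1}"
      using convexD_alt[of "{0<..<1}" l m u] u l m by simp
    ultimately show "z \<in> edge_point P e' ` {0<..<1}" by blast
  qed
  have w: "seg_in P ?w"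
    unfolding seg_in_def
  proof (intro conjI)
    show "frg ?w < num_fragments P" using ed edge_fragment by simp
    have "edge_point P e' ` {0<..<1} \<subseteq> fragment P (frag_of e')"
      using edge_point_fragment[OF ed(2)] by auto
    then show "closed_segment (src ?w) (tgt ?w) \<subseteq> fragment P (frg ?w)" using sub by simp
    have "edge_point P e' ` {0<..<1} \<inter> set (fragments P ! frag_of e') = {}"
      using edge_point_not_vertex[OF ed(2)] by auto
    then show "open_segment (src ?w) (tgt ?w) \<inter> set (fragments P ! frg ?w) = {}"
      using sub open_closed_segment by fastforce
  qed
  have eq: "seg_start P ?w = seg_start P ?y" "seg_end P ?w = seg_end P ?y"
    using to_surface_edge_point[OF e', of l] to_surface_edge_point[OF e', of m] l m e(2)
    by (simp_all add: seg_start_def seg_end_def)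
  let ?us = "take r xs" and ?vs = "drop (Suc (Suc (Suc r))) xs"
  have xs: "xs = ?us @ ?x # ?y # ?z # ?vs"
    using len by (metis Cons_nth_drop_Suc Suc_lessD append_take_drop_id)
  have "dist (edge_point P e' l) (edge_point P e' m) = dist (src ?y) (tgt ?y)"
    unfolding l(3) m(3) dist_edge_point using portal_edges(4)[OF e'] by simp
  then have len_eq: "seg_len (?us @ ?x # ?w # ?z # ?vs) = seg_len (?us @ ?x # ?y # ?z # ?vs)" by simp
  have "seg_chain P s (?us @ ?x # ?y # ?z # ?vs) t" using chain xs by metis
  then have ch: "seg_chain P s (?us @ ?x # ?w # ?z # ?vs) t"
    using w eq by (auto simp: seg_chain_append)
  have "optimal P s (?us @ ?x # ?w # ?z # ?vs) t"
    unfolding optimal_def len_eq using optimal ch xs by (simp add: optimal_def)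
  moreover have "length (?us @ ?x # ?w # ?z # ?vs) = length xs" using len by simp
  \<comment> \<open>The moved chain has the same length and number of segments, but now two
    consecutive segments of one fragment meet at a point that is no vertex.\<close>
  ultimately have "minimal P s (?us @ ?x # ?w # ?z # ?vs) t" using min by (auto simp: minimal_def)
  from minimal_no_merge[OF this] have "tgt ?x \<in> set (fragments P ! frg ?x)" using l by simp
  then show False using l edge_point_not_vertex[OF ed(2)] by simp
qed

text \<open>For these \<open>closed_trace_diff_crossing\<close> applies to the segments on both
  sides of the crossing.\<close>

definition good_crossings :: "nat set" where
  "good_crossings = {r \<in> crossings. \<not> runs_along P (xs ! r) \<and> \<not> runs_along P (xs ! Suc r)}"

lemma fragment_part_traces:
  "fragment_part P i (chain_path P (map seg_piece xs)) = (\<Union>q<length xs. trace P i (xs ! q))"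
proof -
  have "map seg_piece xs \<noteq> []" using two by auto
  note img = chain_path_image[OF seg_chain_chain[OF chain] this]
  have "piece_point P (seg_piece x) ` {0..1} = (\<lambda>z. to_surface P (frg x, z)) ` closed_segment (src x) (tgt x)" for x
    unfolding linepath_image_01[symmetric] image_image by (simp add: piece_point_def seg_piece_def)
  then have "chain_path P (map seg_piece xs) ` {0..1} =
      (\<Union>x\<in>set xs. (\<lambda>z. to_surface P (frg x, z)) ` closed_segment (src x) (tgt x))"
    unfolding img by simp
  also have "set xs = (!) xs ` {..<length xs}" by (auto simp: set_conv_nth)
  finally have "chain_path P (map seg_piece xs) ` {0..1} =
      (\<Union>q<length xs. (\<lambda>z. to_surface P (frg (xs ! q), z)) ` closed_segment (src (xs ! q)) (tgt (xs ! q)))"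
    by simp
  then show ?thesis by (auto simp: fragment_part_def trace_def)
qed

text \<open>At a good crossing into a fragment, the part of the fragment visited up to the crossing and the part
  visited from then on are separated: each of the two points of the crossing is isolated on its side.\<close>

lemma card_good_crossings_into:
  assumes comps: "num_components (fragment_part P i (chain_path P (map seg_piece xs))) \<le> enat h"
  shows "card {r \<in> good_crossings. frg (xs ! Suc r) = i} \<le> h"
proof -
  let ?S = "fragment_part P i (chain_path P (map seg_piece xs))"
  let ?R = "{r \<in> good_crossings. frg (xs ! Suc r) = i}"
  define y where "y = (\<lambda>r. src (xs ! Suc r))"
  have R: "Suc r < length xs" "r \<in> crossings" "frg (xs ! Suc r) = i" "\<not> runs_along P (xs ! r)"
      "\<not> runs_along P (xs ! Suc r)" if "r \<in> ?R" for r
    using that by (auto simp: good_crossings_def crossings_def)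
  have in_trace: "z \<in> trace P (frg (xs ! q)) (xs ! q)"
    if "q < length xs" "z \<in> closed_segment (src (xs ! q)) (tgt (xs ! q))" for q z
    using seg_in[OF that(1)] that(2) by (auto simp: trace_def seg_in_def)
  have y_in: "y r \<in> trace P i (xs ! Suc r)" if "r \<in> ?R" for r
    using in_trace[of "Suc r" "y r"] R[OF that] by (simp add: y_def)
  have sep: "\<not> (connected X \<and> X \<subseteq> ?S \<and> y r \<in> X \<and> y q \<in> X)" if rq: "r \<in> ?R" "q \<in> ?R" "q < r" for r q X
  proof
    assume X: "connected X \<and> X \<subseteq> ?S \<and> y r \<in> X \<and> y q \<in> X"
    note r = R[OF rq(1)] and q = R[OF rq(2)]
    define b where "b = tgt (xs ! r)"
    \<comment> \<open>If the crossing returns to the same fragment, its exit point \<open>b\<close>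
      also lies in fragment \<open>i\<close> and has to be assigned to the earlier part.\<close>
    define Z where "Z = (if frg (xs ! r) = i then {b} else {})"
    have cr: "crossing P (frg (xs ! r), b) (i, y r)" "\<not> vertex_point P (frg (xs ! r), b)"
      using crossings_crossing[OF r(2)] r(3) by (simp_all add: y_def b_def)
    have i: "i < num_fragments P" using seg_in[OF r(1)] r(3) by (simp add: seg_in_def)
    \<comment> \<open>\<open>L\<close> and \<open>U\<close> come from the segments before and after
      the crossing; each omits the crossing point that is assigned to the other.\<close>
    define L where "L = (\<Union>k\<in>{..r}. trace P i (xs ! k) - {y r})"
    define U where "U = (\<Union>k\<in>{Suc r..<length xs}. trace P i (xs ! k) - Z)"
    have surf_b: "to_surface P (frg (xs ! r), b) = to_surface P (i, y r)"
      using junction[OF r(1)] r(3) by (simp add: seg_end_def seg_start_def b_def y_def)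
    have yb: "(frg (xs ! r), b) \<noteq> (i, y r)"
      using crossings_neq[OF r(2)] r(3) by (simp add: b_def y_def)
    have y_seg: "y r \<in> closed_segment (src (xs ! Suc r)) (tgt (xs ! Suc r))" by (simp add: y_def)
    have b_seg: "b \<in> closed_segment (src (xs ! r)) (tgt (xs ! r))" by (simp add: b_def)
    have clL: "closed (trace P i (xs ! k) - {y r})" if k: "k \<le> r" for k
    proof (cases "k = r")
      case True
      have "closed (trace P i (xs ! r) - {y r})"
      proof (rule closed_trace_diff_crossing[of _ b])
        show "seg_in P (xs ! r)" using seg_in r(1) by simp
        show "y r \<notin> closed_segment (src (xs ! r)) (tgt (xs ! r))" if "frg (xs ! r) = i"
          using inj_seg[of r "y r" b] b_seg surf_b yb that r(1) by auto
        show "crossing P (frg (xs ! r), b) (i, y r)" by (rule cr(1))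
      qed (use r(4) in \<open>auto simp: b_def\<close>)
      then show ?thesis using True by simp
    next
      case False
      have "y r \<notin> trace P i (xs ! k)"
      proof
        assume "y r \<in> trace P i (xs ! k)"
        then obtain z where "z \<in> closed_segment (src (xs ! k)) (tgt (xs ! k))"
          "to_surface P (frg (xs ! k), z) = to_surface P (frg (xs ! Suc r), y r)"
          unfolding trace_def r(3) by auto
        from inj_points[OF _ r(1) this(1) y_seg this(2)] show False using k False by simp
      qed
      then show ?thesis using closed_trace[OF i seg_in[of k]] k r(1) by simp
    qed
    have clU: "closed (trace P i (xs ! k) - Z)" if k: "Suc r \<le> k" "k < length xs" for k
    proof (cases "frg (xs ! r) = i")
      case fi: True
      then have Z: "Z = {b}" by (simp add: Z_def)
      show ?thesis
      proof (cases "k = Suc r")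
        case True
        have "closed (trace P i (xs ! Suc r) - {b})"
        proof (rule closed_trace_diff_crossing[of _ "y r"])
          show "seg_in P (xs ! Suc r)" using seg_in r(1) by simp
          show "crossing P (frg (xs ! Suc r), y r) (i, b)" using crossing_sym[OF cr(1)] r(3) fi by simp
          show "b \<notin> closed_segment (src (xs ! Suc r)) (tgt (xs ! Suc r))"
            using inj_seg[of "Suc r" b "y r"] y_seg surf_b yb r(1,3) fi by auto
        qed (use r(5) in \<open>auto simp: y_def\<close>)
        then show ?thesis using True Z by simp
      next
        case False
        have "b \<notin> trace P i (xs ! k)"
        proof
          assume "b \<in> trace P i (xs ! k)"
          then obtain z where "z \<in> closed_segment (src (xs ! k)) (tgt (xs ! k))"
            "to_surface P (frg (xs ! r), b) = to_surface P (frg (xs ! k), z)"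
            using fi by (auto simp: trace_def)
          from inj_points[OF _ k(2) b_seg this(1) this(2)] show False using k False by simp
        qed
        then show ?thesis using closed_trace[OF i seg_in[of k]] k Z by simp
      qed
    next
      case False
      then show ?thesis using closed_trace[OF i seg_in[of k]] k by (simp add: Z_def)
    qed
    have "closed L" unfolding L_def using clL by (intro closed_UN) auto
    moreover have "closed U" unfolding U_def using clU by (intro closed_UN) auto
    moreover have "L \<inter> U = {}"
    proof (rule ccontr)
      assume "L \<inter> U \<noteq> {}"
      then obtain w where "w \<in> L" "w \<in> U" by blast
      from this(1) obtain k where k: "k \<le> r" "w \<in> trace P i (xs ! k)" "w \<noteq> y r" unfolding L_def by blast
      from \<open>w \<in> U\<close> obtain k' where k': "Suc r \<le> k'" "k' < length xs" "w \<in> trace P i (xs ! k')" "w \<notin> Z"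
        unfolding U_def by auto
      obtain z z' where w: "k \<le> r" "Suc r \<le> k'" "k' < length xs" "w \<noteq> y r" "w \<notin> Z"
        "z \<in> closed_segment (src (xs ! k)) (tgt (xs ! k))" "to_surface P (i, w) = to_surface P (frg (xs ! k), z)"
        "z' \<in> closed_segment (src (xs ! k')) (tgt (xs ! k'))" "to_surface P (i, w) = to_surface P (frg (xs ! k'), z')"
        using k k' unfolding trace_def by blast
      \<comment> \<open>A point seen from both parts can only be the junction at the crossing, and
        both of its representatives were removed from one of the parts.\<close>
      have "k' = Suc k \<and> z = tgt (xs ! k)" using inj_points[of k k' z z'] w by simp
      then have "k = r" "z = b" using w by (auto simp: b_def)
      then have "to_surface P (i, w) = to_surface P (frg (xs ! r), b)" using w by simp
      from to_surface_eq_cases[OF this] show False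
      proof (elim disjE conjE)
        assume "(i, w) = (frg (xs ! r), b)"
        then show False using w by (auto simp: Z_def)
      next
        assume "vertex_point P (frg (xs ! r), b)"
        then show False using cr(2) by simp
      next
        assume "crossing P (i, w) (frg (xs ! r), b)"
        from crossing_unique[OF this cr(1)] show False using w by simp
      qed
    qed
    moreover have "?S \<subseteq> L \<union> U"
    proof
      fix w assume "w \<in> ?S"
      then obtain k where k: "k < length xs" "w \<in> trace P i (xs ! k)" by (auto simp: fragment_part_traces)
      have yU: "y r \<in> U"
      proof -
        have "y r \<notin> Z" using yb by (auto simp: Z_def)
        then show ?thesis using y_in[OF rq(1)] r(1) unfolding U_def by (intro UN_I[of "Suc r"]) auto
      qed
      have ZL: "Z \<subseteq> L"
        using in_trace[of r b] b_seg r(1) yb unfolding L_def Z_def by auto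
      show "w \<in> L \<union> U"
      proof (cases "k \<le> r")
        case True
        then show ?thesis using k yU unfolding L_def by (cases "w = y r") auto
      next
        case False
        then show ?thesis using k ZL unfolding U_def by (cases "w \<in> Z") auto
      qed
    qed
    moreover have "y q \<in> L"
    proof -
      \<comment> \<open>With equal entry points the path would visit a point twice, or the segment
        between the two crossings would be constant.\<close>
      have "y q \<noteq> y r"
      proof
        assume "y q = y r"
        then have "Suc r = Suc (Suc q) \<and> y q = tgt (xs ! Suc q)"
          using inj_points[of "Suc q" "Suc r" "y q" "y r"] rq(3) r(1,3) q(3) by (auto simp: y_def)
        then show False
          using minimal_remove_constant[OF min two, of "xs ! Suc q"] q(1) by (auto simp: y_def)
      qed
      then show ?thesis using y_in[OF rq(2)] rq(3) unfolding L_def by (intro UN_I[of "Suc q"]) auto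
    qed
    moreover have "y r \<in> U"
    proof -
      have "y r \<notin> Z" using yb by (auto simp: Z_def)
      then show ?thesis using y_in[OF rq(1)] r(1) unfolding U_def by (intro UN_I[of "Suc r"]) auto
    qed
    ultimately show False using X unfolding connected_closed by blast
  qed
  have yS: "y r \<in> ?S" if "r \<in> ?R" for r
    using y_in[OF that] R(1)[OF that] by (auto simp: fragment_part_traces)
  have inj: "inj_on (\<lambda>r. connected_component_set ?S (y r)) ?R"
  proof (rule linorder_inj_onI)
    fix q r assume qr: "q < r" "q \<in> ?R" "r \<in> ?R"
    show "connected_component_set ?S (y q) \<noteq> connected_component_set ?S (y r)"
    proof
      assume "connected_component_set ?S (y q) = connected_component_set ?S (y r)"
      moreover have "y q \<in> connected_component_set ?S (y q)" using yS[OF qr(2)] by simp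
      ultimately have "y q \<in> connected_component_set ?S (y r)" by simp
      moreover have "y r \<in> connected_component_set ?S (y r)" using yS[OF qr(3)] by simp
      ultimately have "connected (connected_component_set ?S (y r)) \<and> connected_component_set ?S (y r) \<subseteq> ?S \<and>
          y r \<in> connected_component_set ?S (y r) \<and> y q \<in> connected_component_set ?S (y r)"
        by (intro conjI connected_connected_component connected_component_subset)
      with sep[OF qr(3,2,1)] show False by (rule notE)
    qed
  qed auto
  have sub: "(\<lambda>r. connected_component_set ?S (y r)) ` ?R \<subseteq> components ?S"
    unfolding components_def by (intro image_subsetI imageI yS)
  have fin: "finite (components ?S)" "card (components ?S) \<le> h"
    using comps by (auto simp: num_components_def split: if_splits)
  show ?thesis using card_inj_on_le[OF inj sub fin(1)] fin(2) by (rule order_trans)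
qed

end

context minimal_chain
begin

text \<open>With \<open>v\<close> vertex junctions at most \<open>2 + 2 * v\<close> segments run
  along portal edges, and each of these spoils at most two junctions. All other junctions are
  vertices or good crossings, so there are at most \<open>4 + 5 * v\<close> junctions besides the
  good crossings.\<close>

lemma length_le:
  assumes comps: "\<And>i. i < num_fragments P \<Longrightarrow>
    num_components (fragment_part P i (chain_path P (map seg_piece xs))) \<le> enat h"
  shows "length xs \<le> 5 + 5 * num_vertices P + h * num_portal_edges P"
proof -
  let ?V = vertex_junctions and ?E = "\<Union>(portals P)"
  define B where "B = {r. r < length xs \<and> runs_along P (xs ! r)}"
  have "B \<subseteq> {0, length xs - 1} \<union> ?V \<union> Suc ` ?V"
  proof
    fix r assume r: "r \<in> B"
    show "r \<in> {0, length xs - 1} \<union> ?V \<union> Suc ` ?V"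
    proof (rule ccontr)
      assume not: "r \<notin> {0, length xs - 1} \<union> ?V \<union> Suc ` ?V"
      then obtain q where q: "r = Suc q" by (cases r) auto
      then have "q \<in> crossings" "Suc q \<in> crossings"
        using not r by (auto simp: crossings_def vertex_junctions_def B_def)
      then show False using runs_along_not_between_crossings[of q] r q by (auto simp: B_def)
    qed
  qed
  then have "card B \<le> card ({0, length xs - 1} \<union> ?V \<union> Suc ` ?V)"
    using card_vertex_junctions(1) by (intro card_mono) auto
  also have "\<dots> \<le> card {0, length xs - 1} + card ?V + card (Suc ` ?V)"
    by (intro order_trans[OF card_Un_le] add_mono card_Un_le order_refl)
  also have "\<dots> \<le> 2 + card ?V + card ?V"
    using card_vertex_junctions(1) by (intro add_mono card_image_le order_refl) (simp add: card_insert_if)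
  finally have cardB: "card B \<le> 2 + 2 * card ?V" by simp
  have finB: "finite B" by (simp add: B_def)
  have cardG: "card good_crossings \<le> h * num_portal_edges P"
  proof -
    \<comment> \<open>A crossing enters a fragment that has a portal edge, and there are at most as
      many such fragments as portal edges.\<close>
    have "good_crossings \<subseteq> (\<Union>i\<in>frag_of ` ?E. {r \<in> good_crossings. frg (xs ! Suc r) = i})"
    proof
      fix r assume r: "r \<in> good_crossings"
      then have "crossing P (frg (xs ! r), tgt (xs ! r)) (frg (xs ! Suc r), src (xs ! Suc r))"
        using crossings_crossing(1) by (simp add: good_crossings_def)
      then have "frg (xs ! Suc r) \<in> frag_of ` ?E" by (auto simp: crossing_def)
      then show "r \<in> (\<Union>i\<in>frag_of ` ?E. {r \<in> good_crossings. frg (xs ! Suc r) = i})" using r by blast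
    qed
    moreover have "finite good_crossings"
      by (rule finite_subset[of _ "{..<length xs}"]) (auto simp: good_crossings_def crossings_def)
    ultimately have "card good_crossings \<le> card (\<Union>i\<in>frag_of ` ?E. {r \<in> good_crossings. frg (xs ! Suc r) = i})"
    proof (intro card_mono)
      show "finite (\<Union>i\<in>frag_of ` ?E. {r \<in> good_crossings. frg (xs ! Suc r) = i})" if "finite good_crossings"
        by (rule finite_subset[OF _ that]) auto
    qed
    also have "\<dots> \<le> (\<Sum>i\<in>frag_of ` ?E. card {r \<in> good_crossings. frg (xs ! Suc r) = i})"
      by (intro card_UN_le finite_imageI finite_portal_edges)
    also have "\<dots> \<le> (\<Sum>i\<in>frag_of ` ?E. h)"
    proof (rule sum_mono)
      fix i assume "i \<in> frag_of ` ?E"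
      then obtain e where e: "e \<in> ?E" "i = frag_of e" by blast
      then have "i < num_fragments P" using portal_partner[OF e(1)] portal_edges edge_fragment by blast
      from card_good_crossings_into[OF comps[OF this]]
      show "card {r \<in> good_crossings. frg (xs ! Suc r) = i} \<le> h" .
    qed
    also have "\<dots> = card (frag_of ` ?E) * h" by simp
    also have "\<dots> \<le> card ?E * h" by (intro mult_right_mono card_image_le finite_portal_edges) simp
    finally show ?thesis by (simp add: num_portal_edges_def mult.commute)
  qed
  have "{..<length xs - 1} \<subseteq> ?V \<union> good_crossings \<union> B \<union> (\<lambda>r. r - 1) ` B"
  proof
    fix r assume "r \<in> {..<length xs - 1}"
    then have r: "Suc r < length xs" by auto
    show "r \<in> ?V \<union> good_crossings \<union> B \<union> (\<lambda>r. r - 1) ` B"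
    proof (cases "runs_along P (xs ! Suc r)")
      case True
      then have "Suc r \<in> B" using r by (simp add: B_def)
      then have "r \<in> (\<lambda>r. r - 1) ` B" by (intro image_eqI[of _ _ "Suc r"]) auto
      then show ?thesis by blast
    next
      case False
      then show ?thesis using r by (auto simp: B_def good_crossings_def crossings_def vertex_junctions_def)
    qed
  qed
  moreover have "finite good_crossings"
    by (rule finite_subset[of _ "{..<length xs}"]) (auto simp: good_crossings_def crossings_def)
  ultimately have "card {..<length xs - 1} \<le> card (?V \<union> good_crossings \<union> B \<union> (\<lambda>r. r - 1) ` B)"
    using card_vertex_junctions(1) finB by (intro card_mono) auto
  also have "\<dots> \<le> card ?V + card good_crossings + card B + card ((\<lambda>r. r - 1) ` B)"
    by (intro order_trans[OF card_Un_le] add_mono order_refl)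
  finally have "length xs - 1 \<le> card ?V + card good_crossings + card B + card B"
    using card_image_le[OF finB, of "\<lambda>r. r - 1"] by simp
  then show ?thesis using cardB cardG card_vertex_junctions(2) by linarith
qed

end

section \<open>Complexity of chains of segments\<close>

context valid_portalgon
begin

lemma straight_piece_chain:
  assumes ch: "seg_chain P s xs t" and r: "r < length xs"
  shows "straight_piece P (chain_path P (map seg_piece xs)) (frg (xs ! r)) (src (xs ! r)) (real r / length xs)
    (tgt (xs ! r)) (real (Suc r) / length xs)"
proof -
  let ?N = "length xs" and ?x = "xs ! r"
  have N: "real ?N > 0" using r by (cases xs) auto
  have x: "seg_in P ?x" using seg_chain_in[OF ch r] .
  have "to_surface P (frg ?x, z) \<notin> surface_vertices P" if "z \<in> open_segment (src ?x) (tgt ?x)" for z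
    using x that surface_vertex_iff[of "frg ?x" z] by (auto simp: seg_in_def)
  moreover have "chain_path P (map seg_piece xs) u = to_surface P (frg ?x, linepath (src ?x) (tgt ?x) (u * ?N - r))"
    if "u \<in> {real r / ?N..real (Suc r) / ?N}" for u
    using chain_path_eq[OF seg_chain_chain[OF ch], of r u] that r N
    by (auto simp: piece_point_def seg_piece_def field_simps)
  moreover have "continuous_on {real r / ?N..real (Suc r) / ?N} (\<lambda>u. u * ?N - r)"
    by (intro continuous_intros)
  moreover have "mono_on {real r / ?N..real (Suc r) / ?N} (\<lambda>u. u * ?N - r)"
    by (auto simp: monotone_on_def intro: mult_right_mono)
  ultimately show ?thesis
    using x N unfolding straight_piece_def seg_in_def
    by (auto simp: divide_strict_right_mono intro!: exI[of _ "\<lambda>u. u * ?N - r"])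
qed

text \<open>Induction from the last segment backwards. The stretch in progress ends at
  \<open>t1\<close> and has crossings \<open>E0\<close>: a vertex junction closes it off and opens a
  new one, a crossing is put in front of \<open>E0\<close>. Either way a segment adds exactly one to
  the count.\<close>

lemma chain_tail_description:
  assumes ch: "seg_chain P s xs t"
    and J: "\<And>r. Suc r < length xs \<Longrightarrow> seg_end P (xs ! r) \<in> surface_vertices P \<or>
      crossing P (frg (xs ! r), tgt (xs ! r)) (frg (xs ! Suc r), src (xs ! Suc r))"
  defines "\<gamma> \<equiv> chain_path P (map seg_piece xs)"
  assumes r: "r < length xs"
  shows "\<exists>t1 tt E0 EE. length tt = length EE \<and> last (t1 # tt) = 1 \<and>
    sorted_wrt (<) (real r / length xs # t1 # tt) \<and>
    (\<forall>j<length EE. \<gamma> ((t1 # tt) ! j) \<in> surface_vertices P) \<and>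
    crosses P \<gamma> (frg (xs ! r)) (src (xs ! r)) (real r / length xs) t1 E0 \<and>
    (\<forall>j<length EE. \<exists>i x. crosses P \<gamma> i x ((t1 # tt) ! j) ((t1 # tt) ! Suc j) (EE ! j)) \<and>
    Suc (length tt) + length E0 + (\<Sum>E\<leftarrow>EE. length E) = length xs - r"
proof -
  have N: "length xs > 0" using r by (cases xs) auto
  note sp = straight_piece_chain[OF ch, folded \<gamma>_def]
  have "r \<le> length xs - 1" using r by simp
  then show ?thesis
  proof (induction r rule: inc_induct)
    case base
    have lt: "length xs - 1 < length xs" and one: "real (Suc (length xs - 1)) / length xs = 1"
      using N by simp_all
    have "crosses P \<gamma> (frg (xs ! (length xs - 1))) (src (xs ! (length xs - 1)))
        (real (length xs - 1) / length xs) 1 []"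
      using crosses.stay[OF sp[OF lt]] unfolding one .
    moreover have "real (length xs - 1) / length xs < 1" using N by simp
    ultimately show ?case
    proof (intro exI[of _ 1] exI[of _ "[]"] conjI)
      assume "crosses P \<gamma> (frg (xs ! (length xs - 1))) (src (xs ! (length xs - 1)))
        (real (length xs - 1) / length xs) 1 []"
      then show "crosses P \<gamma> (frg (xs ! (length xs - 1))) (src (xs ! (length xs - 1)))
        (real (length xs - 1) / length xs) 1 []" .
    next
      have "length xs - (length xs - 1) = 1" using N by arith
      then show "Suc (length []) + length [] + (\<Sum>E\<leftarrow>[]. length E) = length xs - (length xs - 1)" by simp
    qed (use N in auto)
  next
    case (step r)
    then have r: "Suc r < length xs" by simp
    let ?u = "real (Suc r) / length xs"
    have lt: "real r / length xs < ?u" using N by (intro divide_strict_right_mono) auto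
    obtain t1 tt E0 EE where IH: "length tt = length EE" "last (t1 # tt) = 1"
      "sorted_wrt (<) (?u # t1 # tt)"
      "\<forall>j<length EE. \<gamma> ((t1 # tt) ! j) \<in> surface_vertices P"
      "crosses P \<gamma> (frg (xs ! Suc r)) (src (xs ! Suc r)) ?u t1 E0"
      "\<forall>j<length EE. \<exists>i x. crosses P \<gamma> i x ((t1 # tt) ! j) ((t1 # tt) ! Suc j) (EE ! j)"
      "Suc (length tt) + length E0 + (\<Sum>E\<leftarrow>EE. length E) = length xs - Suc r"
      using step.IH by blast
    from J[OF r] show ?case
    proof
      assume v: "seg_end P (xs ! r) \<in> surface_vertices P"
      have "\<gamma> ?u = seg_end P (xs ! r)"
        using chain_path_eq[OF seg_chain_chain[OF ch], of r ?u] r N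
        by (simp add: \<gamma>_def seg_piece_point)
      then have "\<gamma> ?u \<in> surface_vertices P" using v by simp
      moreover have "crosses P \<gamma> (frg (xs ! r)) (src (xs ! r)) (real r / length xs) ?u []"
        using sp[of r] r by (auto intro: crosses.stay)
      ultimately show ?thesis using IH lt r
        by (intro exI[of _ ?u] exI[of _ "t1 # tt"] exI[of _ "[]"] exI[of _ "E0 # EE"])
          (auto simp: nth_Cons split: nat.split intro: less_trans)
    next
      assume "crossing P (frg (xs ! r), tgt (xs ! r)) (frg (xs ! Suc r), src (xs ! Suc r))"
      then obtain e e' l where e: "{e, e'} \<in> portals P" "0 < l" "l < 1" "frg (xs ! r) = frag_of e"
        "tgt (xs ! r) = edge_point P e l" "frg (xs ! Suc r) = frag_of e'" "src (xs ! Suc r) = edge_point P e' l"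
        by (auto simp: crossing_def)
      have "crosses P \<gamma> (frg (xs ! r)) (src (xs ! r)) (real r / length xs) t1 (e # E0)"
        using crosses.cross[OF e(1-3), of \<gamma> "src (xs ! r)" "real r / length xs" ?u t1 E0] sp[of r] r e IH(5)
        by simp
      then show ?thesis using IH lt r
        by (intro exI[of _ t1] exI[of _ tt] exI[of _ "e # E0"] exI[of _ EE]) (auto intro: less_trans)
    qed
  qed
qed

text \<open>The count of the tail lacks only the first vertex \<open>s\<close> of the description,
  hence the successor.\<close>

lemma path_complexity_chain_path:
  assumes ch: "seg_chain P s xs t" "xs \<noteq> []"
    and J: "\<And>r. Suc r < length xs \<Longrightarrow> seg_end P (xs ! r) \<in> surface_vertices P \<or>
      crossing P (frg (xs ! r), tgt (xs ! r)) (frg (xs ! Suc r), src (xs ! Suc r))"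
  shows "path_complexity P (chain_path P (map seg_piece xs)) \<le> enat (Suc (length xs))"
proof -
  let ?\<gamma> = "chain_path P (map seg_piece xs)"
  have "0 < length xs" using ch(2) by simp
  from chain_tail_description[OF ch(1) J this] obtain t1 tt E0 EE where
    d: "length tt = length EE" "last (t1 # tt) = 1" "sorted_wrt (<) (0 # t1 # tt)"
      "\<forall>j<length EE. ?\<gamma> ((t1 # tt) ! j) \<in> surface_vertices P"
      "crosses P ?\<gamma> (frg (xs ! 0)) (src (xs ! 0)) 0 t1 E0"
      "\<forall>j<length EE. \<exists>i x. crosses P ?\<gamma> i x ((t1 # tt) ! j) ((t1 # tt) ! Suc j) (EE ! j)"
      "Suc (length tt) + length E0 + (\<Sum>E\<leftarrow>EE. length E) = length xs"
    by auto
  let ?ts = "0 # t1 # tt" and ?Es = "E0 # EE"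
  have "describes P (map ?\<gamma> ?ts) ?Es ?\<gamma>"
    unfolding describes_def
  proof (intro conjI exI[of _ ?ts] allI impI)
    show "map ?\<gamma> ?ts ! j \<in> surface_vertices P" if "0 < j \<and> j < length ?Es" for j
      using that d(1,4) by (cases j) (auto simp: nth_Cons split: nat.split)
    show "\<exists>i x. crosses P ?\<gamma> i x (?ts ! j) (?ts ! Suc j) (?Es ! j)" if "j < length ?Es" for j
      using that d(5,6) by (cases j) auto
    show "map ?\<gamma> ?ts ! j = ?\<gamma> (?ts ! j)" if "j < length (map ?\<gamma> ?ts)" for j
      using that by (simp only: length_map nth_map)
  qed (use d in auto)
  then have "path_complexity P ?\<gamma> \<le> enat (length (map ?\<gamma> ?ts) + (\<Sum>E\<leftarrow>?Es. length E))"
    unfolding path_complexity_def by (intro INF_lower2[of "(map ?\<gamma> ?ts, ?Es)"]) auto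
  also have "length (map ?\<gamma> ?ts) + (\<Sum>E\<leftarrow>?Es. length E) = Suc (length xs)" using d(7) by simp
  finally show ?thesis .
qed

text \<open>Allows additive constants to be absorbed into the linear bound.\<close>

lemma num_vertices_ge:
  assumes "s \<in> topspace (surface P)"
  shows "3 \<le> num_vertices P"
proof -
  obtain i where i: "i < num_fragments P" using assms by (auto simp: topspace_surface)
  have "3 \<le> length (fragments P ! i)" using simple[OF i] by (simp add: simple_polygon_def)
  also have "\<dots> \<le> num_vertices P" unfolding num_vertices_def using i by (intro member_le_sum) auto
  finally show ?thesis .
qed

lemma happy_components:
  assumes "happy h P" "s \<in> topspace (surface P)" "t \<in> topspace (surface P)" "shortest_path P s t \<gamma>"
    "i < num_fragments P"
  shows "num_components (fragment_part P i \<gamma>) \<le> enat h"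
proof -
  have "num_components (fragment_part P i \<gamma>) \<le> (SUP \<gamma> \<in> {\<gamma>. shortest_path P s t \<gamma>}. num_components (fragment_part P i \<gamma>))"
    using assms(4) by (intro SUP_upper) auto
  also have "\<dots> \<le> fragment_happiness P i"
    unfolding fragment_happiness_def by (rule SUP_upper2[of "(s, t)"]) (use assms in auto)
  also have "\<dots> \<le> happiness P" unfolding happiness_def using assms(5) by (intro SUP_upper) auto
  also have "\<dots> \<le> enat h" using assms(1) by (simp add: happy_def)
  finally show ?thesis .
qed

theorem path_complexity_upper_bound:
  assumes "happy h P" "s \<in> topspace (surface P)" "t \<in> topspace (surface P)"
    "min_complexity_shortest_path P s t \<gamma>"
  shows "path_complexity P \<gamma> \<le> enat (7 * (num_vertices P + h * num_portal_edges P))"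
proof -
  have sp: "shortest_path P s t \<gamma>" using assms(4) by (simp add: min_complexity_shortest_path_def)
  obtain xs where xs: "minimal P s xs t" using exists_minimal[OF sp] .
  have opt: "optimal P s xs t" using xs by (simp add: minimal_def)
  then have ch: "seg_chain P s xs t" "xs \<noteq> []" "ennreal (seg_len xs) \<le> surface_dist P s t"
    by (auto simp: optimal_def)
  have fin: "surface_dist P s t < \<infinity>" using sp unfolding shortest_path_def by metis
  let ?\<gamma> = "chain_path P (map seg_piece xs)"
  have sp': "shortest_path P s t ?\<gamma>"
  proof (rule shortest_chain_path)
    show "chain P s (map seg_piece xs) t" using seg_chain_chain[OF ch(1)] .
    show "chain_len (map seg_piece xs) \<le> surface_dist P s t"
      using chain_len_seg_piece ch(3) by (rule order_trans)
    then show "chain_len (map seg_piece xs) < \<infinity>" using fin by (rule order_le_less_trans)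
  qed (use ch in auto)
  note comps = happy_components[OF assms(1-3) sp']
  have "path_complexity P ?\<gamma> \<le> enat (Suc (length xs)) \<and>
      length xs \<le> 5 + 5 * num_vertices P + h * num_portal_edges P"
  proof (cases "2 \<le> length xs")
    case True
    interpret minimal_chain P s t xs by unfold_locales (use xs True in auto)
    have "path_complexity P ?\<gamma> \<le> enat (Suc (length xs))"
    proof (rule path_complexity_chain_path[OF ch(1,2)])
      fix r assume "Suc r < length xs"
      then have "seg_end P (xs ! r) \<in> surface_vertices P \<or> r \<in> crossings" by (auto simp: crossings_def)
      then show "seg_end P (xs ! r) \<in> surface_vertices P \<or>
        crossing P (frg (xs ! r), tgt (xs ! r)) (frg (xs ! Suc r), src (xs ! Suc r))"
        using crossings_crossing(1) by blast
    qed
    then show ?thesis using length_le[OF comps] by simp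
  next
    case False
    have "path_complexity P ?\<gamma> \<le> enat (Suc (length xs))"
      by (rule path_complexity_chain_path[OF ch(1,2)]) (use False in auto)
    then show ?thesis using False by simp
  qed
  moreover have "path_complexity P \<gamma> \<le> path_complexity P ?\<gamma>"
    using assms(4) sp' by (auto simp: min_complexity_shortest_path_def)
  ultimately have "path_complexity P \<gamma> \<le> enat (Suc (5 + 5 * num_vertices P + h * num_portal_edges P))"
    by (meson Suc_le_mono enat_ord_simps(1) order_trans)
  \<comment> \<open>The additive 6 is at most \<open>2 * num_vertices P\<close>, which raises the
    factor 5 to 7.\<close>
  also have "\<dots> \<le> enat (7 * (num_vertices P + h * num_portal_edges P))"
    using num_vertices_ge[OF assms(2)] by simp
  finally show ?thesis .
qed

end

section \<open>Strips of parallelograms\<close>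

text \<open>A parallelogram whose bottom side is subdivided by \<open>N\<close> further vertices.
  The list starts at \<open>1\<close>, so that sides 0 and 2 are the slanted ones for every
  \<open>N\<close>.\<close>

definition strip_polygon :: "real \<Rightarrow> nat \<Rightarrow> complex list" where
  "strip_polygon A N = [1, Complex (1 + A) 1, Complex A 1, 0] @ map (\<lambda>r. of_real (real r / real (Suc N))) [1..<Suc N]"

definition strip :: "real \<Rightarrow> complex set" where
  "strip A = {z. 0 \<le> Im z \<and> Im z \<le> 1 \<and> A * Im z \<le> Re z \<and> Re z \<le> A * Im z + 1}"

lemma length_strip_polygon: "length (strip_polygon A N) = 4 + N"
  by (simp add: strip_polygon_def)

lemma strip_polygon_vertex:
  "poly_vertex (strip_polygon A N) 0 = 1"
  "poly_vertex (strip_polygon A N) (Suc 0) = Complex (1 + A) 1"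
  "poly_vertex (strip_polygon A N) 2 = Complex A 1"
  "r \<le> Suc N \<Longrightarrow> poly_vertex (strip_polygon A N) (3 + r) = of_real (real r / real (Suc N))"
proof -
  show "poly_vertex (strip_polygon A N) 0 = 1"
    "poly_vertex (strip_polygon A N) (Suc 0) = Complex (1 + A) 1"
    "poly_vertex (strip_polygon A N) 2 = Complex A 1"
    by (simp_all add: poly_vertex_def length_strip_polygon) (simp_all add: strip_polygon_def)
  assume r: "r \<le> Suc N"
  show "poly_vertex (strip_polygon A N) (3 + r) = of_real (real r / real (Suc N))"
  proof (cases "r = Suc N")
    case True
    then have "3 + r = length (strip_polygon A N)" by (simp add: length_strip_polygon)
    then have "poly_vertex (strip_polygon A N) (3 + r) = strip_polygon A N ! 0"
      by (simp add: poly_vertex_def)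
    then show ?thesis using True by (simp add: strip_polygon_def)
  next
    case False
    then have m: "(3 + r) mod length (strip_polygon A N) = 3 + r" using r by (simp add: length_strip_polygon)
    show ?thesis
    proof (cases r)
      case 0
      then show ?thesis unfolding poly_vertex_def m by (simp add: strip_polygon_def)
    next
      case (Suc q)
      then have "strip_polygon A N ! (3 + r) = map (\<lambda>r. of_real (real r / real (Suc N))) [1..<Suc N] ! q"
        by (simp add: strip_polygon_def del: upt_Suc map_upt_Suc)
      then show ?thesis unfolding poly_vertex_def m using False r Suc by (simp del: upt_Suc)
    qed
  qed
qed

lemma closed_segment_horizontal:
  assumes "a \<le> b"
  shows "z \<in> closed_segment (Complex a c) (Complex b c) \<longleftrightarrow> Im z = c \<and> a \<le> Re z \<and> Re z \<le> b"
proof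
  assume "z \<in> closed_segment (Complex a c) (Complex b c)"
  then obtain u where u: "0 \<le> u" "u \<le> 1" "z = (1 - u) *\<^sub>R Complex a c + u *\<^sub>R Complex b c"
    by (auto simp: in_segment)
  have "Re z = a + u * (b - a)" "Im z = c" unfolding u(3) by (simp_all add: algebra_simps)
  moreover have "0 \<le> u * (b - a)" "u * (b - a) \<le> 1 * (b - a)"
    using u assms by (simp_all add: mult_left_le_one_le)
  ultimately show "Im z = c \<and> a \<le> Re z \<and> Re z \<le> b" by auto
next
  assume z: "Im z = c \<and> a \<le> Re z \<and> Re z \<le> b"
  show "z \<in> closed_segment (Complex a c) (Complex b c)"
  proof (cases "a = b")
    case True
    then have "z = Complex a c" using z by (simp add: complex_eq_iff)
    then show ?thesis by simp
  next
    case False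
    define u where "u = (Re z - a) / (b - a)"
    have "u * (b - a) = Re z - a" using False by (simp add: u_def)
    then have "z = (1 - u) *\<^sub>R Complex a c + u *\<^sub>R Complex b c"
      using z by (simp add: complex_eq_iff algebra_simps)
    moreover have "0 \<le> u" "u \<le> 1" using z False assms by (auto simp: u_def field_simps)
    ultimately show ?thesis unfolding in_segment by blast
  qed
qed

lemma closed_segment_slanted:
  "z \<in> closed_segment (Complex a 0) (Complex (a + A) 1) \<longleftrightarrow> 0 \<le> Im z \<and> Im z \<le> 1 \<and> Re z = a + A * Im z"
proof
  assume "z \<in> closed_segment (Complex a 0) (Complex (a + A) 1)"
  then obtain u where u: "0 \<le> u" "u \<le> 1" "z = (1 - u) *\<^sub>R Complex a 0 + u *\<^sub>R Complex (a + A) 1"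
    by (auto simp: in_segment)
  show "0 \<le> Im z \<and> Im z \<le> 1 \<and> Re z = a + A * Im z"
    unfolding u(3) using u(1,2) by (simp add: algebra_simps)
next
  assume "0 \<le> Im z \<and> Im z \<le> 1 \<and> Re z = a + A * Im z"
  then show "z \<in> closed_segment (Complex a 0) (Complex (a + A) 1)"
    unfolding in_segment by (intro exI[of _ "Im z"]) (simp add: complex_eq_iff algebra_simps)
qed

lemma strip_polygon_side:
  "z \<in> poly_side (strip_polygon A N) 0 \<longleftrightarrow> 0 \<le> Im z \<and> Im z \<le> 1 \<and> Re z = 1 + A * Im z"
  "z \<in> poly_side (strip_polygon A N) (Suc 0) \<longleftrightarrow> Im z = 1 \<and> A \<le> Re z \<and> Re z \<le> A + 1"
  "z \<in> poly_side (strip_polygon A N) 2 \<longleftrightarrow> 0 \<le> Im z \<and> Im z \<le> 1 \<and> Re z = A * Im z"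
  "r \<le> N \<Longrightarrow> z \<in> poly_side (strip_polygon A N) (3 + r) \<longleftrightarrow>
    Im z = 0 \<and> real r / real (Suc N) \<le> Re z \<and> Re z \<le> real (Suc r) / real (Suc N)"
proof -
  note v = strip_polygon_vertex[where A = A and N = N]
  have one: "1 = Complex 1 0" "0 = Complex 0 0" by (simp_all add: complex_eq_iff)
  have two: "Suc (Suc 0) = 2" "Suc 2 = 3 + 0" by simp_all
  show "z \<in> poly_side (strip_polygon A N) 0 \<longleftrightarrow> 0 \<le> Im z \<and> Im z \<le> 1 \<and> Re z = 1 + A * Im z"
    unfolding poly_side_def v one(1) by (rule closed_segment_slanted)
  show "z \<in> poly_side (strip_polygon A N) (Suc 0) \<longleftrightarrow> Im z = 1 \<and> A \<le> Re z \<and> Re z \<le> A + 1"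
    unfolding poly_side_def two v closed_segment_commute[of "Complex (1 + A) 1"]
    by (subst closed_segment_horizontal) auto
  have "poly_vertex (strip_polygon A N) (Suc 2) = Complex 0 0" unfolding two by (subst v(4)) (auto simp: one)
  then show "z \<in> poly_side (strip_polygon A N) 2 \<longleftrightarrow> 0 \<le> Im z \<and> Im z \<le> 1 \<and> Re z = A * Im z"
    using closed_segment_slanted[of z 0 A] unfolding poly_side_def v
    by (simp add: closed_segment_commute)
  assume r: "r \<le> N"
  have "poly_vertex (strip_polygon A N) (Suc (3 + r)) = of_real (real (Suc r) / real (Suc N))"
    using v(4)[of "Suc r"] r by simp
  moreover have "of_real x = Complex x 0" for x by (simp add: complex_eq_iff)
  moreover have "real r / real (Suc N) \<le> real (Suc r) / real (Suc N)" by (intro divide_right_mono) auto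
  ultimately show "z \<in> poly_side (strip_polygon A N) (3 + r) \<longleftrightarrow>
    Im z = 0 \<and> real r / real (Suc N) \<le> Re z \<and> Re z \<le> real (Suc r) / real (Suc N)"
    unfolding poly_side_def using v(4)[of r] r by (simp add: closed_segment_horizontal del: of_nat_Suc)
qed

lemma strip_index_cases:
  assumes "j < length (strip_polygon A N)"
  obtains "j = 0" | "j = Suc 0" | "j = 2" | r where "j = 3 + r" "r \<le> N"
  using assms that(4)[of "j - 3"] that by (cases "j \<le> 2") (auto simp: length_strip_polygon le_Suc_eq numeral_2_eq_2)

lemma simple_strip_polygon: "simple_polygon (strip_polygon A N)"
proof -
  let ?vs = "strip_polygon A N"
  let ?v = "poly_vertex ?vs" and ?s = "poly_side ?vs"
  have frac: "real r / real (Suc N) \<le> real q / real (Suc N) \<longleftrightarrow> r \<le> q" for r q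
    by (simp add: divide_le_cancel del: of_nat_Suc)
  have "distinct ?vs"
  proof -
    have "inj_on (\<lambda>r. of_real (real r / real (Suc N)) :: complex) {1..<Suc N}"
      by (auto simp: inj_on_def simp del: of_nat_Suc)
    then show ?thesis
      by (auto simp: strip_polygon_def distinct_map complex_eq_iff simp del: upt_Suc of_nat_Suc)
  qed
  moreover have meet: "z \<in> {?v j, ?v (Suc j)} \<inter> {?v k, ?v (Suc k)}"
    if jk: "j < k" "k < length ?vs" and z: "z \<in> ?s j" "z \<in> ?s k" for j k z
  proof -
    note v = strip_polygon_vertex[where A = A and N = N] and s = strip_polygon_side[where z = z and A = A and N = N]
    have j: "j < length ?vs" using jk by simp
    have v3: "?v (Suc 2) = 0" using v(4)[of 0] by simp
    have vN: "?v (Suc (3 + N)) = 1" using v(4)[of "Suc N"] by simp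
    have vS: "?v (Suc (3 + r)) = of_real (real (Suc r) / real (Suc N))" if "r \<le> N" for r
      using v(4)[of "Suc r"] that by simp
    have two: "Suc (Suc 0) = 2" by simp
    show ?thesis
    proof (rule strip_index_cases[OF j]; rule strip_index_cases[OF jk(2)])
      assume *: "j = 0" "k = Suc 0"
      then have "z = ?v 1" using z s v by (simp add: complex_eq_iff)
      then show ?thesis using * by simp
    next
      assume *: "j = 0" "k = 2"
      then show ?thesis using z s by auto
    next
      fix r assume *: "j = 0" "k = 3 + r" "r \<le> N"
      then have z1: "z = 1" using z s(1) s(4)[of r] by (simp add: complex_eq_iff)
      then have "real (Suc N) / real (Suc N) \<le> real (Suc r) / real (Suc N)"
        using * z(2) s(4)[of r] by simp
      then have "r = N" using frac * by simp
      then show ?thesis using * z1 v(1) vN by simp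
    next
      assume *: "j = Suc 0" "k = 2"
      then have "z = ?v 2" using z s v by (simp add: complex_eq_iff)
      then show ?thesis using * by (simp add: two)
    next
      fix r assume *: "j = Suc 0" "k = 3 + r" "r \<le> N"
      then show ?thesis using z s(2) s(4)[of r] by simp
    next
      fix r assume *: "j = 2" "k = 3 + r" "r \<le> N"
      then have z0: "z = 0" using z s(3) s(4)[of r] by (simp add: complex_eq_iff)
      then have "real r / real (Suc N) \<le> real 0 / real (Suc N)" using * z(2) s(4)[of r] by simp
      then have "r = 0" using frac by blast
      then show ?thesis using * z0 v3 by simp
    next
      fix r q assume *: "j = 3 + r" "r \<le> N" "k = 3 + q" "q \<le> N"
      have zr: "Im z = 0" "real q / real (Suc N) \<le> Re z" "Re z \<le> real (Suc r) / real (Suc N)"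
        using z * s(4)[of r] s(4)[of q] by auto
      then have "real q / real (Suc N) \<le> real (Suc r) / real (Suc N)" by linarith
      then have "q \<le> Suc r" using frac by blast
      then have q: "q = Suc r" using jk * by simp
      then have "z = of_real (real (Suc r) / real (Suc N))" using zr by (simp add: complex_eq_iff)
      then have "z = ?v (Suc (3 + r))" using vS * by simp
      then show ?thesis using * q by simp
    qed (use jk in auto)
  qed
  moreover have "?s j \<inter> ?s k = {?v j, ?v (Suc j)} \<inter> {?v k, ?v (Suc k)}"
    if "j < length ?vs" "k < length ?vs" "j \<noteq> k" for j k
  proof
    show "?s j \<inter> ?s k \<subseteq> {?v j, ?v (Suc j)} \<inter> {?v k, ?v (Suc k)}"
      using meet[of j k] meet[of k j] that by (cases "j < k") (auto simp: not_less)
    show "{?v j, ?v (Suc j)} \<inter> {?v k, ?v (Suc k)} \<subseteq> ?s j \<inter> ?s k"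
      by (auto simp: poly_side_def)
  qed
  ultimately show ?thesis unfolding simple_polygon_def by (auto simp: length_strip_polygon)
qed

text \<open>As an intersection of half-planes the strip gets convexity, closedness and its interior
  from the corresponding facts on half-planes.\<close>

lemma strip_halfspaces:
  "strip A = {z. inner (Complex 0 (-1)) z \<le> 0} \<inter> {z. inner (Complex 0 1) z \<le> 1} \<inter>
    {z. inner (Complex (-1) A) z \<le> 0} \<inter> {z. inner (Complex 1 (-A)) z \<le> 1}"
  by (auto simp: strip_def inner_complex_def)

lemma convex_strip: "convex (strip A)"
  unfolding strip_halfspaces by (intro convex_Int convex_halfspace_le)

lemma poly_boundary_strip: "poly_boundary (strip_polygon A N) = frontier (strip A)"
proof -
  have "interior (strip A) = {z. inner (Complex 0 (-1)) z < 0} \<inter> {z. inner (Complex 0 1) z < 1} \<inter>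
    {z. inner (Complex (-1) A) z < 0} \<inter> {z. inner (Complex 1 (-A)) z < 1}"
    unfolding strip_halfspaces by (simp add: interior_halfspace_le complex_eq_iff)
  then have int: "z \<in> interior (strip A) \<longleftrightarrow> 0 < Im z \<and> Im z < 1 \<and> A * Im z < Re z \<and> Re z < A * Im z + 1" for z
    by (simp add: inner_complex_def) argo
  have "closed (strip A)"
    unfolding strip_halfspaces by (intro closed_Int closed_halfspace_le)
  then have "frontier (strip A) = strip A - interior (strip A)" by (simp add: frontier_def)
  also have "\<dots> = {z \<in> strip A. Im z = 0 \<or> Im z = 1 \<or> Re z = A * Im z \<or> Re z = 1 + A * Im z}"
  proof (rule set_eqI)
    fix z
    have "z \<in> strip A - interior (strip A) \<longleftrightarrow> z \<in> strip A \<and> \<not> (0 < Im z \<and> Im z < 1 \<and> A * Im z < Re z \<and> Re z < A * Im z + 1)"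
      using int by blast
    also have "\<dots> \<longleftrightarrow> z \<in> strip A \<and> (Im z = 0 \<or> Im z = 1 \<or> Re z = A * Im z \<or> Re z = 1 + A * Im z)"
      unfolding strip_def mem_Collect_eq by argo
    finally show "z \<in> strip A - interior (strip A) \<longleftrightarrow>
        z \<in> {z \<in> strip A. Im z = 0 \<or> Im z = 1 \<or> Re z = A * Im z \<or> Re z = 1 + A * Im z}" by simp
  qed
  also have "\<dots> = poly_boundary (strip_polygon A N)"
  proof
    show "{z \<in> strip A. Im z = 0 \<or> Im z = 1 \<or> Re z = A * Im z \<or> Re z = 1 + A * Im z} \<subseteq>
        poly_boundary (strip_polygon A N)"
    proof
      fix z assume "z \<in> {z \<in> strip A. Im z = 0 \<or> Im z = 1 \<or> Re z = A * Im z \<or> Re z = 1 + A * Im z}"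
      then have z: "z \<in> strip A" "Im z = 0 \<or> Im z = 1 \<or> Re z = A * Im z \<or> Re z = 1 + A * Im z" by auto
      note s = strip_polygon_side[where z = z and A = A and N = N]
      have "\<exists>j<4 + N. z \<in> poly_side (strip_polygon A N) j"
        using z(2)
      proof (elim disjE)
        assume "Im z = 0"
        then have "0 \<le> Re z" "Re z \<le> real (Suc N) / real (Suc N)" using z(1) by (auto simp: strip_def)
        then obtain r where "r < Suc N" "real r / real (Suc N) \<le> Re z" "Re z \<le> real (Suc r) / real (Suc N)"
          using strict_partition_cover[of "\<lambda>r. real r / real (Suc N)" "Re z" "Suc N"] by auto
        then show ?thesis using s(4)[of r] \<open>Im z = 0\<close> by (intro exI[of _ "3 + r"]) auto
      next
        assume "Im z = 1"
        then show ?thesis using z(1) s(2) by (intro exI[of _ "Suc 0"]) (auto simp: strip_def)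
      next
        assume "Re z = A * Im z"
        then show ?thesis using z(1) s(3) by (intro exI[of _ 2]) (auto simp: strip_def)
      next
        assume "Re z = 1 + A * Im z"
        then show ?thesis using z(1) s(1) by (intro exI[of _ 0]) (auto simp: strip_def)
      qed
      then show "z \<in> poly_boundary (strip_polygon A N)" by (auto simp: poly_boundary_def length_strip_polygon)
    qed
    show "poly_boundary (strip_polygon A N) \<subseteq>
        {z \<in> strip A. Im z = 0 \<or> Im z = 1 \<or> Re z = A * Im z \<or> Re z = 1 + A * Im z}"
    proof
      fix z assume "z \<in> poly_boundary (strip_polygon A N)"
      then obtain j where j: "j < length (strip_polygon A N)" "z \<in> poly_side (strip_polygon A N) j"
        by (auto simp: poly_boundary_def)
      note s = strip_polygon_side[where z = z and A = A and N = N]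
      show "z \<in> {z \<in> strip A. Im z = 0 \<or> Im z = 1 \<or> Re z = A * Im z \<or> Re z = 1 + A * Im z}"
      proof (rule strip_index_cases[OF j(1)])
        fix r assume r: "j = 3 + r" "r \<le> N"
        then have "Im z = 0" "real r / real (Suc N) \<le> Re z" "Re z \<le> real (Suc r) / real (Suc N)"
          using j(2) s(4)[of r] by auto
        moreover have "real (Suc r) / real (Suc N) \<le> 1" "0 \<le> real r / real (Suc N)" using r by auto
        ultimately have "0 \<le> Re z" "Re z \<le> 1" "Im z = 0" by linarith+
        then show ?thesis by (simp add: strip_def)
      qed (use j(2) s in \<open>auto simp: strip_def\<close>)
    qed
  qed
  finally show ?thesis by simp
qed

text \<open>The inside of the frontier of a bounded convex set is its interior.\<close>

lemma poly_region_strip: "poly_region (strip_polygon A N) = strip A"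
proof -
  have "closed (strip A)"
    unfolding strip_halfspaces by (intro closed_Int closed_halfspace_le)
  moreover have "bounded (strip A)"
  proof (rule boundedI)
    fix z assume z: "z \<in> strip A"
    have "\<bar>A * Im z\<bar> \<le> \<bar>A\<bar> * 1"
      using z unfolding abs_mult by (intro mult_left_mono) (auto simp: strip_def)
    then have "\<bar>Re z\<bar> \<le> \<bar>A\<bar> + 1" using z by (auto simp: strip_def)
    moreover have "\<bar>Im z\<bar> \<le> 1" using z by (auto simp: strip_def)
    ultimately show "norm z \<le> \<bar>A\<bar> + 2" using cmod_le[of z] by linarith
  qed
  ultimately show ?thesis
    unfolding poly_region_def poly_boundary_strip
    using inside_frontier_eq_interior[OF _ convex_strip[of A]] frontier_def[of "strip A"]
    by (metis Diff_partition Un_commute closure_closed interior_subset)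
qed

text \<open>Side 0 runs upwards and side 2 downwards, hence the opposite flags. The right side of
  each strip is glued to the left side of the next; the row, unlike the annulus, omits the portal
  that leads from the last strip back to the first.\<close>

definition strip_portalgon :: "real \<Rightarrow> nat \<Rightarrow> nat \<Rightarrow> bool \<Rightarrow> portalgon" where
  "strip_portalgon A k N cyclic =
     \<lparr>fragments = strip_polygon A N # replicate (k - 1) (strip_polygon A 0),
      portals = (\<lambda>i. {DEdge i 0 True, DEdge (Suc i mod k) 2 False}) ` {..<(if cyclic then k else k - 1)}\<rparr>"

lemma happyI:
  assumes "\<And>s t \<gamma> i. shortest_path P s t \<gamma> \<Longrightarrow> i < num_fragments P \<Longrightarrow>
    num_components (fragment_part P i \<gamma>) \<le> enat h"
  shows "happy h P"
  unfolding happy_def happiness_def fragment_happiness_def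
  using assms by (intro SUP_least) (auto intro!: SUP_least)

text \<open>Send each component to some \<open>C j\<close> that meets it. Being connected,
  \<open>C j\<close> lies within this component, so the map is injective.\<close>

lemma num_components_Union_le:
  assumes "finite J" "\<And>j. j \<in> J \<Longrightarrow> connected (C j)"
  shows "num_components (\<Union>j\<in>J. C j) \<le> enat (card J)"
proof -
  let ?X = "\<Union>j\<in>J. C j"
  define f where "f = (\<lambda>Y. SOME j. j \<in> J \<and> C j \<inter> Y \<noteq> {})"
  have f: "f Y \<in> J \<and> C (f Y) \<inter> Y \<noteq> {}" if "Y \<in> components ?X" for Y
  proof -
    have "Y \<noteq> {}" "Y \<subseteq> ?X" using in_components_nonempty[OF that] in_components_subset[OF that] by auto
    then have "\<exists>j. j \<in> J \<and> C j \<inter> Y \<noteq> {}" by blast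
    then show ?thesis unfolding f_def by (rule someI_ex)
  qed
  have "inj_on f (components ?X)"
  proof (rule inj_onI)
    fix Y Z assume YZ: "Y \<in> components ?X" "Z \<in> components ?X" "f Y = f Z"
    have sub: "C (f Y) \<subseteq> W" if "W \<in> components ?X" "C (f Y) \<inter> W \<noteq> {}" for W
    proof (rule components_maximal[OF that(1)])
      show "connected (C (f Y))" "C (f Y) \<subseteq> ?X" using f[OF YZ(1)] assms(2) by auto
    qed (use that in auto)
    have "C (f Y) \<subseteq> Y" "C (f Y) \<subseteq> Z" "C (f Y) \<inter> Y \<noteq> {}"
      using sub[OF YZ(1)] sub[OF YZ(2)] f[OF YZ(1)] f[OF YZ(2)] YZ(3) by auto
    then have "Y \<inter> Z \<noteq> {}" by blast
    then show "Y = Z" using components_nonoverlap[OF YZ(1,2)] by blast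
  qed
  moreover have "f ` components ?X \<subseteq> J" using f by blast
  ultimately have "finite (components ?X)" "card (components ?X) \<le> card J"
    using assms(1) inj_on_finite card_inj_on_le by blast+
  then show ?thesis by (simp add: num_components_def)
qed

locale strips =
  fixes A :: real and k N :: nat and cyclic :: bool
  assumes k: "1 \<le> k"
begin

abbreviation "P \<equiv> strip_portalgon A k N cyclic"

lemma num_fragments: "num_fragments P = k"
  using k by (simp add: strip_portalgon_def)

lemma fragments_nth: "i < k \<Longrightarrow> fragments P ! i = strip_polygon A (if i = 0 then N else 0)"
  by (cases i) (auto simp: strip_portalgon_def)

lemma fragment: "i < k \<Longrightarrow> fragment P i = strip A"
  by (simp add: fragment_def fragments_nth poly_region_strip)

lemma portals: "portals P = (\<lambda>i. {DEdge i 0 True, DEdge (Suc i mod k) 2 False}) ` {..<(if cyclic then k else k - 1)}"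
  by (simp add: strip_portalgon_def)

lemma portal_index: "i < (if cyclic then k else k - 1) \<Longrightarrow> i < k"
  by (auto split: if_splits)

lemma edge_ends:
  assumes "i < k"
  shows "edge_start P (DEdge i 0 True) = 1" "edge_end P (DEdge i 0 True) = 1 + Complex A 1"
    "edge_start P (DEdge i 2 False) = 0" "edge_end P (DEdge i 2 False) = Complex A 1"
proof -
  have "Suc 2 = 3 + 0" by simp
  then show "edge_start P (DEdge i 0 True) = 1" "edge_end P (DEdge i 0 True) = 1 + Complex A 1"
    "edge_start P (DEdge i 2 False) = 0" "edge_end P (DEdge i 2 False) = Complex A 1"
    using assms strip_polygon_vertex(4)[of 0]
    by (simp_all add: edge_start_def edge_end_def fragments_nth strip_polygon_vertex(1-3) complex_eq_iff)
qed

lemma edge_points: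
  assumes "i < k"
  shows "edge_point P (DEdge i 0 True) l = 1 + of_real l * Complex A 1"
    "edge_point P (DEdge i 2 False) l = of_real l * Complex A 1"
  by (simp_all add: edge_point_def edge_ends[OF assms] linepath_def scaleR_conv_of_real algebra_simps)

lemma Suc_mod_inj: "i < k \<Longrightarrow> j < k \<Longrightarrow> Suc i mod k = Suc j mod k \<Longrightarrow> i = j"
  by (auto simp: mod_Suc split: if_splits)

lemma is_portalgon: "is_portalgon P"
  unfolding is_portalgon_def
proof (intro conjI ballI impI)
  show "simple_polygon vs" if "vs \<in> set (fragments P)" for vs
    using that by (auto simp: strip_portalgon_def simple_strip_polygon)
  fix p assume "p \<in> portals P"
  then obtain i where i: "i < k" "p = {DEdge i 0 True, DEdge (Suc i mod k) 2 False}"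
    using portal_index by (auto simp: portals)
  have sk: "Suc i mod k < k" using k by simp
  show "\<exists>e e'. p = {e, e'} \<and> is_edge P e \<and> is_edge P e' \<and> \<not> same_side e e' \<and>
      dist (edge_start P e) (edge_end P e) = dist (edge_start P e') (edge_end P e')"
  proof (intro exI conjI)
    show "p = {DEdge i 0 True, DEdge (Suc i mod k) 2 False}" by (rule i(2))
    show "dist (edge_start P (DEdge i 0 True)) (edge_end P (DEdge i 0 True)) =
      dist (edge_start P (DEdge (Suc i mod k) 2 False)) (edge_end P (DEdge (Suc i mod k) 2 False))"
      unfolding edge_ends[OF i(1)] edge_ends[OF sk] by (simp add: dist_norm)
  qed (use i sk in \<open>auto simp: is_edge_def num_fragments fragments_nth length_strip_polygon same_side_def\<close>)
  fix q e e' assume "q \<in> portals P" "e \<in> p" "e' \<in> q" "same_side e e'"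
  then obtain j where j: "j < k" "q = {DEdge j 0 True, DEdge (Suc j mod k) 2 False}"
    using portal_index by (auto simp: portals)
  have "e = DEdge i 0 True \<or> e = DEdge (Suc i mod k) 2 False"
    "e' = DEdge j 0 True \<or> e' = DEdge (Suc j mod k) 2 False"
    using \<open>e \<in> p\<close> \<open>e' \<in> q\<close> i(2) j(2) by simp_all
  then have "i = j \<or> Suc i mod k = Suc j mod k" using \<open>same_side e e'\<close> by (auto simp: same_side_def)
  then have "i = j" using Suc_mod_inj[OF i(1) j(1)] by blast
  then show "p = q" using i j by simp
qed

sublocale valid_portalgon P
  by unfold_locales (rule is_portalgon)

lemma num_vertices: "num_vertices P = 4 * k + N"
proof -
  have "num_vertices P = (\<Sum>i<k. 4 + (if i = 0 then N else 0))"
    unfolding num_vertices_def num_fragments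
    by (rule sum.cong) (auto simp: fragments_nth length_strip_polygon)
  also have "\<dots> = 4 * k + N" using k by (simp add: sum.distrib)
  finally show ?thesis .
qed

lemma num_portal_edges: "num_portal_edges P = 2 * (if cyclic then k else k - 1)"
proof -
  let ?I = "{..<(if cyclic then k else k - 1)}"
  have eq: "\<Union>(portals P) = (\<lambda>i. DEdge i 0 True) ` ?I \<union> (\<lambda>i. DEdge (Suc i mod k) 2 False) ` ?I"
    by (auto simp: portals)
  have "inj_on (\<lambda>i. DEdge i 0 True) ?I" by (auto simp: inj_on_def)
  moreover have "inj_on (\<lambda>i. DEdge (Suc i mod k) 2 False) ?I"
  proof (rule inj_onI)
    fix i j assume ij: "i \<in> ?I" "j \<in> ?I" and "DEdge (Suc i mod k) 2 False = DEdge (Suc j mod k) 2 False"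
    then have "Suc i mod k = Suc j mod k" by simp
    then show "i = j" using Suc_mod_inj[of i j] portal_index[of i] portal_index[of j] ij by blast
  qed
  moreover have "(\<lambda>i. DEdge i 0 True) ` ?I \<inter> (\<lambda>i. DEdge (Suc i mod k) 2 False) ` ?I = {}" by auto
  ultimately show ?thesis
    unfolding num_portal_edges_def eq by (subst card_Un_disjoint) (auto simp: card_image)
qed

section \<open>Development of strips into the plane\<close>

text \<open>Copy \<open>j\<close> of the strip is developed at horizontal offset \<open>j\<close>; in the cyclic case this is the universal
  cover of an annulus.\<close>

definition copies :: "int set" where
  "copies = (if cyclic then UNIV else {0..<int k})"

definition frag :: "int \<Rightarrow> nat" where
  "frag j = nat (j mod int k)"

text \<open>The developing map, as a relation because a point on a common side lies in two copies;
  \<open>lifts_unique\<close> shows that it is a function of \<open>z\<close>.\<close>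

definition lifts :: "complex \<Rightarrow> (nat \<times> complex) set \<Rightarrow> bool" where
  "lifts z s \<longleftrightarrow> (\<exists>j\<in>copies. z - of_int j \<in> strip A \<and> s = to_surface P (frag j, z - of_int j))"

lemma frag_less: "frag j < k"
  using k by (simp add: frag_def nat_less_iff)

lemma frag_Suc: "frag (j + 1) = Suc (frag j) mod k"
proof -
  have "int (Suc (frag j) mod k) = (int (frag j) + 1) mod int k" by (simp add: zmod_int add.commute)
  also have "int (frag j) = j mod int k" using k by (simp add: frag_def)
  finally have "int (Suc (frag j) mod k) = int (frag (j + 1))" using k by (simp add: frag_def mod_simps)
  then show ?thesis by linarith
qed

lemma frag_of_nat: "i < k \<Longrightarrow> frag (int i) = i \<and> int i \<in> copies"
  by (simp add: frag_def copies_def)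

text \<open>Gluing changes the local coordinate by 1 in one direction, and passing to the
  neighbouring copy compensates for it, so the point of the plane stays the same.\<close>

lemma glued_develop:
  assumes "glued P (i, x) (i', x')" "j \<in> copies" "frag j = i"
  shows "\<exists>j'\<in>copies. frag j' = i' \<and> x' + of_int j' = x + of_int j"
proof -
  obtain e e' l where e: "{e, e'} \<in> portals P" "i = frag_of e" "x = edge_point P e l"
      "i' = frag_of e'" "x' = edge_point P e' l"
    using assms(1) by (auto simp: glued_def)
  then obtain t where t: "t < (if cyclic then k else k - 1)" "{e, e'} = {DEdge t 0 True, DEdge (Suc t mod k) 2 False}"
    by (auto simp: portals)
  have tk: "t < k" "Suc t mod k < k" using portal_index[OF t(1)] k by auto
  from t(2) consider "e = DEdge t 0 True" "e' = DEdge (Suc t mod k) 2 False"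
    | "e = DEdge (Suc t mod k) 2 False" "e' = DEdge t 0 True"
    by (auto simp: doubleton_eq_iff)
  then show ?thesis
  proof cases
    case 1
    have "x = 1 + x'" unfolding e(3,5) 1 using edge_points[OF tk(1), of l] edge_points[OF tk(2), of l] by simp
    moreover have "frag (j + 1) = i'" using assms(3) e 1 frag_Suc by simp
    moreover have "j + 1 \<in> copies"
      using assms(2,3) t(1) e(2) 1 by (auto simp: copies_def frag_def split: if_splits)
    ultimately show ?thesis by (intro bexI[of _ "j + 1"]) auto
  next
    case 2
    have "x' = 1 + x" unfolding e(3,5) 2 using edge_points[OF tk(1), of l] edge_points[OF tk(2), of l] by simp
    moreover have "Suc (frag (j - 1)) mod k = Suc t mod k" using assms(3) e 2 frag_Suc[of "j - 1"] by simp
    then have "frag (j - 1) = i'" using Suc_mod_inj[OF frag_less tk(1)] e 2 by simp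
    moreover have "j - 1 \<in> copies"
      using assms(2,3) t(1) e(2) 2 by (auto simp: copies_def frag_def split: if_splits)
    ultimately show ?thesis by (intro bexI[of _ "j - 1"]) auto
  qed
qed

lemma lifts_develop:
  assumes "lifts z s" "s = to_surface P (i, x)"
  shows "\<exists>j\<in>copies. frag j = i \<and> z = x + of_int j"
proof -
  obtain j where j: "j \<in> copies" "s = to_surface P (frag j, z - of_int j)" using assms(1) by (auto simp: lifts_def)
  then have "equivclp (glued P) (frag j, z - of_int j) (i, x)"
    using assms(2) by (metis to_surface_eq_iff)
  then have "\<exists>j\<in>copies. frag j = fst (i, x) \<and> snd (i, x) + of_int j = z"
  proof (induction rule: equivclp_induct)
    case base
    then show ?case using j by auto
  next
    case (step y y')
    then have "glued P (fst y, snd y) (fst y', snd y')" using glued_sym by (metis prod.collapse)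
    then show ?case using step.IH glued_develop by metis
  qed
  then show ?thesis by auto
qed

text \<open>Different copies that contain \<open>z\<close> are neighbours, and \<open>z\<close> lies
  on their common side, along which they are glued.\<close>

lemma lifts_unique:
  assumes "lifts z s" "lifts z s'"
  shows "s = s'"
proof -
  have *: "to_surface P (frag j, z - of_int j) = to_surface P (frag j', z - of_int j')"
    if j: "j \<in> copies" "z - of_int j \<in> strip A" "j' \<in> copies" "z - of_int j' \<in> strip A" "j < j'" for j j'
  proof -
    have r: "A * Im z \<le> Re z - of_int j" "Re z - of_int j \<le> A * Im z + 1"
      "A * Im z \<le> Re z - of_int j'" "Re z - of_int j' \<le> A * Im z + 1" "0 \<le> Im z" "Im z \<le> 1"
      using j by (auto simp: strip_def)
    then have "real_of_int j' \<le> of_int j + 1" by linarith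
    then have j': "j' = j + 1" using j(5) by linarith
    then have Re: "Re z = A * Im z + 1 + of_int j" using r by simp
    have t: "frag j < (if cyclic then k else k - 1)"
      using j j' frag_less[of j] by (auto simp: copies_def frag_def)
    have "{DEdge (frag j) 0 True, DEdge (Suc (frag j) mod k) 2 False} \<in> portals P"
      unfolding portals using t by (intro imageI) simp
    from to_surface_edge_point[OF this, of "Im z"] r
    have "to_surface P (frag j, edge_point P (DEdge (frag j) 0 True) (Im z)) =
      to_surface P (Suc (frag j) mod k, edge_point P (DEdge (Suc (frag j) mod k) 2 False) (Im z))" by simp
    moreover have "edge_point P (DEdge (frag j) 0 True) (Im z) = z - of_int j"
      unfolding edge_points[OF frag_less] using Re by (simp add: complex_eq_iff)
    moreover have "Suc (frag j) mod k < k" using k by simp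
    then have "edge_point P (DEdge (Suc (frag j) mod k) 2 False) (Im z) = z - of_int j'"
      using edge_points Re j' by (simp add: complex_eq_iff)
    ultimately show ?thesis using frag_Suc j' by simp
  qed
  obtain j j' where j: "j \<in> copies" "z - of_int j \<in> strip A" "s = to_surface P (frag j, z - of_int j)"
    "j' \<in> copies" "z - of_int j' \<in> strip A" "s' = to_surface P (frag j', z - of_int j')"
    using assms by (auto simp: lifts_def)
  consider "j < j'" | "j = j'" | "j' < j" by linarith
  then show ?thesis
  proof cases
    case 1
    show ?thesis unfolding j(3,6) by (rule *[OF j(1,2,4,5) 1])
  next
    case 2
    show ?thesis unfolding j(3,6) 2 ..
  next
    case 3
    show ?thesis unfolding j(3,6) by (rule *[OF j(4,5,1,2) 3, symmetric])
  qed
qed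

text \<open>Two lifts of a point differ by the offset between two copies of one fragment.\<close>

lemma lifts_fiber:
  assumes "lifts z s" "lifts z' s"
  shows "\<exists>n::int. z = z' + of_int n \<and> (if cyclic then int k dvd n else n = 0)"
proof -
  obtain j' where j': "j' \<in> copies" "s = to_surface P (frag j', z' - of_int j')" using assms(2) by (auto simp: lifts_def)
  from lifts_develop[OF assms(1) j'(2)] obtain j where j: "j \<in> copies" "frag j = frag j'"
    "z = z' - of_int j' + of_int j" by auto
  have "j mod int k = j' mod int k" using j(2) k by (simp add: frag_def eq_nat_nat_iff)
  then have "int k dvd j - j'" by (simp add: mod_eq_dvd_iff)
  moreover have "j = j'" if "\<not> cyclic"
  proof -
    have "j \<in> {0..<int k}" "j' \<in> {0..<int k}" using that j(1) j'(1) unfolding copies_def by simp_all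
    then show ?thesis using \<open>j mod int k = j' mod int k\<close> by simp
  qed
  ultimately show ?thesis using j(3) by (intro exI[of _ "j - j'"]) auto
qed

lemma lifts_translate:
  assumes "cyclic" "lifts z s"
  shows "lifts (z + of_int (int k * n)) s"
proof -
  obtain j where j: "z - of_int j \<in> strip A" "s = to_surface P (frag j, z - of_int j)"
    using assms(2) by (auto simp: lifts_def)
  moreover have "copies = UNIV" using assms(1) unfolding copies_def by simp
  ultimately show ?thesis unfolding lifts_def
    by (intro bexI[of _ "j + int k * n"]) (auto simp: frag_def)
qed

lemma lifts_exists:
  assumes "i < k" "x \<in> strip A"
  shows "lifts (x + of_nat i) (to_surface P (i, x))"
  unfolding lifts_def using assms frag_of_nat[OF assms(1)] by (intro bexI[of _ "int i"]) auto

lemma lifts_topspace: "s \<in> topspace (surface P) \<Longrightarrow> \<exists>z. lifts z s"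
  using lifts_exists fragment unfolding topspace_surface num_fragments by blast

lemma strip_shift:
  "z - of_int j \<in> strip A \<longleftrightarrow> 0 \<le> Im z \<and> Im z \<le> 1 \<and> of_int j \<le> Re z - A * Im z \<and> Re z - A * Im z \<le> of_int j + 1"
  by (auto simp: strip_def)

text \<open>The segment is cut where it leaves copy \<open>j\<close> in the direction of
  \<open>j'\<close>; the rest starts in a copy that is closer to \<open>j'\<close>.\<close>

lemma lift_segment_chain:
  assumes "j \<in> copies" "z - of_int j \<in> strip A" "j' \<in> copies" "z' - of_int j' \<in> strip A"
  shows "\<exists>ps. ps \<noteq> [] \<and>
    chain P (to_surface P (frag j, z - of_int j)) ps (to_surface P (frag j', z' - of_int j')) \<and>
    chain_len ps \<le> ennreal (dist z z')"
  using assms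
proof (induction "nat \<bar>j - j'\<bar>" arbitrary: j z rule: less_induct)
  case less
  have direct: "piece P (frag j, linepath (z - of_int j) (w - of_int j)) \<and>
      piece_point P (frag j, linepath (z - of_int j) (w - of_int j)) 0 = to_surface P (frag j, z - of_int j) \<and>
      piece_point P (frag j, linepath (z - of_int j) (w - of_int j)) 1 = to_surface P (frag j, w - of_int j) \<and>
      curve_length (linepath (z - of_int j) (w - of_int j)) 0 1 \<le> ennreal (dist z w)"
    if "w - of_int j \<in> strip A" for w
  proof (intro conjI)
    have "closed_segment (z - of_int j) (w - of_int j) \<subseteq> fragment P (frag j)"
      using that less.prems(2) convex_strip fragment[OF frag_less] by (simp add: closed_segment_subset)
    then show "piece P (frag j, linepath (z - of_int j) (w - of_int j))"
      using frag_less num_fragments by (intro piece_linepath) auto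
    show "curve_length (linepath (z - of_int j) (w - of_int j)) 0 1 \<le> ennreal (dist z w)"
      using curve_length_linepath[of "z - of_int j" "w - of_int j"] by (simp add: dist_norm)
  qed (simp_all add: piece_point_def linepath_0' linepath_1')
  show ?case
  proof (cases "j = j'")
    case True
    then show ?thesis using direct[of z'] less.prems
      by (intro exI[of _ "[(frag j, linepath (z - of_int j) (z' - of_int j))]"]) auto
  next
    case False
    \<comment> \<open>The shear that makes the slanted sides vertical: copy \<open>j\<close> is
      where \<open>G\<close> lies between \<open>j\<close> and \<open>j + 1\<close>, within heights
      0 to 1.\<close>
    define G where "G = (\<lambda>w. Re w - A * Im w)"
    define c where "c = (if j < j' then j + 1 else j)"
    define j1 where "j1 = (if j < j' then j + 1 else j - 1)"
    have Gz: "of_int j \<le> G z" "G z \<le> of_int j + 1" "of_int j' \<le> G z'" "G z' \<le> of_int j' + 1"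
      and Im: "0 \<le> Im z" "Im z \<le> 1" "0 \<le> Im z'" "Im z' \<le> 1"
      using less.prems by (auto simp: strip_shift G_def)
    have cont: "continuous_on {0..1} (\<lambda>u. G (linepath z z' u))"
      unfolding G_def linepath_def by (intro continuous_intros)
    have "\<exists>u\<ge>0. u \<le> 1 \<and> G (linepath z z' u) = of_int c"
    proof (cases "j < j'")
      case True
      then have "real_of_int (j + 1) \<le> of_int j'" by linarith
      then show ?thesis using Gz True cont by (intro IVT') (auto simp: c_def linepath_0' linepath_1')
    next
      case False
      then have "real_of_int (j' + 1) \<le> of_int j" using \<open>j \<noteq> j'\<close> by linarith
      then show ?thesis using Gz False cont by (intro IVT2') (auto simp: c_def linepath_0' linepath_1')
    qed
    then obtain u where u: "0 \<le> u" "u \<le> 1" "G (linepath z z' u) = of_int c" by blast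
    define r where "r = linepath z z' u"
    have r: "r \<in> closed_segment z z'" unfolding r_def using u by (simp add: linepath_in_path)
    have "Im r = (1 - u) * Im z + u * Im z'" by (simp add: r_def linepath_def)
    moreover have "(1 - u) * Im z + u * Im z' \<in> {0..1}"
      using convexD_alt[of "{0..1}" "Im z" "Im z'" u] Im u by simp
    ultimately have rs: "r - of_int j \<in> strip A" "r - of_int j1 \<in> strip A"
      using u(3) by (auto simp: strip_shift r_def[symmetric] G_def c_def j1_def split: if_splits)
    have j1: "j1 \<in> copies" "nat \<bar>j1 - j'\<bar> < nat \<bar>j - j'\<bar>"
      using less.prems(1,3) False by (auto simp: j1_def copies_def split: if_splits)
    obtain ps where ps: "chain P (to_surface P (frag j1, r - of_int j1)) ps (to_surface P (frag j', z' - of_int j'))"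
        "chain_len ps \<le> ennreal (dist r z')"
      using less.hyps[OF j1(2,1) rs(2) less.prems(3,4)] by blast
    have "to_surface P (frag j, r - of_int j) = to_surface P (frag j1, r - of_int j1)"
      using lifts_unique[of r] rs less.prems(1) j1(1) unfolding lifts_def by blast
    then have "chain P (to_surface P (frag j, z - of_int j))
        ((frag j, linepath (z - of_int j) (r - of_int j)) # ps) (to_surface P (frag j', z' - of_int j'))"
      using direct[OF rs(1)] ps(1) by simp
    moreover have "chain_len ((frag j, linepath (z - of_int j) (r - of_int j)) # ps) \<le> ennreal (dist z r) + ennreal (dist r z')"
      using direct[OF rs(1)] ps(2) by (simp add: add_mono)
    moreover have "dist z z' = dist z r + dist r z'"
      using r by (simp add: between_mem_segment[symmetric] between)
    ultimately show ?thesis by (intro exI conjI) auto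
  qed
qed

lemma lifts_chain:
  assumes "lifts z s" "lifts z' s'"
  shows "\<exists>ps. ps \<noteq> [] \<and> chain P s ps s' \<and> chain_len ps \<le> ennreal (dist z z')"
  using assms lift_segment_chain unfolding lifts_def by blast

lemma connected_space_surface: "connected_space (surface P)"
proof (rule path_connected_imp_connected_space)
  show "path_connected_space (surface P)"
    unfolding path_connected_space_def
  proof (intro ballI)
    fix s t assume "s \<in> topspace (surface P)" "t \<in> topspace (surface P)"
    then obtain z z' where "lifts z s" "lifts z' t" using lifts_topspace by blast
    then obtain ps where "ps \<noteq> []" "chain P s ps t" using lifts_chain by blast
    then have "path_between P s t (chain_path P ps)" by (intro path_between_chain_path)
    then show "\<exists>g. pathin (surface P) g \<and> g 0 = s \<and> g 1 = t" by (auto simp: path_between_def)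
  qed
qed

text \<open>Each piece is translated into the copy in which the lift built so far ends; translations
  preserve lengths.\<close>

lemma path_lift:
  assumes D: "path_decomposition P \<gamma> ts ps"
  shows "\<exists>g. continuous_on {0..1} g \<and> (\<forall>u\<in>{0..1}. lifts (g u) (\<gamma> u)) \<and>
    curve_length g 0 1 \<le> path_length P \<gamma>"
proof -
  note facts = decomposition_facts[OF D]
  have piece: "fst (ps ! j) < k" "continuous_on {ts ! j..ts ! Suc j} (snd (ps ! j))"
    "\<And>u. u \<in> {ts ! j..ts ! Suc j} \<Longrightarrow> snd (ps ! j) u \<in> strip A \<and> \<gamma> u = to_surface P (fst (ps ! j), snd (ps ! j) u)"
    if "j < length ps" for j
    using D that by (auto simp: path_decomposition_def num_fragments fragment)
  have "\<exists>g. continuous_on {0..ts ! n} g \<and> (\<forall>u\<in>{0..ts ! n}. lifts (g u) (\<gamma> u)) \<and>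
      curve_length g 0 (ts ! n) \<le> (\<Sum>j<n. curve_length (snd (ps ! j)) (ts ! j) (ts ! Suc j))"
    if "n \<le> length ps" for n
    using that
  proof (induction n)
    case 0
    have "0 < length ps" using facts(1) by simp
    from piece[OF this] facts(2) facts(4)[OF this]
    have "lifts (snd (ps ! 0) 0 + of_nat (fst (ps ! 0))) (\<gamma> 0)" using lifts_exists by auto
    then show ?case using facts(2) by (intro exI[of _ "\<lambda>_. snd (ps ! 0) 0 + of_nat (fst (ps ! 0))"])
        (auto simp: curve_length_empty)
  next
    case (Suc n)
    then obtain g where g: "continuous_on {0..ts ! n} g" "\<And>u. u \<in> {0..ts ! n} \<Longrightarrow> lifts (g u) (\<gamma> u)"
      "curve_length g 0 (ts ! n) \<le> (\<Sum>j<n. curve_length (snd (ps ! j)) (ts ! j) (ts ! Suc j))" by auto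
    let ?f = "snd (ps ! n)" and ?a = "ts ! n" and ?b = "ts ! Suc n"
    have n: "n < length ps" using Suc.prems by simp
    have ab: "0 \<le> ?a" "?a < ?b" using facts(4)[OF n] facts(5)[of n] n by auto
    have 1: "lifts (g ?a) (\<gamma> ?a)" by (rule g(2)) (use ab in auto)
    have 2: "\<gamma> ?a = to_surface P (fst (ps ! n), ?f ?a)" using piece(3)[OF n, of ?a] ab by auto
    from lifts_develop[OF 1 2] obtain j where j: "j \<in> copies" "frag j = fst (ps ! n)" "g ?a = ?f ?a + of_int j" by blast
    define h where "h = (\<lambda>u. if u \<le> ?a then g u else ?f u + of_int j)"
    have h2: "h u = ?f u + of_int j" if "u \<in> {?a..?b}" for u
      using that j(3) by (cases "u = ?a") (auto simp: h_def)
    have "continuous_on ({0..?a} \<union> {?a..?b}) h"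
      unfolding h_def
    proof (rule continuous_on_cases)
      show "continuous_on {?a..?b} (\<lambda>u. ?f u + of_int j)" by (intro continuous_intros piece(2)[OF n])
      show "\<forall>x. x \<in> {0..?a} \<and> \<not> x \<le> ?a \<or> x \<in> {?a..?b} \<and> x \<le> ?a \<longrightarrow> g x = ?f x + of_int j"
      proof (intro allI impI)
        fix x assume "x \<in> {0..?a} \<and> \<not> x \<le> ?a \<or> x \<in> {?a..?b} \<and> x \<le> ?a"
        then have "x = ?a" by auto
        then show "g x = ?f x + of_int j" using j(3) by simp
      qed
    qed (use g(1) in auto)
    moreover have "{0..?a} \<union> {?a..?b} = {0..?b}" using ab by auto
    moreover have "lifts (h u) (\<gamma> u)" if "u \<in> {0..?b}" for u
    proof (cases "u \<le> ?a")
      case True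
      then show ?thesis using g(2)[of u] that by (simp add: h_def)
    next
      case False
      then have "u \<in> {?a..?b}" using that by auto
      then show ?thesis unfolding lifts_def using h2 piece(3)[OF n] j(1,2) by (intro bexI[of _ j]) auto
    qed
    moreover have "curve_length h 0 ?b \<le> (\<Sum>j<Suc n. curve_length (snd (ps ! j)) (ts ! j) (ts ! Suc j))"
    proof -
      have "curve_length h 0 ?b \<le> curve_length h 0 ?a + curve_length h ?a ?b"
        using ab by (intro curve_length_subadditive) auto
      also have "curve_length h 0 ?a = curve_length g 0 ?a" by (rule curve_length_cong) (simp add: h_def)
      also have "curve_length h ?a ?b = curve_length ?f ?a ?b"
        by (rule curve_length_dist_cong) (simp add: h2 dist_norm)
      finally show ?thesis using g(3) by (auto intro: order_trans add_right_mono)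
    qed
    ultimately show ?case by (intro exI[of _ h]) auto
  qed
  from this[of "length ps"] show ?thesis using facts(3) by (simp add: path_length_decomposition[OF D])
qed

text \<open>A path of finite length lifts to a curve between lifts of its ends, and a curve is at
  least as long as its chord.\<close>

lemma surface_dist_ge:
  assumes "\<And>z z'. lifts z s \<Longrightarrow> lifts z' t \<Longrightarrow> \<delta> \<le> dist z z'"
  shows "ennreal \<delta> \<le> surface_dist P s t"
  unfolding surface_dist_def
proof (rule INF_greatest)
  fix \<gamma> assume "\<gamma> \<in> {\<gamma>. path_between P s t \<gamma>}"
  then have \<gamma>: "\<gamma> 0 = s" "\<gamma> 1 = t" by (auto simp: path_between_def)
  show "ennreal \<delta> \<le> path_length P \<gamma>"
  proof (cases "path_length P \<gamma> < \<infinity>")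
    case True
    then obtain ts ps where "path_decomposition P \<gamma> ts ps" by (rule finite_path_length_decomposition)
    from path_lift[OF this] obtain g where g: "\<And>u. u \<in> {0..1} \<Longrightarrow> lifts (g u) (\<gamma> u)"
        "curve_length g 0 1 \<le> path_length P \<gamma>" by blast
    have "ennreal \<delta> \<le> ennreal (dist (g 0) (g 1))"
      using assms[of "g 0" "g 1"] g(1)[of 0] g(1)[of 1] \<gamma> by (intro ennreal_leI) auto
    also have "\<dots> \<le> curve_length g 0 1" by (intro dist_le_curve_length) simp
    finally show ?thesis using g(2) by (rule order_trans)
  qed (simp add: less_top[symmetric])
qed

text \<open>The chord between the ends of the lift descends to a path from \<open>s\<close> to
  \<open>t\<close>, so the lift is no longer than its chord. Any other pair of lifts gives a
  competitor in the same way.\<close>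

lemma shortest_path_lift:
  assumes "shortest_path P s t \<gamma>"
  shows "\<exists>g. (\<forall>u\<in>{0..1}. lifts (g u) (\<gamma> u)) \<and> g ` {0..1} = closed_segment (g 0) (g 1) \<and>
    (\<forall>z z'. lifts z s \<longrightarrow> lifts z' t \<longrightarrow> dist (g 0) (g 1) \<le> dist z z')"
proof -
  have \<gamma>: "path_length P \<gamma> = surface_dist P s t" "path_length P \<gamma> < \<infinity>" "\<gamma> 0 = s" "\<gamma> 1 = t"
    using assms by (auto simp: shortest_path_def path_between_def)
  obtain ts ps where "path_decomposition P \<gamma> ts ps" using finite_path_length_decomposition[OF \<gamma>(2)] .
  from path_lift[OF this] obtain g where g: "continuous_on {0..1} g" "\<forall>u\<in>{0..1}. lifts (g u) (\<gamma> u)"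
      "curve_length g 0 1 \<le> surface_dist P s t" using \<gamma>(1) by auto
  have le: "surface_dist P s t \<le> ennreal (dist z z')" if z: "lifts z s" "lifts z' t" for z z'
  proof -
    obtain qs where "qs \<noteq> []" "chain P s qs t" "chain_len qs \<le> ennreal (dist z z')"
      using lifts_chain[OF z] by blast
    then show ?thesis using surface_dist_le_chain order_trans by blast
  qed
  have ends: "lifts (g 0) s" "lifts (g 1) t" using g(2) \<gamma>(3,4) by auto
  have "curve_length g 0 1 \<le> ennreal (dist (g 0) (g 1))"
    using g(3) le[OF ends] by (rule order_trans)
  then have "g ` {0..1} = closed_segment (g 0) (g 1)"
    using curve_length_straight[of 0 1 g] g(1) by simp
  moreover have "dist (g 0) (g 1) \<le> dist z z'" if z: "lifts z s" "lifts z' t" for z z'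
  proof -
    have "ennreal (dist (g 0) (g 1)) \<le> curve_length g 0 1" by (intro dist_le_curve_length) simp
    also have "\<dots> \<le> ennreal (dist z z')" using g(3) le[OF z] by (rule order_trans)
    finally show ?thesis by (simp add: ennreal_le_iff)
  qed
  ultimately show ?thesis using g(2) by blast
qed

lemma fragment_part_lift:
  assumes i: "i < k" and g: "\<And>u. u \<in> {0..1} \<Longrightarrow> lifts (g u) (\<gamma> u)" "g ` {0..1} = closed_segment a b"
  shows "fragment_part P i \<gamma> = (\<Union>j\<in>{j \<in> copies. frag j = i \<and> (\<exists>z\<in>closed_segment a b. z - of_int j \<in> strip A)}.
    (\<lambda>z. z - of_int j) ` closed_segment a b \<inter> strip A)"
proof (intro equalityI subsetI)
  fix x assume "x \<in> fragment_part P i \<gamma>"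
  then obtain u where u: "u \<in> {0..1}" "x \<in> strip A" "\<gamma> u = to_surface P (i, x)"
    by (auto simp: fragment_part_def fragment[OF i])
  from lifts_develop[OF g(1)[OF u(1)] u(3)] obtain j where j: "j \<in> copies" "frag j = i" "g u = x + of_int j" by blast
  have "g u \<in> closed_segment a b" using u(1) g(2) by auto
  then show "x \<in> (\<Union>j\<in>{j \<in> copies. frag j = i \<and> (\<exists>z\<in>closed_segment a b. z - of_int j \<in> strip A)}.
    (\<lambda>z. z - of_int j) ` closed_segment a b \<inter> strip A)"
    using j u(2) by (intro UN_I[of j]) (auto intro!: image_eqI[of _ _ "g u"] bexI[of _ "g u"])
next
  fix x assume "x \<in> (\<Union>j\<in>{j \<in> copies. frag j = i \<and> (\<exists>z\<in>closed_segment a b. z - of_int j \<in> strip A)}.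
    (\<lambda>z. z - of_int j) ` closed_segment a b \<inter> strip A)"
  then obtain j z where j: "j \<in> copies" "frag j = i" "z \<in> closed_segment a b" "x = z - of_int j" "x \<in> strip A" by blast
  then obtain u where u: "u \<in> {0..1}" "z = g u" using g(2) by blast
  have "lifts z (to_surface P (i, x))" using j by (auto simp: lifts_def)
  then have "to_surface P (i, x) = \<gamma> u" using lifts_unique g(1)[OF u(1)] u(2) by blast
  then show "x \<in> fragment_part P i \<gamma>" using u(1) j(5) by (auto simp: fragment_part_def fragment[OF i])
qed

text \<open>Each copy of the fragment that the segment meets contributes a convex, hence connected,
  set.\<close>

lemma num_components_lift:
  assumes "i < k" "\<And>u. u \<in> {0..1} \<Longrightarrow> lifts (g u) (\<gamma> u)" "g ` {0..1} = closed_segment a b"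
    and "finite {j \<in> copies. frag j = i \<and> (\<exists>z\<in>closed_segment a b. z - of_int j \<in> strip A)}"
    and "card {j \<in> copies. frag j = i \<and> (\<exists>z\<in>closed_segment a b. z - of_int j \<in> strip A)} \<le> h"
  shows "num_components (fragment_part P i \<gamma>) \<le> enat h"
proof -
  let ?J = "{j \<in> copies. frag j = i \<and> (\<exists>z\<in>closed_segment a b. z - of_int j \<in> strip A)}"
  have conn: "connected ((\<lambda>z. z - of_int j) ` closed_segment a b \<inter> strip A)" for j
  proof -
    have "(\<lambda>z. z - of_int j) ` closed_segment a b = (+) (- of_int j) ` closed_segment a b" by auto
    then have "convex ((\<lambda>z. z - of_int j) ` closed_segment a b)" using convex_translation by simp
    then show ?thesis using convex_strip by (intro convex_connected convex_Int)
  qed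
  have "fragment_part P i \<gamma> = (\<Union>j\<in>?J. (\<lambda>z. z - of_int j) ` closed_segment a b \<inter> strip A)"
    using assms(1-3) by (rule fragment_part_lift)
  also have "num_components \<dots> \<le> enat (card ?J)"
    by (rule num_components_Union_le[OF assms(4) conn])
  finally show ?thesis using assms(5) order_trans enat_ord_simps(1) by blast
qed

end

section \<open>Lower bounds for the complexity of a path\<close>

lemma straight_piece_point:
  assumes "straight_piece P \<gamma> i x a y b" "u \<in> {a..b}"
  obtains l where "0 \<le> l" "l \<le> 1" "\<gamma> u = to_surface P (i, linepath x y l)"
    "u = a \<Longrightarrow> l = 0" "u = b \<Longrightarrow> l = 1"
proof -
  obtain \<phi> where \<phi>: "mono_on {a..b} \<phi>" "\<phi> a = 0" "\<phi> b = 1"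
      "\<forall>u\<in>{a..b}. \<gamma> u = to_surface P (i, linepath x y (\<phi> u))"
    using assms(1) by (auto simp: straight_piece_def)
  have "\<phi> a \<le> \<phi> u" "\<phi> u \<le> \<phi> b" using assms(2) by (auto intro!: mono_onD[OF \<phi>(1)])
  then show ?thesis using that[of "\<phi> u"] \<phi> assms(2) by auto
qed

lemma straight_piece_surj:
  assumes "straight_piece P \<gamma> i x a y b" "0 \<le> l" "l \<le> 1"
  obtains u where "u \<in> {a..b}" "\<gamma> u = to_surface P (i, linepath x y l)"
proof -
  obtain \<phi> where \<phi>: "continuous_on {a..b} \<phi>" "\<phi> a = 0" "\<phi> b = 1"
      "\<forall>u\<in>{a..b}. \<gamma> u = to_surface P (i, linepath x y (\<phi> u))"
    using assms(1) by (auto simp: straight_piece_def)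
  have "a < b" using assms(1) by (simp add: straight_piece_def)
  then have "\<exists>u\<ge>a. u \<le> b \<and> \<phi> u = l" using \<phi> assms(2,3) by (intro IVT') auto
  then show ?thesis using that \<phi>(4) by auto
qed

lemma crosses_less: "crosses P \<gamma> i x a b E \<Longrightarrow> a < b"
  by (induction rule: crosses.induct) (auto simp: straight_piece_def)

lemma describes_pieces:
  assumes "describes P vs Es \<gamma>"
  obtains ts where "ts ! 0 = (0::real)" "ts ! length Es = 1" "Es \<noteq> []" "length vs = Suc (length Es)"
    "\<And>j. j < length vs \<Longrightarrow> vs ! j = \<gamma> (ts ! j)"
    "\<And>j. j < length Es \<Longrightarrow> 0 \<le> ts ! j \<and> ts ! Suc j \<le> 1 \<and> (\<exists>i x. crosses P \<gamma> i x (ts ! j) (ts ! Suc j) (Es ! j))"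
proof -
  obtain ts where ts: "length vs = Suc (length Es)" "length ts = length vs" "hd ts = 0" "last ts = 1"
      "sorted_wrt (<) ts" "\<forall>j<length vs. vs ! j = \<gamma> (ts ! j)"
      "\<forall>j<length Es. \<exists>i x. crosses P \<gamma> i x (ts ! j) (ts ! Suc j) (Es ! j)"
    using assms by (auto simp: describes_def)
  have ne: "ts \<noteq> []" using ts(1,2) by auto
  have t0: "ts ! 0 = 0" and t1: "ts ! length Es = 1"
    using ts ne by (simp_all add: hd_conv_nth last_conv_nth)
  have less: "ts ! j < ts ! l" if "j < l" "l \<le> length Es" for j l
    using that ts by (simp add: sorted_wrt_iff_nth_less)
  have range: "0 \<le> ts ! j" "ts ! j \<le> 1" if "j \<le> length Es" for j
    using less[of 0 j] less[of j "length Es"] t0 t1 that by (cases "j = 0"; cases "j = length Es"; force)+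
  have "Es \<noteq> []" using t0 t1 by auto
  then show ?thesis using that[OF t0 t1 _ ts(1)] ts(6,7) range by simp
qed

context valid_portalgon
begin

lemma straight_piece_vertices:
  assumes "straight_piece P \<gamma> i x a y b" "u \<in> {a..b}" "\<gamma> u \<in> surface_vertices P"
  shows "\<gamma> u = \<gamma> a \<or> \<gamma> u = \<gamma> b"
proof -
  have ab: "a \<in> {a..b}" "b \<in> {a..b}" using assms(2) by auto
  have ends: "\<gamma> a = to_surface P (i, x)" "\<gamma> b = to_surface P (i, y)"
    using straight_piece_point[OF assms(1) ab(1)] straight_piece_point[OF assms(1) ab(2)]
    by (metis linepath_0', metis linepath_1')
  obtain l where l: "0 \<le> l" "l \<le> 1" "\<gamma> u = to_surface P (i, linepath x y l)"
    using straight_piece_point[OF assms(1,2)] by metis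
  have "linepath x y l \<notin> open_segment x y" using assms(1,3) l(3) by (auto simp: straight_piece_def)
  moreover have "linepath x y l \<in> closed_segment x y" using l by (simp add: linepath_in_path)
  ultimately have "linepath x y l = x \<or> linepath x y l = y" by (auto simp: open_segment_def)
  then show ?thesis using l(3) ends by auto
qed

text \<open>Crossings happen in relative interiors of edges and straight pieces have no vertices
  inside, so a vertex can occur only at the ends of the stretch.\<close>

lemma crosses_vertices:
  "crosses P \<gamma> i x a b E \<Longrightarrow> u \<in> {a..b} \<Longrightarrow> \<gamma> u \<in> surface_vertices P \<Longrightarrow> \<gamma> u = \<gamma> a \<or> \<gamma> u = \<gamma> b"
proof (induction arbitrary: u rule: crosses.induct)
  case (stay i x a y b)
  then show ?case using straight_piece_vertices by blast
next
  case (cross e e' l x a c b E)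
  have c: "c \<in> {a..c}" using cross.hyps(4) by (simp add: straight_piece_def)
  obtain l' where "\<gamma> c = to_surface P (frag_of e, linepath x (edge_point P e l) l')" "l' = 1"
    using straight_piece_point[OF cross.hyps(4) c] by metis
  then have gc: "\<gamma> c = to_surface P (frag_of e, edge_point P e l)" by (simp add: linepath_1')
  have e: "is_edge P e" by (rule portal_edges(1)[OF cross.hyps(1)])
  have nv: "\<gamma> c \<notin> surface_vertices P"
    unfolding gc using surface_vertex_iff[OF edge_fragment[OF e]] edge_point_not_vertex[OF e cross.hyps(2,3)] by simp
  show ?case
  proof (cases "u \<le> c")
    case True
    then have "u \<in> {a..c}" using cross.prems(1) by simp
    from straight_piece_vertices[OF cross.hyps(4) this cross.prems(2)] nv cross.prems(2)
    show ?thesis by metis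
  next
    case False
    then have "u \<in> {c..b}" using cross.prems(1) by simp
    from cross.IH[OF this cross.prems(2)] nv cross.prems(2) show ?thesis by metis
  qed
qed

text \<open>By \<open>crosses_vertices\<close>, every vertex on the path is an entry of the vertex
  list of each description.\<close>

lemma path_complexity_ge_vertices:
  "enat (card (surface_vertices P \<inter> \<gamma> ` {0..1})) \<le> path_complexity P \<gamma>"
  unfolding path_complexity_def
proof (rule INF_greatest, clarify)
  fix vs Es assume d: "describes P vs Es \<gamma>"
  obtain ts where ts: "ts ! 0 = (0::real)" "ts ! length Es = 1" "Es \<noteq> []" "length vs = Suc (length Es)"
    "\<And>j. j < length vs \<Longrightarrow> vs ! j = \<gamma> (ts ! j)"
    "\<And>j. j < length Es \<Longrightarrow> 0 \<le> ts ! j \<and> ts ! Suc j \<le> 1 \<and> (\<exists>i x. crosses P \<gamma> i x (ts ! j) (ts ! Suc j) (Es ! j))"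
    using describes_pieces[OF d] by metis
  have "surface_vertices P \<inter> \<gamma> ` {0..1} \<subseteq> set vs"
  proof
    fix v assume "v \<in> surface_vertices P \<inter> \<gamma> ` {0..1}"
    then obtain u where u: "u \<in> {0..1}" "v = \<gamma> u" "\<gamma> u \<in> surface_vertices P" by auto
    obtain j where j: "j < length Es" "ts ! j \<le> u" "u \<le> ts ! Suc j"
      using strict_partition_cover[of "\<lambda>j. ts ! j" u "length Es"] ts(1-3) u(1) by auto
    obtain i x where "crosses P \<gamma> i x (ts ! j) (ts ! Suc j) (Es ! j)" using ts(6)[OF j(1)] by blast
    then have "\<gamma> u = \<gamma> (ts ! j) \<or> \<gamma> u = \<gamma> (ts ! Suc j)" using crosses_vertices u(3) j by auto
    then have "v = vs ! j \<or> v = vs ! Suc j" using ts(4,5) j(1) u(2) by auto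
    then show "v \<in> set vs" using j(1) ts(4) by auto
  qed
  then have "card (surface_vertices P \<inter> \<gamma> ` {0..1}) \<le> card (set vs)" by (intro card_mono) auto
  also have "\<dots> \<le> length vs + (\<Sum>E\<leftarrow>Es. length E)" using card_length[of vs] by simp
  finally show "enat (card (surface_vertices P \<inter> \<gamma> ` {0..1})) \<le> enat (length vs + (\<Sum>E\<leftarrow>Es. length E))" by simp
qed

end

lemma crosses_card:
  assumes sp: "\<And>i x a y b. straight_piece P \<gamma> i x a y b \<Longrightarrow> 0 \<le> a \<Longrightarrow> b \<le> 1 \<Longrightarrow>
      card {r. r < R \<and> (\<exists>u\<in>{a..b}. T r u)} \<le> 1"
  shows "crosses P \<gamma> i x a b E \<Longrightarrow> 0 \<le> a \<Longrightarrow> b \<le> 1 \<Longrightarrow>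
    card {r::nat. r < R \<and> (\<exists>u\<in>{a..b::real}. T r u)} \<le> Suc (length E)"
proof (induction rule: crosses.induct)
  case (stay i x a y b)
  then show ?case using sp by fastforce
next
  case (cross e e' l x a c b E)
  have ac: "a < c" "c < b" using cross.hyps(4) crosses_less[OF cross.hyps(5)] by (auto simp: straight_piece_def)
  let ?S = "\<lambda>a b. {r. r < R \<and> (\<exists>u\<in>{a..b}. T r u)}"
  have "?S a b \<subseteq> ?S a c \<union> ?S c b"
  proof clarify
    fix r u assume "u \<in> {a..b}" "T r u" "\<not> (\<exists>u\<in>{c..b}. T r u)"
    moreover from this have "u \<in> {a..c}" by (cases "u \<le> c") auto
    ultimately show "\<exists>u\<in>{a..c}. T r u" by blast
  qed
  then have "card (?S a b) \<le> card (?S a c \<union> ?S c b)" by (intro card_mono) auto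
  also have "\<dots> \<le> card (?S a c) + card (?S c b)" by (rule card_Un_le)
  also have "\<dots> \<le> 1 + Suc (length E)"
    using sp[OF cross.hyps(4)] cross.IH cross.prems ac by (intro add_mono) auto
  finally show ?case by simp
qed

text \<open>Read \<open>T r u\<close> as: test \<open>r\<close> is passed at time \<open>u\<close>.
  A description has one straight piece per stretch and one more per crossing, fewer in all than its
  complexity, and a piece passes at most one test.\<close>

lemma path_complexity_ge_tests:
  assumes sp: "\<And>i x a y b. straight_piece P \<gamma> i x a y b \<Longrightarrow> 0 \<le> a \<Longrightarrow> b \<le> 1 \<Longrightarrow>
      card {r. r < R \<and> (\<exists>u\<in>{a..b}. T r u)} \<le> 1"
    and all: "\<And>r. r < R \<Longrightarrow> \<exists>u\<in>{0..1::real}. T r u"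
  shows "enat R \<le> path_complexity P \<gamma>"
  unfolding path_complexity_def
proof (rule INF_greatest, clarify)
  fix vs Es assume d: "describes P vs Es \<gamma>"
  obtain ts where ts: "ts ! 0 = (0::real)" "ts ! length Es = 1" "Es \<noteq> []" "length vs = Suc (length Es)"
    "\<And>j. j < length vs \<Longrightarrow> vs ! j = \<gamma> (ts ! j)"
    "\<And>j. j < length Es \<Longrightarrow> 0 \<le> ts ! j \<and> ts ! Suc j \<le> 1 \<and> (\<exists>i x. crosses P \<gamma> i x (ts ! j) (ts ! Suc j) (Es ! j))"
    using describes_pieces[OF d] by metis
  let ?S = "\<lambda>a b. {r. r < R \<and> (\<exists>u\<in>{a..b}. T r u)}"
  have cc: "card (?S a b) \<le> Suc (length E)" if "crosses P \<gamma> i x a b E" "0 \<le> a" "b \<le> 1" for i x a b E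
    by (rule crosses_card[of P \<gamma> R T, OF _ that]) (rule sp)
  have "{..<R} \<subseteq> (\<Union>j<length Es. ?S (ts ! j) (ts ! Suc j))"
  proof
    fix r assume "r \<in> {..<R}"
    then have "r < R" by simp
    from all[OF this] \<open>r < R\<close> obtain u where u: "r < R" "u \<in> {0..1}" "T r u" by blast
    obtain j where "j < length Es" "ts ! j \<le> u" "u \<le> ts ! Suc j"
      using strict_partition_cover[of "\<lambda>j. ts ! j" u "length Es"] ts(1-3) u(2) by auto
    then show "r \<in> (\<Union>j<length Es. ?S (ts ! j) (ts ! Suc j))"
      using u by (intro UN_I[of j]) (auto intro!: bexI[of _ u])
  qed
  then have "card {..<R} \<le> card (\<Union>j<length Es. ?S (ts ! j) (ts ! Suc j))" by (intro card_mono) auto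
  also have "\<dots> \<le> (\<Sum>j<length Es. card (?S (ts ! j) (ts ! Suc j)))" by (intro card_UN_le) auto
  also have "\<dots> \<le> (\<Sum>j<length Es. Suc (length (Es ! j)))"
  proof (rule sum_mono)
    fix j assume "j \<in> {..<length Es}"
    then obtain i x where "crosses P \<gamma> i x (ts ! j) (ts ! Suc j) (Es ! j)" "0 \<le> ts ! j" "ts ! Suc j \<le> 1"
      using ts(6) by blast
    then show "card (?S (ts ! j) (ts ! Suc j)) \<le> Suc (length (Es ! j))"
      using cc by blast
  qed
  also have "\<dots> = length Es + (\<Sum>E\<leftarrow>Es. length E)"
  proof -
    have "(\<Sum>j<length Es. Suc (length (Es ! j))) = (\<Sum>j<length Es. 1 + length (Es ! j))" by simp
    also have "\<dots> = (\<Sum>j<length Es. 1) + (\<Sum>j<length Es. length (Es ! j))" by (rule sum.distrib)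
    finally show ?thesis by (simp add: sum_list_sum_nth atLeast0LessThan)
  qed
  also have "\<dots> \<le> length vs + (\<Sum>E\<leftarrow>Es. length E)" using ts(4) by simp
  finally show "enat R \<le> enat (length vs + (\<Sum>E\<leftarrow>Es. length E))" by simp
qed

text \<open>Complexities are elements of the well-ordered type \<open>enat\<close>, so a minimum is
  attained, infinite or not.\<close>

lemma exists_min_complexity_shortest_path:
  assumes "shortest_path P s t \<gamma>"
  shows "\<exists>\<gamma>. min_complexity_shortest_path P s t \<gamma>"
proof -
  have "\<exists>n. \<exists>\<gamma>. shortest_path P s t \<gamma> \<and> path_complexity P \<gamma> = n" using assms by blast
  then obtain n where n: "\<exists>\<gamma>. shortest_path P s t \<gamma> \<and> path_complexity P \<gamma> = n"
      "\<forall>m<n. \<not> (\<exists>\<gamma>. shortest_path P s t \<gamma> \<and> path_complexity P \<gamma> = m)"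
    using exists_least_iff[of "\<lambda>n. \<exists>\<gamma>. shortest_path P s t \<gamma> \<and> path_complexity P \<gamma> = n"] by blast
  then show ?thesis unfolding min_complexity_shortest_path_def by (metis not_le)
qed

section \<open>Happiness and long paths of the strip portalgons\<close>

context strips
begin

text \<open>In a row each fragment has a single copy in the plane, which the straight lift meets in
  a convex set.\<close>

lemma happy_open:
  assumes "\<not> cyclic" "1 \<le> h"
  shows "happy h P"
proof (rule happyI)
  fix s t \<gamma> i assume sp: "shortest_path P s t \<gamma>" and i: "i < num_fragments P"
  obtain g where g: "\<And>u. u \<in> {0..1} \<Longrightarrow> lifts (g u) (\<gamma> u)" "g ` {0..1} = closed_segment (g 0) (g 1)"
    using shortest_path_lift[OF sp] by blast
  let ?J = "{j \<in> copies. frag j = i \<and> (\<exists>z\<in>closed_segment (g 0) (g 1). z - of_int j \<in> strip A)}"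
  have "?J \<subseteq> {int i}"
  proof
    fix j assume "j \<in> ?J"
    then have "frag j = i" "j \<in> {0..<int k}" using assms(1) unfolding copies_def by auto
    then show "j \<in> {int i}" by (auto simp: frag_def)
  qed
  then have "finite ?J" "card ?J \<le> h"
    using assms(2) card_mono[of "{int i}" ?J] by (auto intro: finite_subset)
  moreover have "i < k" using i by (simp add: num_fragments)
  ultimately show "num_components (fragment_part P i \<gamma>) \<le> enat h"
    using num_components_lift[of i g \<gamma> "g 0" "g 1"] g by blast
qed

lemma lifts_Im: "lifts z s \<Longrightarrow> 0 \<le> Im z \<and> Im z \<le> 1"
  by (auto simp: lifts_def strip_def)

text \<open>A shortest path goes around the annulus at most half a time more than the strips do.\<close>

lemma happy_cyclic:
  assumes cyc: "cyclic" and A: "A = real (k * B)" and h: "B + 2 \<le> h"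
  shows "happy h P"
proof (rule happyI)
  fix s t \<gamma> i assume sp: "shortest_path P s t \<gamma>" and "i < num_fragments P"
  then have i: "i < k" by (simp add: num_fragments)
  obtain g where g: "\<And>u. u \<in> {0..1} \<Longrightarrow> lifts (g u) (\<gamma> u)" "g ` {0..1} = closed_segment (g 0) (g 1)"
      "\<And>z z'. lifts z s \<Longrightarrow> lifts z' t \<Longrightarrow> dist (g 0) (g 1) \<le> dist z z'"
    using shortest_path_lift[OF sp] by blast
  have ends: "lifts (g 0) s" "lifts (g 1) t"
    using g(1)[of 0] g(1)[of 1] sp by (auto simp: shortest_path_def path_between_def)
  define G where "G = (\<lambda>w. Re w - A * Im w)"
  define m where "m = min (G (g 0)) (G (g 1))"
  define M where "M = max (G (g 0)) (G (g 1))"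
  have k0: "real k > 0" using k by simp
  have Re: "\<bar>Re (g 0) - Re (g 1)\<bar> \<le> real k / 2"
  proof -
    \<comment> \<open>Translating a lift of \<open>t\<close> by a multiple of \<open>k\<close>
      changes only its real part, and the nearest translate is at horizontal distance at most
      \<open>k / 2\<close>.\<close>
    define n where "n = round ((Re (g 0) - Re (g 1)) / k)"
    have "dist (g 0) (g 1) \<le> dist (g 0) (g 1 + of_int (int k * n))"
      using g(3)[OF ends(1) lifts_translate[OF cyc ends(2)]] .
    then have "cmod (g 0 - g 1) \<le> cmod (g 0 - (g 1 + of_int (int k * n)))" by (simp add: dist_norm)
    then have 1: "\<bar>Re (g 0 - g 1)\<bar> \<le> \<bar>Re (g 0 - (g 1 + of_int (int k * n)))\<bar>"
      by (subst (asm) cmod_Re_le_iff) auto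
    have "\<bar>of_int n - (Re (g 0) - Re (g 1)) / k\<bar> \<le> 1 / 2"
      unfolding n_def by (rule of_int_round_abs_le)
    then have 2: "\<bar>real k * (of_int n - (Re (g 0) - Re (g 1)) / k)\<bar> \<le> real k * (1 / 2)"
      unfolding abs_mult by (intro mult_mono) auto
    have 3: "real k * (of_int n - (Re (g 0) - Re (g 1)) / k) = - Re (g 0 - (g 1 + of_int (int k * n)))"
      using k0 by (simp add: right_diff_distrib diff_divide_distrib)
    show ?thesis using order_trans[OF 1 2[unfolded 3 abs_minus_cancel]] by simp
  qed
  have "\<bar>A * (Im (g 0) - Im (g 1))\<bar> \<le> A * 1"
    unfolding abs_mult using lifts_Im[OF ends(1)] lifts_Im[OF ends(2)] A by (intro mult_mono) auto
  moreover have "G (g 0) - G (g 1) = (Re (g 0) - Re (g 1)) - A * (Im (g 0) - Im (g 1))"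
    by (simp add: G_def algebra_simps)
  ultimately have "\<bar>G (g 0) - G (g 1)\<bar> \<le> real k / 2 + A"
    using Re abs_triangle_ineq4[of "Re (g 0) - Re (g 1)" "A * (Im (g 0) - Im (g 1))"] by simp
  then have mM: "M - m \<le> real k / 2 + A" by (simp add: m_def M_def min_def max_def abs_if split: if_splits)
  let ?J = "{j \<in> copies. frag j = i \<and> (\<exists>z\<in>closed_segment (g 0) (g 1). z - of_int j \<in> strip A)}"
  \<comment> \<open>The copies of fragment \<open>i\<close> have index \<open>k * q + i\<close>; the
    range of \<open>G\<close> on the segment confines \<open>q\<close> to
    \<open>{a..b}\<close>.\<close>
  define a where "a = \<lceil>(m - 1 - i) / k\<rceil>"
  define b where "b = \<lfloor>(M - i) / k\<rfloor>"
  have J: "j div int k \<in> {a..b} \<and> j = int k * (j div int k) + int i" if j: "j \<in> ?J" for j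
  proof -
    obtain z where z: "z \<in> closed_segment (g 0) (g 1)" "z - of_int j \<in> strip A" "frag j = i" using j by blast
    obtain u where u: "0 \<le> u" "u \<le> 1" "z = (1 - u) *\<^sub>R g 0 + u *\<^sub>R g 1" using z(1) by (auto simp: in_segment)
    have "G z = (1 - u) * G (g 0) + u * G (g 1)" unfolding u(3) by (simp add: G_def algebra_simps)
    moreover have "(1 - u) * G (g 0) + u * G (g 1) \<in> {m..M}"
      using convexD_alt[of "{m..M}" "G (g 0)" "G (g 1)" u] u(1,2) by (simp add: m_def M_def)
    ultimately have Gz: "m \<le> G z" "G z \<le> M" by auto
    have "j mod int k = int i" using z(3) k by (auto simp: frag_def)
    then have eq: "j = int k * (j div int k) + int i" by (metis mult_div_mod_eq)
    define q where "q = j div int k"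
    have "real_of_int j = real k * of_int q + real i" using eq unfolding q_def[symmetric] by simp
    moreover have "of_int j \<le> G z" "G z \<le> of_int j + 1" using z(2) by (auto simp: strip_shift G_def)
    ultimately have "m - 1 - i \<le> of_int q * real k" "of_int q * real k \<le> M - i" using Gz by (auto simp: mult.commute)
    then have "(m - 1 - i) / k \<le> of_int q" "of_int q \<le> (M - i) / k" using k0 by (simp_all add: field_simps)
    then have "q \<in> {a..b}" unfolding a_def b_def by (simp add: ceiling_le_iff le_floor_iff)
    then show ?thesis using eq q_def by blast
  qed
  have inj: "inj_on (\<lambda>j. j div int k) ?J"
  proof (rule inj_onI)
    fix j j' assume "j \<in> ?J" "j' \<in> ?J" and eq: "j div int k = j' div int k"
    then have "j = int k * (j div int k) + int i" "j' = int k * (j' div int k) + int i" using J by blast+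
    then show "j = j'" using eq by simp
  qed
  have sub: "(\<lambda>j. j div int k) ` ?J \<subseteq> {a..b}" using J by blast
  have "card ?J \<le> card {a..b}" using card_inj_on_le[OF inj sub] by simp
  moreover have "card {a..b} \<le> B + 2"
  proof -
    have "of_int b \<le> (M - i) / k" "(m - 1 - i) / k \<le> of_int a" by (auto simp: a_def b_def)
    then have "of_int b - of_int a \<le> (M - i) / k - (m - 1 - i) / k" by linarith
    also have "\<dots> = (M - m + 1) / k" by (simp add: diff_divide_distrib[symmetric])
    also have "\<dots> \<le> (real k / 2 + A + real k) / k"
      using mM k by (intro divide_right_mono) auto
    \<comment> \<open>As \<open>b - a\<close> is an integer, it is at most \<open>B + 1\<close>, so
      \<open>{a..b}\<close> has at most \<open>B + 2\<close> elements.\<close>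
    also have "\<dots> = real B + 3 / 2" using k0 by (simp add: A field_simps)
    finally have "b - a < int B + 2" by linarith
    then show ?thesis by simp
  qed
  moreover have "finite ?J" using inj_on_finite[OF inj sub] by simp
  ultimately show "num_components (fragment_part P i \<gamma>) \<le> enat h"
    using num_components_lift[of i g \<gamma> "g 0" "g 1" h] g(1,2) i h by force
qed

lemma shortest_path_exists:
  assumes "lifts z s" "lifts z' t" "\<And>w w'. lifts w s \<Longrightarrow> lifts w' t \<Longrightarrow> dist z z' \<le> dist w w'"
  shows "\<exists>\<gamma>. shortest_path P s t \<gamma>"
proof -
  obtain ps where ps: "ps \<noteq> []" "chain P s ps t" "chain_len ps \<le> ennreal (dist z z')"
    using lifts_chain[OF assms(1,2)] by blast
  have "ennreal (dist z z') \<le> surface_dist P s t" by (rule surface_dist_ge) (rule assms(3))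
  then have "chain_len ps \<le> surface_dist P s t" using ps(3) by (rule order_trans[rotated])
  moreover have "chain_len ps < \<infinity>" using ps(3) by (rule order_le_less_trans) simp
  ultimately show ?thesis using shortest_chain_path[OF ps(2,1)] by blast
qed

lemma lifts_in_topspace: "lifts z s \<Longrightarrow> s \<in> topspace (surface P)"
  using frag_less fragment[OF frag_less] unfolding lifts_def topspace_surface num_fragments by blast

text \<open>Every surface point has just one lift here, so a shortest path follows the bottom from
  \<open>0\<close> to \<open>k\<close> and passes all vertices on it.\<close>

lemma open_lower_bound:
  assumes op: "\<not> cyclic" and A: "A = 0"
  defines "s \<equiv> to_surface P (0, 0)" and "t \<equiv> to_surface P (k - 1, 1)"
  shows "s \<in> topspace (surface P)" "t \<in> topspace (surface P)" "\<exists>\<gamma>. shortest_path P s t \<gamma>"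
    "\<And>\<gamma>. shortest_path P s t \<gamma> \<Longrightarrow> enat (k + N + 1) \<le> path_complexity P \<gamma>"
proof -
  have real_strip: "of_real x \<in> strip A" if "0 \<le> x" "x \<le> 1" for x
    using that A by (simp add: strip_def)
  have ls: "lifts 0 s" using lifts_exists[of 0 0] k real_strip[of 0] by (simp add: s_def)
  have lt: "lifts (of_nat k) t"
    using lifts_exists[of "k - 1" 1] k real_strip[of 1] by (simp add: t_def of_nat_diff)
  show "s \<in> topspace (surface P)" "t \<in> topspace (surface P)" using ls lt lifts_in_topspace by auto
  have fiber: "z = z'" if "lifts z v" "lifts z' v" for z z' v
    using lifts_fiber[OF that] op by auto
  show "\<exists>\<gamma>. shortest_path P s t \<gamma>"
  proof (rule shortest_path_exists[OF ls lt])
    fix w w' assume "lifts w s" "lifts w' t"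
    then have "w = 0" "w' = of_nat k" using fiber[OF _ ls] fiber[OF _ lt] by blast+
    then show "dist 0 (of_nat k :: complex) \<le> dist w w'" by simp
  qed
  fix \<gamma> assume sp: "shortest_path P s t \<gamma>"
  obtain g where g: "\<And>u. u \<in> {0..1} \<Longrightarrow> lifts (g u) (\<gamma> u)" "g ` {0..1} = closed_segment (g 0) (g 1)"
    using shortest_path_lift[OF sp] by blast
  have "\<gamma> 0 = s" "\<gamma> 1 = t" using sp by (auto simp: shortest_path_def path_between_def)
  then have ends: "g 0 = 0" "g 1 = of_nat k"
    using g(1)[of 0] g(1)[of 1] fiber[OF ls] fiber[OF lt] by auto
  let ?S = "surface_vertices P \<inter> \<gamma> ` {0..1}"
  \<comment> \<open>Abscissae of the bottom vertices: \<open>N + 1\<close> of them to the left of 1,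
    in the first square, and then the right corners of all \<open>k\<close> squares.\<close>
  define Z where "Z = (\<lambda>r. real r / real (Suc N)) ` {0..N} \<union> real ` {1..k}"
  have ex: "\<exists>v. v \<in> ?S \<and> lifts (of_real x) v" if x: "x \<in> Z" for x
  proof -
    have "\<exists>v. v \<in> surface_vertices P \<and> lifts (of_real x) v"
    proof (cases "x \<in> real ` {1..k}")
      case True
      then obtain q where q: "1 \<le> q" "q \<le> k" "x = real q" by auto
      have i: "q - 1 < k" using q by simp
      have "1 \<in> set (fragments P ! (q - 1))" using i by (simp add: fragments_nth strip_polygon_def)
      then have "to_surface P (q - 1, 1) \<in> surface_vertices P"
        using surface_vertex_iff[of "q - 1" 1] i by (simp add: num_fragments)
      moreover have "lifts (of_real x) (to_surface P (q - 1, 1))"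
        using lifts_exists[OF i, of 1] real_strip[of 1] q by (simp add: of_nat_diff)
      ultimately show ?thesis by blast
    next
      case False
      then obtain r where r: "r \<le> N" "x = real r / real (Suc N)" using x by (auto simp: Z_def)
      have "fragments P ! 0 \<noteq> []" using k by (simp add: fragments_nth strip_polygon_def)
      then have "of_real x \<in> set (fragments P ! 0)"
        using poly_vertex_in_set[of "fragments P ! 0" "3 + r"] strip_polygon_vertex(4)[of r N A] r k
        by (simp add: fragments_nth)
      then have "to_surface P (0, of_real x) \<in> surface_vertices P"
        using surface_vertex_iff[of 0 "of_real x"] k by (simp add: num_fragments)
      moreover have "lifts (of_real x) (to_surface P (0, of_real x))"
        using lifts_exists[of 0 "of_real x"] real_strip[of x] r k by simp
      ultimately show ?thesis by blast
    qed
    then obtain v where v: "v \<in> surface_vertices P" "lifts (of_real x) v" by blast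
    have "0 \<le> x" "x \<le> real k"
    proof -
      consider r where "r \<le> N" "x = real r / real (Suc N)" | q where "q \<le> k" "x = real q"
        using x by (auto simp: Z_def)
      then have "0 \<le> x \<and> x \<le> real k"
      proof cases
        case 1
        have "x \<le> 1" "0 \<le> x" unfolding 1(2) using 1(1) by simp_all
        moreover have "1 \<le> real k" using k by simp
        ultimately show ?thesis by linarith
      qed simp
      then show "0 \<le> x" "x \<le> real k" by auto
    qed
    then have "complex_of_real x \<in> closed_segment (Complex 0 0) (Complex (real k) 0)"
      by (subst closed_segment_horizontal) auto
    moreover have "Complex 0 0 = g 0" "Complex (real k) 0 = g 1" using ends by (auto simp: complex_eq_iff)
    ultimately obtain u where u: "u \<in> {0..1}" "g u = of_real x" using g(2) by (metis imageE)
    then have "\<gamma> u = v" using lifts_unique[of "g u"] g(1)[OF u(1)] v(2) by simp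
    then show ?thesis using v u(1) by blast
  qed
  define f where "f = (\<lambda>x. SOME v. v \<in> ?S \<and> lifts (of_real x) v)"
  have f: "f x \<in> ?S \<and> lifts (of_real x) (f x)" if "x \<in> Z" for x
    unfolding f_def by (rule someI_ex[OF ex[OF that]])
  have "inj_on f Z"
  proof (rule inj_onI)
    fix x x' assume "x \<in> Z" "x' \<in> Z" "f x = f x'"
    then have "complex_of_real x = of_real x'" using fiber[of "of_real x" "f x" "of_real x'"] f by metis
    then show "x = x'" by simp
  qed
  then have "card Z \<le> card ?S" using f card_surface_vertices(1) by (intro card_inj_on_le[of f]) auto
  moreover have "card Z = N + 1 + k"
  proof -
    have "(\<lambda>r. real r / real (Suc N)) ` {0..N} \<inter> real ` {1..k} = {}"
    proof -
      have "real r / real (Suc N) < real q" if "r \<le> N" "1 \<le> q" for r q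
      proof -
        have "real r / real (Suc N) < 1" using that by simp
        then show ?thesis using that(2) by linarith
      qed
      then show ?thesis by fastforce
    qed
    moreover have "inj_on (\<lambda>r. real r / real (Suc N)) {0..N}" by (auto simp: inj_on_def simp del: of_nat_Suc)
    ultimately show ?thesis unfolding Z_def by (subst card_Un_disjoint) (auto simp: card_image)
  qed
  ultimately have "enat (k + N + 1) \<le> enat (card ?S)" by simp
  then show "enat (k + N + 1) \<le> path_complexity P \<gamma>"
    using path_complexity_ge_vertices by (rule order_trans)
qed

text \<open>Lifts of \<open>s\<close> have height 0 and lifts of \<open>t\<close> height 1, and
  \<open>\<i>\<close> is a lift of \<open>t\<close> because \<open>A\<close> is a multiple of
  \<open>k\<close>. So shortest lifts are vertical, at an integer abscissa.\<close>

lemma cyclic_lower_bound: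
  assumes cyc: "cyclic" and A: "A = real (k * B)" and B: "1 \<le> B"
  defines "s \<equiv> to_surface P (0, 0)" and "t \<equiv> to_surface P (0, Complex A 1)"
  shows "s \<in> topspace (surface P)" "t \<in> topspace (surface P)" "\<exists>\<gamma>. shortest_path P s t \<gamma>"
    "\<And>\<gamma>. shortest_path P s t \<gamma> \<Longrightarrow> enat (k * B) \<le> path_complexity P \<gamma>"
proof -
  have A0: "A > 0" using A B k by simp
  have ls: "lifts 0 s" using lifts_exists[of 0 0] k by (simp add: s_def strip_def)
  have "lifts (Complex A 1) t" using lifts_exists[of 0 "Complex A 1"] k by (simp add: t_def strip_def)
  from lifts_translate[OF cyc this, of "- int B"]
  have lt': "lifts (Complex A 1 + of_int (int k * - int B)) t" .
  have eq: "Complex A 1 + of_int (int k * - int B) = \<i>" by (simp add: complex_eq_iff A)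
  have lt: "lifts \<i> t" using lt' unfolding eq .
  show "s \<in> topspace (surface P)" "t \<in> topspace (surface P)" using ls lt lifts_in_topspace by auto
  have Im_s: "Im z = 0 \<and> Re z \<in> \<int>" if "lifts z s" for z
    using lifts_fiber[OF that ls] by auto
  have Im_t: "Im z = 1" if "lifts z t" for z using lifts_fiber[OF that lt] by auto
  show "\<exists>\<gamma>. shortest_path P s t \<gamma>"
  proof (rule shortest_path_exists[OF ls lt])
    fix w w' assume "lifts w s" "lifts w' t"
    then have "\<bar>Im (w - w')\<bar> = 1" using Im_s Im_t by simp
    then show "dist 0 \<i> \<le> dist w w'" using abs_Im_le_cmod[of "w - w'"] by (simp add: dist_norm)
  qed
  fix \<gamma> assume sp: "shortest_path P s t \<gamma>"
  obtain g where g: "\<And>u. u \<in> {0..1} \<Longrightarrow> lifts (g u) (\<gamma> u)" "g ` {0..1} = closed_segment (g 0) (g 1)"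
      "\<And>z z'. lifts z s \<Longrightarrow> lifts z' t \<Longrightarrow> dist (g 0) (g 1) \<le> dist z z'"
    using shortest_path_lift[OF sp] by blast
  have "\<gamma> 0 = s" "\<gamma> 1 = t" using sp by (auto simp: shortest_path_def path_between_def)
  then have ends: "lifts (g 0) s" "lifts (g 1) t" using g(1)[of 0] g(1)[of 1] by auto
  have Im_g: "Im (g 0) = 0" "Im (g 1) = 1" "Re (g 0) \<in> \<int>" using Im_s Im_t ends by auto
  have "cmod (g 0 - g 1) \<le> cmod (- \<i>)" using g(3)[OF ls lt] by (simp add: dist_norm)
  then have "\<bar>Re (g 0 - g 1)\<bar> \<le> \<bar>Re (- \<i>)\<bar>" by (subst (asm) cmod_Re_le_iff) (auto simp: Im_g)
  then have Re_g1: "Re (g 1) = Re (g 0)" by simp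
  have Re_g: "Re (g u) = Re (g 0)" if "u \<in> {0..1}" for u
  proof -
    have "g u \<in> closed_segment (g 0) (g 1)" using g(2) that by blast
    then obtain l where l: "g u = (1 - l) *\<^sub>R g 0 + l *\<^sub>R g 1" by (auto simp: in_segment)
    show ?thesis unfolding l using Re_g1 by (simp add: algebra_simps)
  qed
  \<comment> \<open>The vertical lift meets slanted sides at the heights \<open>r / A\<close>; the
    tests are placed halfway between consecutive ones.\<close>
  define y where "y = (\<lambda>r. (real r + 1 / 2) / A)"
  have Ay: "A * y r = real r + 1 / 2" for r using A0 by (simp add: y_def)
  show "enat (k * B) \<le> path_complexity P \<gamma>"
  proof (rule path_complexity_ge_tests[where T = "\<lambda>r u. Im (g u) = y r"])
    fix r assume r: "r < k * B"
    then have "real (Suc r) \<le> real (k * B)" by (simp only: of_nat_le_iff Suc_le_eq)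
    then have "real r + 1 \<le> A" unfolding A by simp
    then have y01: "0 \<le> y r" "y r \<le> 1" using A0 by (auto simp: y_def field_simps)
    have "Complex (Re (g 0)) (y r) = (1 - y r) *\<^sub>R g 0 + y r *\<^sub>R g 1"
      using Im_g Re_g1 by (simp add: complex_eq_iff algebra_simps)
    then have "Complex (Re (g 0)) (y r) \<in> closed_segment (g 0) (g 1)"
      unfolding in_segment using y01 by blast
    then obtain u where "u \<in> {0..1}" "g u = Complex (Re (g 0)) (y r)" using g(2) by (metis imageE)
    then show "\<exists>u\<in>{0..1}. Im (g u) = y r" by (intro bexI[of _ u]) auto
  next
    fix i x a w b assume st: "straight_piece P \<gamma> i x a w b" and ab: "0 \<le> a" "b \<le> 1"
    have i: "i < k" and sub: "closed_segment x w \<subseteq> strip A"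
      using st fragment by (auto simp: straight_piece_def num_fragments)
    have lift: "Re z \<in> \<int>" "Im z = Im (g u)" if "u \<in> {a..b}" "\<gamma> u = to_surface P (i, z)" for u z
    proof -
      have u: "u \<in> {0..1}" using that ab by auto
      from lifts_develop[OF g(1)[OF u] that(2)] obtain j where "g u = z + of_int j" by blast
      then have "Re z = Re (g 0) - of_int j" "Im z = Im (g u)" using Re_g[OF u] by simp_all
      then show "Re z \<in> \<int>" "Im z = Im (g u)" using Im_g(3) by auto
    qed
    \<comment> \<open>Copies have integer offsets, so within its fragment the piece stays on integer
      abscissae, and by continuity on a single one.\<close>
    have int: "Re (linepath x w l) \<in> \<int>" if "0 \<le> l" "l \<le> 1" for l
      using straight_piece_surj[OF st that] lift(1) by metis
    have Re_x: "Re w = Re x"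
    proof (rule ccontr)
      assume "Re w \<noteq> Re x"
      define d where "d = Re w - Re x"
      have "Re x \<in> \<int>" "Re w \<in> \<int>" using int[of 0] int[of 1] by (simp_all add: linepath_0' linepath_1')
      then have "d \<in> \<int>" and d0: "d \<noteq> 0" using \<open>Re w \<noteq> Re x\<close> by (simp_all add: d_def)
      then have "1 \<le> \<bar>d\<bar>" by (simp add: Ints_nonzero_abs_ge1)
      \<comment> \<open>At this parameter the abscissa would be half a unit away from
        \<open>Re x\<close>, hence no integer.\<close>
      define l where "l = 1 / (2 * \<bar>d\<bar>)"
      have l: "0 \<le> l" "l \<le> 1" using \<open>1 \<le> \<bar>d\<bar>\<close> by (auto simp: l_def field_simps)
      have "Re (linepath x w l) = Re x + l * d" by (simp add: linepath_def d_def algebra_simps)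
      moreover have "l * d = sgn d / 2" using d0 by (simp add: l_def sgn_if)
      ultimately have "Re x + sgn d / 2 \<in> \<int>" using int[OF l] by simp
      then have "sgn d / 2 \<in> \<int>" using \<open>Re x \<in> \<int>\<close> by (metis Ints_diff add_diff_cancel_left')
      then have "\<bar>sgn d / 2\<bar> \<ge> 1" using d0 by (intro Ints_nonzero_abs_ge1) (auto simp: sgn_if)
      then show False using d0 by (auto simp: sgn_if split: if_splits)
    qed
    \<comment> \<open>At height \<open>y r\<close> the strip extends from \<open>r + 1 / 2\<close>
      to \<open>r + 3 / 2\<close>, and the only integer in between is \<open>r + 1\<close>. So the
      abscissa of the piece determines the test.\<close>
    have Re_test: "Re x = real r + 1" if "u \<in> {a..b}" "Im (g u) = y r" for u r
    proof -
      have u: "u \<in> {a..b}" by (rule that(1))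
      obtain l where l: "0 \<le> l" "l \<le> 1" "\<gamma> u = to_surface P (i, linepath x w l)"
        using straight_piece_point[OF st u] by metis
      let ?z = "linepath x w l"
      have z: "Re ?z = Re x" using Re_x by (simp add: linepath_def algebra_simps)
      have "Im ?z = y r" using lift(2)[OF that(1) l(3)] that(2) by simp
      moreover have "?z \<in> strip A" using sub l(1,2) linepath_in_path[of l x w] by auto
      ultimately have "real r + 1 / 2 \<le> Re x" "Re x \<le> real r + 1 / 2 + 1"
        using z Ay[of r] by (auto simp: strip_def)
      moreover obtain q :: int where "Re x = of_int q"
        using lift(1)[OF u l(3)] z by (auto elim: Ints_cases)
      ultimately have "real_of_int (int r) < of_int q" "real_of_int q < of_int (int r + 2)" by simp_all
      then have "q = int r + 1" unfolding of_int_less_iff by simp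
      then show ?thesis using \<open>Re x = of_int q\<close> by simp
    qed
    have "r = r'" if "\<exists>u\<in>{a..b}. Im (g u) = y r" "\<exists>u\<in>{a..b}. Im (g u) = y r'" for r r'
      using Re_test that by (metis add_right_cancel of_nat_eq_iff)
    then show "card {r. r < k * B \<and> (\<exists>u\<in>{a..b}. Im (g u) = y r)} \<le> 1"
      by (subst One_nat_def, subst card_le_Suc0_iff_eq) auto
  qed
qed

end

section \<open>The two bounds, with the parameters of the examples\<close>

theorem lemma2:
  shows "(\<exists>C::nat. \<forall>P h s t \<gamma>.
            is_portalgon P \<longrightarrow> happy h P \<longrightarrow>
            s \<in> topspace (surface P) \<longrightarrow> t \<in> topspace (surface P) \<longrightarrow>
            min_complexity_shortest_path P s t \<gamma> \<longrightarrow>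
            path_complexity P \<gamma> \<le> enat (C * (num_vertices P + h * num_portal_edges P)))
       \<and> (\<exists>C::nat. \<forall>n m h. even m \<longrightarrow> 2 * m + 4 \<le> n \<longrightarrow> 1 \<le> h \<longrightarrow>
            (\<exists>P s t. is_portalgon P \<and> connected_space (surface P) \<and> happy h P \<and>
               num_vertices P = n \<and> num_portal_edges P = m \<and>
               s \<in> topspace (surface P) \<and> t \<in> topspace (surface P) \<and>
               (\<exists>\<gamma>. min_complexity_shortest_path P s t \<gamma>) \<and>
               (\<forall>\<gamma>. min_complexity_shortest_path P s t \<gamma> \<longrightarrow>
                  enat (n + h * m) \<le> enat C * path_complexity P \<gamma>)))"
proof
  show "\<exists>C::nat. \<forall>P h s t \<gamma>.
            is_portalgon P \<longrightarrow> happy h P \<longrightarrow>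
            s \<in> topspace (surface P) \<longrightarrow> t \<in> topspace (surface P) \<longrightarrow>
            min_complexity_shortest_path P s t \<gamma> \<longrightarrow>
            path_complexity P \<gamma> \<le> enat (C * (num_vertices P + h * num_portal_edges P))"
    using valid_portalgon.path_complexity_upper_bound[OF valid_portalgon.intro] by blast
  show "\<exists>C::nat. \<forall>n m h. even m \<longrightarrow> 2 * m + 4 \<le> n \<longrightarrow> 1 \<le> h \<longrightarrow>
            (\<exists>P s t. is_portalgon P \<and> connected_space (surface P) \<and> happy h P \<and>
               num_vertices P = n \<and> num_portal_edges P = m \<and>
               s \<in> topspace (surface P) \<and> t \<in> topspace (surface P) \<and>
               (\<exists>\<gamma>. min_complexity_shortest_path P s t \<gamma>) \<and>
               (\<forall>\<gamma>. min_complexity_shortest_path P s t \<gamma> \<longrightarrow>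
                  enat (n + h * m) \<le> enat C * path_complexity P \<gamma>))"
  \<comment> \<open>For the annulus \<open>n + h * m\<close> is at most \<open>8 * (m2 * B)\<close>;
    for the row it is at most \<open>14 * m2 + 4 + N\<close> or \<open>8 * m2 + 8 + 2 * N\<close>.
    So 16 leaves room in all cases.\<close>
  proof (intro exI[of _ 16] allI impI)
    fix n m h :: nat assume m: "even m" and n: "2 * m + 4 \<le> n" and h: "1 \<le> h"
    obtain m2 where m2: "m = 2 * m2" using m by blast
    have bound: "enat (n + h * m) \<le> enat 16 * c" if "enat K \<le> c" "n + h * m \<le> 16 * K" for c K
    proof -
      have "enat (n + h * m) \<le> enat 16 * enat K" using that(2) by simp
      also have "\<dots> \<le> enat 16 * c" using that(1) by (rule mult_left_mono) simp
      finally show ?thesis .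
    qed
    show "\<exists>P s t. is_portalgon P \<and> connected_space (surface P) \<and> happy h P \<and>
               num_vertices P = n \<and> num_portal_edges P = m \<and>
               s \<in> topspace (surface P) \<and> t \<in> topspace (surface P) \<and>
               (\<exists>\<gamma>. min_complexity_shortest_path P s t \<gamma>) \<and>
               (\<forall>\<gamma>. min_complexity_shortest_path P s t \<gamma> \<longrightarrow>
                  enat (n + h * m) \<le> enat 16 * path_complexity P \<gamma>)"
    \<comment> \<open>The bound \<open>6 \<le> h\<close> guarantees
      \<open>h \<le> 2 * (h - 2)\<close>, so \<open>B\<close> is of the order of \<open>h\<close>.
      For smaller \<open>h\<close> the product is at most \<open>5 * m\<close>, of the order of
      \<open>n\<close>, and the row suffices.\<close>
    proof (cases "n < h * m \<and> 6 \<le> h")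
      case True
      define B where "B = h - 2"
      \<comment> \<open>The annulus of \<open>m2\<close> strips has \<open>4 * m2\<close> corners;
        the remaining vertices go to the bottom of the first strip.\<close>
      define N where "N = n - 4 * m2"
      have "1 \<le> m2" using True m2 by (cases m2) auto
      interpret strips "real (m2 * B)" m2 N True by unfold_locales fact
      have B: "1 \<le> B" "B + 2 \<le> h" using True by (auto simp: B_def)
      have K: "n + h * m \<le> 16 * (m2 * B)"
      proof -
        have "n + h * m \<le> 4 * (m2 * h)" using True m2 by (simp add: mult.commute mult.left_commute)
        also have "\<dots> \<le> 4 * (m2 * (2 * B))" using True by (intro mult_left_mono) (auto simp: B_def)
        finally show ?thesis by simp
      qed
      note lb = cyclic_lower_bound[OF TrueI refl B(1)]
      show ?thesis
      proof (rule exI, rule exI, rule exI, intro conjI allI impI)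
        show "is_portalgon P" by (rule is_portalgon)
        show "connected_space (surface P)" by (rule connected_space_surface)
        show "happy h P" by (rule happy_cyclic[OF TrueI refl B(2)])
        show "num_vertices P = n" using num_vertices n m2 unfolding N_def by simp
        show "num_portal_edges P = m" unfolding num_portal_edges using m2 by simp
        show "\<exists>\<gamma>. min_complexity_shortest_path P (to_surface P (0, 0)) (to_surface P (0, Complex (real (m2 * B)) 1)) \<gamma>"
          using lb(3) exists_min_complexity_shortest_path by blast
        fix \<gamma> assume "min_complexity_shortest_path P (to_surface P (0, 0)) (to_surface P (0, Complex (real (m2 * B)) 1)) \<gamma>"
        then show "enat (n + h * m) \<le> enat 16 * path_complexity P \<gamma>"
          using bound[OF lb(4) K] by (simp add: min_complexity_shortest_path_def)
      qed (rule lb)+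
    next
      case False
      \<comment> \<open>A row with \<open>m2\<close> portals has \<open>m2 + 1\<close> squares and
        hence \<open>2 * m + 4\<close> corners, which is where the bound on \<open>n\<close> comes
        from.\<close>
      define N where "N = n - 2 * m - 4"
      interpret strips 0 "m2 + 1" N False by unfold_locales simp
      have "n + h * m \<le> 16 * (m2 + 1 + N + 1)"
      proof -
        have "h * m \<le> 5 * m" if "h < 6" using that by (intro mult_right_mono) auto
        then have "h * m \<le> n \<or> h * m \<le> 5 * m" using False by linarith
        moreover have "n = 4 * m2 + 4 + N" using n m2 by (simp add: N_def)
        moreover have "n + x \<le> 16 * (m2 + 1 + N + 1)"
          if "x \<le> n \<or> x \<le> 5 * m" "n = 4 * m2 + 4 + N" for x
          using that m2 by auto
        ultimately show ?thesis by blast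
      qed
      have not_False: "\<not> False" by simp
      note K = \<open>n + h * m \<le> 16 * (m2 + 1 + N + 1)\<close> and lb = open_lower_bound[OF not_False refl]
      show ?thesis
      proof (rule exI, rule exI, rule exI, intro conjI allI impI)
        show "is_portalgon P" by (rule is_portalgon)
        show "connected_space (surface P)" by (rule connected_space_surface)
        show "happy h P" by (rule happy_open) (use h in auto)
        show "num_vertices P = n" using num_vertices n m2 unfolding N_def by simp
        show "num_portal_edges P = m" unfolding num_portal_edges using m2 by simp
        show "\<exists>\<gamma>. min_complexity_shortest_path P (to_surface P (0, 0)) (to_surface P (m2 + 1 - 1, 1)) \<gamma>"
          using lb(3) exists_min_complexity_shortest_path by blast
        fix \<gamma> assume "min_complexity_shortest_path P (to_surface P (0, 0)) (to_surface P (m2 + 1 - 1, 1)) \<gamma>"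
        then show "enat (n + h * m) \<le> enat 16 * path_complexity P \<gamma>"
          using bound[OF lb(4) K] by (simp add: min_complexity_shortest_path_def)
      qed (rule lb)+
    qed
  qed
qed

end
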